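(* Let $A=I_d$ (the $3\times3$ identity matrix) and $B=\mathrm{diag}(\theta_1,1,\theta_2)$, where $\theta_1,\theta_2\in\mathbb{R}$ satisfy $\theta_1>0$, $\theta_2>0$ and $(1-\theta_1)(1-\theta_2)>0$. Let $W:\mathbb{R}^{3\times3}\to[0,\infty)$ be continuous and satisfy: (i) $\{W=0\}=\{A,B\}$; (ii) $\frac1{C_1}|\xi|^2-C_1\le W(\xi)\le C_1|\xi|^2+C_1$ for all $\xi\in\mathbb{R}^{3\times3}$ and some constant $C_1>0$; (iii) there exist $\varrho>0$ and $C_2>0$ such that $\frac1{C_2}\mathrm{dist}(\xi,\{A,B\})^2\le W(\xi)\le C_2\,\mathrm{dist}(\xi,\{A,B\})^2$ whenever $\mathrm{dist}(\xi,\{A,B\})\le\varrho$. Let $h_n\to0^+$ and $\varepsilon_n\to0^+$ be arbitrary sequences such that $h_n/\varepsilon_n\to\infty$. Then, for any sequence $\{u_n\}\subset H^2(\Omega;\mathbb{R}^3)$ such that $\sup_nF_{\varepsilon_n}^{h_n}(u_n)<\infty$, there exist a subsequence (not relabeled) and $\xi_0\in\{A,B\}$ such that $\nabla_{h_n}u_n\to\xi_0$ in $L^2(\Omega;\mathbb{R}^{3\times3})$.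
   Context: $I:=(-\frac12,\frac12)$, $\omega\subset\mathbb{R}^2$ is a bounded convex open set, $\Omega:=\omega\times I$; $|\cdot|$ is the Euclidean norm. For $h,\varepsilon>0$ and $u\in H^2(\Omega;\mathbb{R}^3)$: $\nabla_hu:=(\partial_1u,\partial_2u,\frac1h\partial_3u)$, $|\nabla^2_hu|^2:=\sum_{i,j\in\{1,2\}}|\partial^2_{ij}u|^2+\frac{2}{h^2}\sum_{i\in\{1,2\}}|\partial^2_{i3}u|^2+\frac1{h^4}|\partial^2_{33}u|^2$, and $F_\varepsilon^h(u):=\int_\Omega\frac1\varepsilon W(\nabla_hu)+\varepsilon|\nabla_h^2u|^2\,dx$. *)

theory Defs
  imports "HOL-Analysis.Analysis"
begin

section \<open>Sobolev functions\<close>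

definition partial_deriv :: "'n::finite \<Rightarrow> (real^'n \<Rightarrow> real) \<Rightarrow> real^'n \<Rightarrow> real" where
  "partial_deriv i \<phi> x = frechet_derivative \<phi> (at x) (axis i 1)"

text \<open>A list of directions plays the role of a multi-index; the order of its entries is irrelevant
  on smooth functions.\<close>

abbreviation iter_partial :: "'n::finite list \<Rightarrow> (real^'n \<Rightarrow> real) \<Rightarrow> real^'n \<Rightarrow> real" where
  "iter_partial js \<phi> \<equiv> foldr partial_deriv js \<phi>"

text \<open>Total differentiability of all iterated partial derivatives (which forces their continuity)
  expresses that \<open>\<phi>\<close> is infinitely often continuously differentiable.\<close>

definition test_functions :: "(real^'n::finite) set \<Rightarrow> (real^'n \<Rightarrow> real) set" where
  "test_functions S = {\<phi>. (\<forall>js x. iter_partial js \<phi> differentiable (at x)) \<and>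
     (\<exists>K. compact K \<and> K \<subseteq> S \<and> (\<forall>x. x \<notin> K \<longrightarrow> \<phi> x = 0))}"

definition locally_integrable_on ::
    "(real^'n::finite \<Rightarrow> 'b::euclidean_space) \<Rightarrow> (real^'n) set \<Rightarrow> bool"
    (infix "locally'_integrable'_on" 50) where
  "f locally_integrable_on S \<longleftrightarrow> (\<forall>K. compact K \<and> K \<subseteq> S \<longrightarrow> integrable (lebesgue_on K) f)"

definition has_weak_deriv ::
    "(real^'n::finite) set \<Rightarrow> 'n list \<Rightarrow> (real^'n \<Rightarrow> 'b::euclidean_space) \<Rightarrow> (real^'n \<Rightarrow> 'b) \<Rightarrow> bool"
  where
  "has_weak_deriv S js f g \<longleftrightarrow> f locally_integrable_on S \<and> g locally_integrable_on S \<and>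
     (\<forall>\<phi>\<in>test_functions S.
        (LINT x|lebesgue_on S. iter_partial js \<phi> x *\<^sub>R f x) =
        (-1) ^ length js *\<^sub>R (LINT x|lebesgue_on S. \<phi> x *\<^sub>R g x))"

text \<open>The weak derivative is unique only up to null sets; a representative is chosen. It is
  only meaningful where a weak derivative exists, as it does for functions in \<open>sobolev_H\<close>.\<close>

definition weak_deriv ::
    "(real^'n::finite) set \<Rightarrow> 'n list \<Rightarrow> (real^'n \<Rightarrow> 'b::euclidean_space) \<Rightarrow> real^'n \<Rightarrow> 'b" where
  "weak_deriv S js f = (SOME g. has_weak_deriv S js f g)"

definition L2 :: "(real^'n::finite) set \<Rightarrow> (real^'n \<Rightarrow> 'b::euclidean_space) set" where
  "L2 S = {f \<in> borel_measurable (lebesgue_on S). integrable (lebesgue_on S) (\<lambda>x. (norm (f x))\<^sup>2)}"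

definition L2_norm :: "(real^'n::finite) set \<Rightarrow> (real^'n \<Rightarrow> 'b::euclidean_space) \<Rightarrow> real" where
  "L2_norm S f = sqrt (LINT x|lebesgue_on S. (norm (f x))\<^sup>2)"

definition L2_tendsto ::
    "(real^'n::finite) set \<Rightarrow> (nat \<Rightarrow> real^'n \<Rightarrow> 'b::euclidean_space) \<Rightarrow> (real^'n \<Rightarrow> 'b) \<Rightarrow> bool" where
  "L2_tendsto S f g \<longleftrightarrow> (\<forall>n. f n \<in> L2 S) \<and> g \<in> L2 S \<and>
     (\<lambda>n. L2_norm S (\<lambda>x. f n x - g x)) \<longlonglongrightarrow> 0"

definition sobolev_H :: "nat \<Rightarrow> (real^'n::finite) set \<Rightarrow> (real^'n \<Rightarrow> 'b::euclidean_space) set" where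
  "sobolev_H k S =
     {f \<in> L2 S. \<forall>js. length js \<le> k \<longrightarrow> (\<exists>g\<in>L2 S. has_weak_deriv S js f g)}"


section \<open>The thin-film energy\<close>

definition film_domain :: "(real^2) set \<Rightarrow> (real^3) set" where
  "film_domain \<omega> = {x. vector [x$1, x$2] \<in> \<omega> \<and> - (1/2) < x$3 \<and> x$3 < 1/2}"

text \<open>The columns are \<open>\<partial>\<^sub>1u\<close>, \<open>\<partial>\<^sub>2u\<close> and \<open>(1/h) \<partial>\<^sub>3u\<close>. The norm of \<open>real^3^3\<close> is the
  Frobenius norm.\<close>

definition scaled_grad :: "(real^3) set \<Rightarrow> real \<Rightarrow> (real^3 \<Rightarrow> real^3) \<Rightarrow> real^3 \<Rightarrow> real^3^3" where
  "scaled_grad \<Omega> h u x =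
     (\<chi> i j. (if j = 3 then 1 / h else 1) * (weak_deriv \<Omega> [j] u x $ i))"

definition scaled_hess_sq :: "(real^3) set \<Rightarrow> real \<Rightarrow> (real^3 \<Rightarrow> real^3) \<Rightarrow> real^3 \<Rightarrow> real" where
  "scaled_hess_sq \<Omega> h u x =
     (\<Sum>i\<in>{1,2}. \<Sum>j\<in>{1,2}. (norm (weak_deriv \<Omega> [i,j] u x))\<^sup>2)
     + 2 / h\<^sup>2 * (\<Sum>i\<in>{1,2}. (norm (weak_deriv \<Omega> [i,3] u x))\<^sup>2)
     + 1 / h^4 * (norm (weak_deriv \<Omega> [3,3] u x))\<^sup>2"

text \<open>The integrand is nonnegative for \<open>W \<ge> 0\<close> and \<open>\<epsilon> > 0\<close>, so the integral is taken in the
  extended nonnegative reals.\<close>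

definition film_energy ::
    "(real^3^3 \<Rightarrow> real) \<Rightarrow> (real^3) set \<Rightarrow> real \<Rightarrow> real \<Rightarrow> (real^3 \<Rightarrow> real^3) \<Rightarrow> ennreal" where
  "film_energy W \<Omega> \<epsilon> h u =
     (\<integral>\<^sup>+x. ennreal (1 / \<epsilon> * W (scaled_grad \<Omega> h u x) + \<epsilon> * scaled_hess_sq \<Omega> h u x) \<partial>lebesgue_on \<Omega>)"

definition diag3 :: "real \<Rightarrow> real \<Rightarrow> real \<Rightarrow> real^3^3" where
  "diag3 a b c = (\<chi> i j. if i = j then vector [a, b, c] $ i else 0)"

end

theory Submission
  imports Defs "HOL-Computational_Algebra.Polynomial"
begin

text \<open>By coercivity the squared distance of \<open>\<nabla>\<^sub>hu\<close> to the wells has integral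
  \<open>O(\<epsilon>)\<close>. Normalise \<open>f = (u\<^sub>1 - x\<^sub>1)/a\<close> and \<open>g =
  (u\<^sub>3 - h x\<^sub>3)/b\<close> with \<open>a = \<theta>\<^sub>1 - 1\<close>, \<open>b =
  \<theta>\<^sub>2 - 1\<close>. Up to the distance to the wells, \<open>\<partial>\<^sub>1f\<close> and
  \<open>\<partial>\<^sub>3g/h\<close> are the same phase indicator with values 0 and 1, while
  \<open>\<partial>\<^sub>3f/h\<close>, \<open>\<partial>\<^sub>1g\<close> and
  \<open>\<partial>\<^sub>2g\<close> are small. Let \<open>Q\<close> be a weighted vertical average of
  \<open>\<partial>\<^sub>3g/h\<close>. Integrating by parts in the vertical direction,
  \<open>\<nabla>Q\<close> is of the order of the distance divided by \<open>h\<close>. As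
  \<open>\<partial>\<^sub>1f \<cdot> \<partial>\<^sub>3g\<close> is a null Lagrangian up to small terms,
  \<open>Q - Q\<^sup>2\<close> is small up to a derivative \<open>\<partial>\<^sub>1T\<close> with \<open>T =
  O(h)\<close>, so the distance controls how far the average \<open>m\<close> of \<open>Q\<close> over a
  horizontal length \<open>h\<close> is from 0 and 1. For a transition function \<open>\<Phi>\<close> with
  \<open>\<Phi>' = O(\<bar>s - s\<^sup>2\<bar>)\<close>, the gradient of \<open>\<Phi>(m)\<close> is then
  quadratic in the distance, divided by \<open>h\<close>, and \<open>\<Phi>(m)\<close> has total variation
  \<open>O(\<epsilon>/h) \<rightarrow> 0\<close>. Hence the two phases cannot coexist in any small box, and
  since \<open>\<Omega>\<close> is connected one of them disappears along a subsequence.\<close>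

section \<open>Smooth product functions\<close>

text \<open>The matrix \<open>B - A\<close> has rank two, so the wells are incompatible in the bulk.
  Its first two columns, however, are those of a rank-one matrix with normal along the first axis,
  so in the plane an interface is compatible; excluding it must exploit the third column and the
  finite thickness. The indicator is read off from the scaled vertical derivative of g because a
  vertical integration by parts expresses the horizontal gradient of its average by the small first
  and second derivatives of g, at the price 1/h; differentiating an average of the horizontal
  derivative of f would leave second derivatives that the distance does not control. A gradient
  linear in the distance would only bound the variation by sqrt(\<epsilon>)/h, which need not
  vanish; the slope of the transition function supplies the second power and thus \<epsilon>/h. The
  length h is the one at which the oscillation of Q, with slope O(1/h), and the difference quotient
  of T, of size O(h), are both of the order of the distance. The estimates are made for smooth
  functions, where the mixed derivative exists classically, and transferred by mollification with an
  error chosen after h.\<close>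

primrec times_differentiable :: "nat \<Rightarrow> (real \<Rightarrow> real) \<Rightarrow> bool" where
  "times_differentiable 0 f = True"
| "times_differentiable (Suc n) f =
    (\<exists>f'. (\<forall>t. (f has_real_derivative f' t) (at t)) \<and> times_differentiable n f')"

definition smooth :: "(real \<Rightarrow> real) \<Rightarrow> bool" where
  "smooth f \<longleftrightarrow> (\<forall>n. times_differentiable n f)"

lemma times_differentiable_SucD: "times_differentiable (Suc n) f \<Longrightarrow> times_differentiable n f"
  by (induction n arbitrary: f) auto

lemma times_differentiable_const: "times_differentiable n (\<lambda>t. c)"
proof (induction n arbitrary: c)
  case (Suc n)
  show ?case
    by (auto intro!: exI[of _ "\<lambda>t. 0"] Suc simp del: times_differentiable.simps(1))
qed simp

lemma times_differentiable_add:
  "times_differentiable n f \<Longrightarrow> times_differentiable n g \<Longrightarrow> times_differentiable n (\<lambda>t. f t + g t)"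
proof (induction n arbitrary: f g)
  case (Suc n)
  then obtain f' g' where *: "\<forall>t. (f has_real_derivative f' t) (at t)" "times_differentiable n f'"
    "\<forall>t. (g has_real_derivative g' t) (at t)" "times_differentiable n g'"
    by auto
  then have "times_differentiable n (\<lambda>t. f' t + g' t)"
    by (intro Suc.IH)
  with * show ?case
    by (auto intro!: exI[of _ "\<lambda>t. f' t + g' t"] derivative_intros)
qed simp

lemma times_differentiable_mult:
  "times_differentiable n f \<Longrightarrow> times_differentiable n g \<Longrightarrow> times_differentiable n (\<lambda>t. f t * g t)"
proof (induction n arbitrary: f g)
  case (Suc n)
  then obtain f' g' where *: "\<forall>t. (f has_real_derivative f' t) (at t)" "times_differentiable n f'"
    "\<forall>t. (g has_real_derivative g' t) (at t)" "times_differentiable n g'"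
    by auto
  have "times_differentiable n (\<lambda>t. f t * g' t + f' t * g t)"
    using * Suc.prems[THEN times_differentiable_SucD] by (intro times_differentiable_add Suc.IH)
  with * show ?case
    by (auto intro!: exI[of _ "\<lambda>t. f t * g' t + f' t * g t"] DERIV_mult')
qed simp

lemma times_differentiable_affine:
  "times_differentiable n f \<Longrightarrow> times_differentiable n (\<lambda>t. f (a + b * t))"
proof (induction n arbitrary: f)
  case (Suc n)
  then obtain f' where *: "\<forall>t. (f has_real_derivative f' t) (at t)" "times_differentiable n f'"
    by auto
  have "times_differentiable n (\<lambda>t. b * f' (a + b * t))"
    by (intro times_differentiable_mult times_differentiable_const Suc.IH *)
  moreover have "((\<lambda>t. f (a + b * t)) has_real_derivative b * f' (a + b * t)) (at t)" for t
  proof -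
    have "((\<lambda>t. a + b * t) has_real_derivative b) (at t)"
      by (auto intro!: derivative_eq_intros)
    from DERIV_chain2[OF *(1)[rule_format] this] show ?thesis
      by (simp add: mult.commute)
  qed
  ultimately show ?case
    by (auto intro!: exI[of _ "\<lambda>t. b * f' (a + b * t)"])
qed simp

lemma smooth_mult: "smooth f \<Longrightarrow> smooth g \<Longrightarrow> smooth (\<lambda>t. f t * g t)"
  by (simp add: smooth_def times_differentiable_mult)

lemma smooth_const: "smooth (\<lambda>t. c)"
  by (simp add: smooth_def times_differentiable_const)

lemma smooth_affine: "smooth f \<Longrightarrow> smooth (\<lambda>t. f (a + b * t))"
  by (simp add: smooth_def times_differentiable_affine)

lemma smooth_DERIV: "smooth f \<Longrightarrow> (f has_real_derivative deriv f t) (at t)"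
  unfolding smooth_def by (metis DERIV_imp_deriv times_differentiable.simps(2))

lemma smooth_deriv: "smooth f \<Longrightarrow> smooth (deriv f)"
proof -
  assume f: "smooth f"
  have "times_differentiable n (deriv f)" for n
  proof -
    obtain f' where *: "\<forall>t. (f has_real_derivative f' t) (at t)" "times_differentiable n f'"
      using f unfolding smooth_def by (metis times_differentiable.simps(2))
    then have "f' = deriv f"
      by (metis DERIV_imp_deriv ext)
    with * show ?thesis by simp
  qed
  then show ?thesis by (simp add: smooth_def)
qed

lemma smooth_continuous: "smooth f \<Longrightarrow> continuous_on S f"
  using smooth_DERIV by (meson DERIV_isCont continuous_at_imp_continuous_on)

section \<open>A flat exponential function and a compactly supported bump\<close>

lemma poly_over_exp_tendsto_0:
  fixes p :: "real poly"
  shows "((\<lambda>x. poly p x * exp (- x)) \<longlongrightarrow> 0) at_top"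
proof -
  have "((\<lambda>x. \<Sum>i\<le>degree p. coeff p i * (x ^ i / exp x)) \<longlongrightarrow> (\<Sum>i\<le>degree p. coeff p i * 0)) at_top"
    by (intro tendsto_intros tendsto_power_div_exp_0)
  then show ?thesis
    by (simp add: poly_altdef exp_minus sum_distrib_right divide_inverse mult.assoc)
qed

text \<open>The polynomial coefficient closes the family under differentiation: the chain rule
  produces the factor \<open>1 / t^2\<close>, which is \<open>[:0, 0, 1:]\<close> evaluated at
  \<open>1 / t\<close>, times \<open>p - pderiv p\<close>. Smoothness then follows by induction for
  all \<open>p\<close> at once.\<close>

definition flat_exp :: "real poly \<Rightarrow> real \<Rightarrow> real" where
  "flat_exp p t = (if t > 0 then poly p (1 / t) * exp (- (1 / t)) else 0)"

lemma flat_exp_DERIV: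
  "(flat_exp p has_real_derivative flat_exp ([:0, 0, 1:] * (p - pderiv p)) t) (at t)"
proof -
  consider "t > 0" | "t < 0" | "t = 0" by linarith
  then show ?thesis
  proof cases
    case 1
    have "((\<lambda>t. poly p (1 / t) * exp (- (1 / t))) has_real_derivative
        flat_exp ([:0, 0, 1:] * (p - pderiv p)) t) (at t)"
      using 1 unfolding flat_exp_def
      by (auto intro!: derivative_eq_intros DERIV_chain2[OF poly_DERIV]
          simp: field_simps power2_eq_square)
    then show ?thesis
      by (rule has_field_derivative_transform_within_open[where S = "{0<..}"])
        (use 1 in \<open>auto simp: flat_exp_def\<close>)
  next
    case 2
    have "((\<lambda>t. 0) has_real_derivative 0) (at t)"
      by simp
    then have "(flat_exp p has_real_derivative 0) (at t)"
      by (rule has_field_derivative_transform_within_open[where S = "{..<0}"])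
        (use 2 in \<open>auto simp: flat_exp_def\<close>)
    then show ?thesis
      using 2 by (simp add: flat_exp_def)
  next
    case 3
    \<comment> \<open>The difference quotient at 0 divides by \<open>s\<close>, which raises the
      polynomial in \<open>1 / s\<close> by one degree; hence \<open>pCons 0 p\<close>.\<close>
    have "((\<lambda>s. poly (pCons 0 p) (1 / s) * exp (- (1 / s))) \<longlongrightarrow> 0) (at_right 0)"
      using filterlim_compose[OF poly_over_exp_tendsto_0[of "pCons 0 p"] filterlim_inverse_at_top_right]
      by (simp add: field_simps)
    then have right: "((\<lambda>s. flat_exp p s / s) \<longlongrightarrow> 0) (at_right 0)"
      by (rule Lim_transform_eventually)
        (auto simp: eventually_at_filter flat_exp_def field_simps)
    have left: "((\<lambda>s. flat_exp p s / s) \<longlongrightarrow> 0) (at_left 0)"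
      by (rule Lim_transform_eventually[OF tendsto_const])
        (auto simp: eventually_at_filter flat_exp_def)
    have "((\<lambda>s. flat_exp p s / s) \<longlongrightarrow> 0) (at 0)"
      using left right by (rule filterlim_split_at_real)
    then show ?thesis
      using 3 by (simp add: has_field_derivative_iff flat_exp_def)
  qed
qed

lemma smooth_flat_exp: "smooth (flat_exp p)"
proof -
  have "times_differentiable n (flat_exp p)" for n p
    by (induction n arbitrary: p) (use flat_exp_DERIV in auto)
  then show ?thesis by (simp add: smooth_def)
qed

definition bump :: "real \<Rightarrow> real" where
  "bump t = flat_exp 1 (1 + t) * flat_exp 1 (1 - t)"

lemma smooth_bump: "smooth bump"
  using smooth_mult[OF smooth_affine[OF smooth_flat_exp, of 1 1 1] smooth_affine[OF smooth_flat_exp, of 1 1 "-1"]]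
  by (simp add: bump_def[abs_def])

lemma bump_nonneg: "bump t \<ge> 0"
  and bump_pos: "\<bar>t\<bar> < 1 \<Longrightarrow> bump t > 0"
  and bump_eq_0: "\<bar>t\<bar> \<ge> 1 \<Longrightarrow> bump t = 0"
  by (auto simp: bump_def flat_exp_def)

text \<open>A partial derivative merely exchanges one factor for its derivative, so the
  differentiability of all orders that \<open>test_functions\<close> demands reduces to functions of
  one variable.\<close>

definition tensor :: "('n::finite \<Rightarrow> real \<Rightarrow> real) \<Rightarrow> real^'n \<Rightarrow> real" where
  "tensor k x = (\<Prod>i\<in>UNIV. k i (x $ i))"

lemma tensor_has_derivative:
  assumes "\<And>i. smooth (k i)"
  shows "(tensor k has_derivative
    (\<lambda>v. \<Sum>i\<in>UNIV. v $ i * deriv (k i) (x $ i) * (\<Prod>j\<in>UNIV - {i}. k j (x $ j)))) (at x)"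
proof -
  have "((\<lambda>x. k i (x $ i)) has_derivative (\<lambda>v. v $ i * deriv (k i) (x $ i))) (at x)" for i
    using has_derivative_compose[OF _ smooth_DERIV[OF assms, unfolded has_field_derivative_def],
        of "\<lambda>x. x $ i" "\<lambda>v. v $ i" x UNIV i]
    by (simp add: bounded_linear.has_derivative[OF bounded_linear_vec_nth] mult.commute)
  then show ?thesis
    unfolding tensor_def[abs_def] by (intro has_derivative_prod) auto
qed

lemma tensor_upd:
  "tensor (k(j := l)) x = l (x $ j) * (\<Prod>i\<in>UNIV - {j}. k i (x $ i))"
proof -
  have "(\<Prod>i\<in>UNIV - {j}. (k(j := l)) i (x $ i)) = (\<Prod>i\<in>UNIV - {j}. k i (x $ i))"
    by (rule prod.cong) auto
  then show ?thesis
    unfolding tensor_def by (subst prod.remove[of UNIV j]) auto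
qed

lemma partial_deriv_tensor:
  assumes "\<And>i. smooth (k i)"
  shows "partial_deriv j (tensor k) = tensor (k(j := deriv (k j)))"
proof
  fix x
  have "partial_deriv j (tensor k) x
      = (\<Sum>i\<in>UNIV. axis j 1 $ i * deriv (k i) (x $ i) * (\<Prod>j\<in>UNIV - {i}. k j (x $ j)))"
    unfolding partial_deriv_def
    by (subst frechet_derivative_at[OF tensor_has_derivative[OF assms], symmetric]) simp
  also have "\<dots> = (\<Sum>i\<in>UNIV. if i = j then deriv (k i) (x $ i) * (\<Prod>j\<in>UNIV - {i}. k j (x $ j)) else 0)"
    by (rule sum.cong) (auto simp: axis_def)
  finally show "partial_deriv j (tensor k) x = tensor (k(j := deriv (k j))) x"
    by (simp add: tensor_upd)
qed

lemma iter_partial_tensor: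
  assumes "\<And>i. smooth (k i)"
  shows "\<exists>l. iter_partial js (tensor k) = tensor l \<and> (\<forall>i. smooth (l i))"
proof (induction js)
  case (Cons j js)
  then obtain l where "iter_partial js (tensor k) = tensor l" "\<forall>i. smooth (l i)"
    by (elim exE conjE)
  then have "iter_partial (j # js) (tensor k) = tensor (l(j := deriv (l j)))"
    "\<forall>i. smooth ((l(j := deriv (l j))) i)"
    by (auto simp: partial_deriv_tensor smooth_deriv)
  then show ?case
    by (intro exI[of _ "l(j := deriv (l j))"] conjI)
next
  case Nil
  show ?case
    using assms by (intro exI[of _ k] conjI) simp_all
qed

lemma tensor_test_function:
  assumes "\<And>i. smooth (k i)" and "\<And>i t. t \<notin> {a $ i..b $ i} \<Longrightarrow> k i t = 0" and "cbox a b \<subseteq> S"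
  shows "tensor k \<in> test_functions S"
proof -
  have "iter_partial js (tensor k) differentiable (at x)" for js x
  proof -
    obtain l where l: "iter_partial js (tensor k) = tensor l" "\<forall>i. smooth (l i)"
      using iter_partial_tensor[of k js] assms(1) by (elim meta_impE exE conjE)
    show ?thesis
      unfolding l(1) by (rule differentiableI[OF tensor_has_derivative]) (use l(2) in blast)
  qed
  moreover have "tensor k x = 0" if x: "x \<notin> cbox a b" for x
  proof -
    obtain i where "x $ i \<notin> {a $ i..b $ i}"
      using x unfolding mem_box_cart atLeastAtMost_iff by blast
    then show ?thesis
      using assms(2) unfolding tensor_def by (intro prod_zero) auto
  qed
  ultimately show ?thesis
    using assms(3) compact_cbox[of a b] unfolding test_functions_def by blast
qed

lemma continuous_on_tensor: "(\<And>i. smooth (k i)) \<Longrightarrow> continuous_on S (tensor k)"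
  by (rule continuous_at_imp_continuous_on) (blast intro: has_derivative_continuous tensor_has_derivative)

section \<open>The transition function\<close>

text \<open>A double zero at 0, and one of the complement at 1, make the slope vanish at both
  phases, while the values stay in the unit interval for every real argument. Large gradients
  therefore cannot spoil the estimates.\<close>

definition transition :: "real \<Rightarrow> real" where
  "transition s = s\<^sup>2 / (s\<^sup>2 + (1 - s)\<^sup>2)"

lemma transition_denom: "s\<^sup>2 + (1 - s)\<^sup>2 \<ge> (1/2 :: real)" "s\<^sup>2 + (1 - s)\<^sup>2 \<noteq> (0::real)"
proof -
  have "(2 * s - 1)\<^sup>2 \<ge> 0"
    by simp
  then show "s\<^sup>2 + (1 - s)\<^sup>2 \<ge> (1/2 :: real)"
    by (simp add: power2_eq_square algebra_simps)
  then show "s\<^sup>2 + (1 - s)\<^sup>2 \<noteq> (0::real)"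
    by linarith
qed

lemma transition_bounds: "0 \<le> transition s" "transition s \<le> 1"
  using transition_denom(1)[of s] by (auto simp: transition_def divide_le_eq_1)

lemma continuous_on_transition [continuous_intros]:
  "continuous_on S f \<Longrightarrow> continuous_on S (\<lambda>x. transition (f x))"
  unfolding transition_def by (intro continuous_intros ballI transition_denom)

definition transition_deriv :: "real \<Rightarrow> real" where
  "transition_deriv s = 2 * ((s - s\<^sup>2) / (s\<^sup>2 + (1 - s)\<^sup>2)\<^sup>2)"

lemma transition_DERIV: "(transition has_real_derivative transition_deriv s) (at s)"
proof -
  have "((\<lambda>s. s\<^sup>2 / (s\<^sup>2 + (1 - s)\<^sup>2)) has_real_derivative transition_deriv s) (at s)"
    unfolding transition_deriv_def
    by (rule derivative_eq_intros refl transition_denom)+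
      (simp add: power2_eq_square algebra_simps)
  then show ?thesis
    by (simp add: transition_def[abs_def])
qed

lemma transition_deriv_bound1: "\<bar>transition_deriv s\<bar> \<le> 8 * \<bar>s - s\<^sup>2\<bar>"
proof -
  define N where "N = s\<^sup>2 + (1 - s)\<^sup>2"
  have N: "N \<ge> 1/2"
    using transition_denom by (simp add: N_def)
  have "(1/2)\<^sup>2 \<le> N\<^sup>2"
    using N by (intro power_mono) auto
  then have "1 \<le> 4 * N\<^sup>2"
    by (simp add: power2_eq_square)
  then have "2 * \<bar>s - s\<^sup>2\<bar> * 1 \<le> 2 * \<bar>s - s\<^sup>2\<bar> * (4 * N\<^sup>2)"
    by (intro mult_left_mono) auto
  then have "2 * \<bar>s - s\<^sup>2\<bar> / N\<^sup>2 \<le> 8 * \<bar>s - s\<^sup>2\<bar>"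
    using N by (simp add: divide_simps)
  then show ?thesis
    unfolding transition_deriv_def N_def[symmetric] by (simp add: abs_mult del: right_diff_distrib_numeral)
qed

lemma transition_deriv_bound2: "\<bar>transition_deriv s\<bar> \<le> 2"
proof -
  \<comment> \<open>In terms of \<open>w\<close> the denominator is \<open>1 - 2 * w\<close>, so
    that the slope depends on \<open>w\<close> alone and
    \<open>\<bar>w\<bar> \<le> (1 - 2 * w)\<^sup>2\<close> is left to show.\<close>
  define w where "w = s - s\<^sup>2"
  have N: "s\<^sup>2 + (1 - s)\<^sup>2 = 1 - 2 * w"
    by (simp add: w_def power2_eq_square algebra_simps)
  have w: "1 - 2 * w \<ge> 1/2"
    using transition_denom[of s] by (simp add: N)
  have "\<bar>w\<bar> \<le> (1 - 2 * w)\<^sup>2"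
  proof (cases "w \<ge> 0")
    case True
    have "w \<le> (1/2)\<^sup>2"
      using w by (simp add: power2_eq_square)
    also have "\<dots> \<le> (1 - 2 * w)\<^sup>2"
      using w by (intro power_mono) auto
    finally show ?thesis
      using True by simp
  next
    case False
    have "(1 - 2 * w)\<^sup>2 = 1 - 4 * w + 4 * w\<^sup>2"
      by (simp add: power2_eq_square algebra_simps)
    moreover have "w\<^sup>2 \<ge> 0"
      by simp
    ultimately have "(1 - 2 * w)\<^sup>2 \<ge> - 4 * w"
      by linarith
    then show ?thesis
      using False by simp
  qed
  then show ?thesis
    using w by (simp add: transition_deriv_def N abs_mult divide_simps flip: w_def)
qed

lemma transition_lipschitz: "\<bar>transition s - transition t\<bar> \<le> 2 * \<bar>s - t\<bar>"
  using field_differentiable_bound[of UNIV transition transition_deriv 2 s t]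
    transition_DERIV transition_deriv_bound2 by simp

text \<open>The points 0, 1/2 and 1 are fixed, and the difference factors exactly as
  \<open>w * (2 * s - 1) / (1 - 2 * w)\<close> with \<open>w = s - s\<^sup>2\<close>. This allows
  the indicator to be exchanged for its transition at the cost of its defect.\<close>

lemma transition_diff_bound: "\<bar>transition s - s\<bar> \<le> 2 * \<bar>s - s\<^sup>2\<bar>"
proof -
  define w where "w = s - s\<^sup>2"
  have N: "s\<^sup>2 + (1 - s)\<^sup>2 = 1 - 2 * w"
    by (simp add: w_def power2_eq_square algebra_simps)
  have w: "1 - 2 * w \<ge> 1/2"
    using transition_denom[of s] by (simp add: N)
  \<comment> \<open>For the denominator N the left side is 2N - 1, and completing a square shows
    that this is at most \<open>(2 N)\<^sup>2\<close>.\<close>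
  have "(2 * s - 1)\<^sup>2 = 2 * (1 - 2 * w) - 1"
    by (simp add: w_def power2_eq_square algebra_simps)
  also have "\<dots> \<le> (2 * (1 - 2 * w))\<^sup>2"
    using zero_le_power2[of "2 * (1 - 2 * w) - 1 / 2"]
    by (simp add: power2_eq_square algebra_simps)
  finally have "\<bar>2 * s - 1\<bar>\<^sup>2 \<le> (2 * (1 - 2 * w))\<^sup>2"
    by simp
  then have "\<bar>2 * s - 1\<bar> \<le> 2 * (1 - 2 * w)"
    by (rule power2_le_imp_le) (use w in simp)
  then have "\<bar>w\<bar> * \<bar>2 * s - 1\<bar> \<le> \<bar>w\<bar> * (2 * (1 - 2 * w))"
    by (intro mult_left_mono) auto
  moreover have "transition s - s = w * (2 * s - 1) / (1 - 2 * w)"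
    using w unfolding transition_def N by (simp add: w_def field_simps power2_eq_square)
  ultimately show ?thesis
    using w unfolding w_def[symmetric] by (simp add: abs_mult pos_divide_le_eq mult_ac)
qed

text \<open>The product equals \<open>w\<^sup>2 / (1 - 2 * w)\<^sup>2\<close> for the defect
  \<open>w = s - s\<^sup>2\<close>; \<open>transition_deriv_bound2\<close> then pays for the
  denominator with one factor \<open>w\<close>.\<close>

lemma transition_mixing_bound: "transition s * (1 - transition s) \<le> 4 * \<bar>s - s\<^sup>2\<bar>"
  "transition s * (1 - transition s) \<le> 1"
proof -
  define w where "w = s - s\<^sup>2"
  have N: "s\<^sup>2 + (1 - s)\<^sup>2 = 1 - 2 * w"
    by (simp add: w_def power2_eq_square algebra_simps)
  have w: "1 - 2 * w \<ge> 1/2"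
    using transition_denom[of s] by (simp add: N)
  have eq: "transition s * (1 - transition s) = w\<^sup>2 / (1 - 2 * w)\<^sup>2"
  proof -
    have "1 - transition s = (1 - s)\<^sup>2 / (1 - 2 * w)"
      using w unfolding transition_def N by (simp add: w_def field_simps power2_eq_square)
    moreover have "w = s * (1 - s)"
      by (simp add: w_def power2_eq_square algebra_simps)
    ultimately show ?thesis
      unfolding transition_def N by (simp add: power_mult_distrib power2_eq_square)
  qed
  have "\<bar>w\<bar> \<le> 4 * (1 - 2 * w)\<^sup>2"
    using transition_deriv_bound2[of s] w
    by (simp add: transition_deriv_def N abs_mult divide_simps flip: w_def)
  then have "\<bar>w\<bar> * \<bar>w\<bar> \<le> (4 * (1 - 2 * w)\<^sup>2) * \<bar>w\<bar>"
    by (intro mult_right_mono) auto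
  then have "w\<^sup>2 \<le> 4 * \<bar>w\<bar> * (1 - 2 * w)\<^sup>2"
    by (metis abs_mult_self_eq mult.assoc mult.commute power2_eq_square)
  then show "transition s * (1 - transition s) \<le> 4 * \<bar>s - s\<^sup>2\<bar>"
    using w unfolding eq w_def[symmetric] by (simp add: pos_divide_le_eq)
  show "transition s * (1 - transition s) \<le> 1"
    using transition_bounds[of s] by (intro mult_le_one) auto
qed

text \<open>Below 1 the square is absorbed by \<open>D\<close>, above 1 the a priori bound
  \<open>B\<close> is at most \<open>B * D\<close>. Making errors linear in \<open>D\<close> keeps
  products of two of them within reach of an L2 bound.\<close>

lemma min_quadratic_bound:
  fixes D :: real
  assumes "0 \<le> D" "0 \<le> A" "0 \<le> B" "y \<le> A * (D + D\<^sup>2)" "y \<le> B"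
  shows "y \<le> (2 * A + B) * D"
proof (cases "D \<le> 1")
  case True
  then have "D\<^sup>2 \<le> D"
    using assms(1) by (simp add: power2_eq_square mult_left_le)
  then have "A * (D + D\<^sup>2) \<le> A * (2 * D)"
    using assms by (intro mult_left_mono) auto
  moreover have "0 \<le> B * D"
    using assms by simp
  moreover have "(2 * A + B) * D = A * (2 * D) + B * D"
    by algebra
  ultimately show ?thesis
    using assms(4) by linarith
next
  case False
  then have "B * 1 \<le> B * D"
    using assms by (intro mult_left_mono) auto
  moreover have "0 \<le> A * D"
    using assms by simp
  moreover have "(2 * A + B) * D = 2 * (A * D) + B * D"
    by algebra
  ultimately show ?thesis
    using assms(5) by linarith
qed

section \<open>Vertical averages on a slice\<close>

lemma continuous_on_compose_Pair:
  assumes "continuous_on UNIV (\<lambda>(x, t). f x t)" "continuous_on S a" "continuous_on S b"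
  shows "continuous_on S (\<lambda>x. f (a x) (b x))"
  using continuous_on_compose2[OF assms(1) continuous_on_Pair[OF assms(2,3)]] by simp

lemma continuous_on_compose_Triple:
  assumes "continuous_on UNIV (\<lambda>(x, y, z). f x y z)"
    "continuous_on S a" "continuous_on S b" "continuous_on S c"
  shows "continuous_on S (\<lambda>x. f (a x) (b x) (c x))"
  using continuous_on_compose2[OF assms(1) continuous_on_Pair[OF assms(2) continuous_on_Pair[OF assms(3,4)]]]
  by simp

text \<open>Expand the nonnegative integral of \<open>(e - I)\<^sup>2\<close>, where I is the
  integral of \<open>e\<close>. Since the measure is at most 1, the terms in I add up to at most
  \<open>- I\<^sup>2\<close>.\<close>

lemma integral_Cauchy_Schwarz_unit:
  fixes e :: "'a::euclidean_space \<Rightarrow> real"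
  assumes e: "continuous_on (cbox a b) e" and le: "measure lborel (cbox a b) \<le> 1"
  shows "integral (cbox a b) e \<le> sqrt (integral (cbox a b) (\<lambda>x. (e x)\<^sup>2))"
proof -
  define I where "I = integral (cbox a b) e"
  have int: "e integrable_on cbox a b" "(\<lambda>x. (e x)\<^sup>2) integrable_on cbox a b"
    using e by (auto intro!: integrable_continuous continuous_intros)
  have "0 \<le> integral (cbox a b) (\<lambda>x. (e x - I)\<^sup>2)"
    using e by (intro integral_nonneg integrable_continuous continuous_intros) auto
  also have "(\<lambda>x. (e x - I)\<^sup>2) = (\<lambda>x. (e x)\<^sup>2 - (2 * I) * e x + I\<^sup>2)"
    by (simp add: power2_eq_square algebra_simps fun_eq_iff)
  also have "integral (cbox a b) \<dots>
      = integral (cbox a b) (\<lambda>x. (e x)\<^sup>2) - (2 * I) * I + measure lborel (cbox a b) *\<^sub>R I\<^sup>2"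
    unfolding I_def using int
    by (intro integral_unique has_integral_add has_integral_diff has_integral_mult_right has_integral_const
        integrable_integral)
  also have "\<dots> \<le> integral (cbox a b) (\<lambda>x. (e x)\<^sup>2) - (2 * I) * I + 1 * I\<^sup>2"
    using le unfolding real_scaleR_def by (intro add_left_mono mult_right_mono) auto
  finally have "I\<^sup>2 \<le> integral (cbox a b) (\<lambda>x. (e x)\<^sup>2)"
    by (simp add: power2_eq_square)
  then show ?thesis
    unfolding I_def by (rule real_le_rsqrt)
qed

text \<open>The recurring device of the estimates: a pointwise bound of second degree in the error
  turns into one of second degree in its L2 norm, with the same coefficients.\<close>

lemma integral_quadratic_bound:
  fixes e \<phi> :: "'a::euclidean_space \<Rightarrow> real"
  assumes e: "continuous_on (cbox a b) e" and \<phi>: "continuous_on (cbox a b) \<phi>"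
    and le: "measure lborel (cbox a b) \<le> 1" and nonneg: "0 \<le> A" "0 \<le> B"
    and bd: "\<And>x. x \<in> cbox a b \<Longrightarrow> \<bar>\<phi> x\<bar> \<le> A + B * e x + C * (e x)\<^sup>2"
  shows "\<bar>integral (cbox a b) \<phi>\<bar> \<le> A + B * sqrt (integral (cbox a b) (\<lambda>x. (e x)\<^sup>2))
    + C * integral (cbox a b) (\<lambda>x. (e x)\<^sup>2)"
proof -
  have int: "e integrable_on cbox a b" "(\<lambda>x. (e x)\<^sup>2) integrable_on cbox a b"
    using e by (auto intro!: integrable_continuous continuous_intros)
  have "norm (integral (cbox a b) \<phi>) \<le> integral (cbox a b) (\<lambda>x. A + B * e x + C * (e x)\<^sup>2)"
    using e \<phi> bd by (intro integral_norm_bound_integral integrable_continuous continuous_intros) auto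
  also have "\<dots> = measure lborel (cbox a b) *\<^sub>R A + B * integral (cbox a b) e + C * integral (cbox a b) (\<lambda>x. (e x)\<^sup>2)"
    using int
    by (intro integral_unique has_integral_add has_integral_mult_right has_integral_const integrable_integral)
  also have "\<dots> \<le> 1 * A + B * sqrt (integral (cbox a b) (\<lambda>x. (e x)\<^sup>2)) + C * integral (cbox a b) (\<lambda>x. (e x)\<^sup>2)"
    using nonneg le unfolding real_scaleR_def
    by (intro add_mono mult_right_mono mult_left_mono integral_Cauchy_Schwarz_unit e)
      (auto intro: integral_nonneg int)
  finally show ?thesis
    by simp
qed

section \<open>Parameter integrals and vertical integration by parts\<close>

lemma continuous_on_integral_param:
  fixes f :: "'a::topological_space \<Rightarrow> real \<Rightarrow> real"
  assumes "continuous_on UNIV (\<lambda>(x, t). f x t)"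
  shows "continuous_on S (\<lambda>x. integral {a..b} (f x))"
  unfolding interval_cbox
  by (rule integral_continuous_on_param, rule continuous_on_subset[OF assms]) simp

lemma integral_param_DERIV:
  fixes f :: "real \<Rightarrow> real \<Rightarrow> real"
  assumes "\<And>x t. ((\<lambda>x. f x t) has_real_derivative fx x t) (at x)"
    and "continuous_on UNIV (\<lambda>(x, t). fx x t)" and "\<And>x. continuous_on UNIV (f x)"
  shows "((\<lambda>x. integral {a..b} (f x)) has_real_derivative integral {a..b} (fx x)) (at x)"
  unfolding interval_cbox
proof (rule leibniz_rule_field_derivative[where U = UNIV])
  show "f x integrable_on cbox a b" for x
    using assms(3) by (blast intro: continuous_on_subset integrable_continuous)
  show "continuous_on (UNIV \<times> cbox a b) (\<lambda>(x, t). fx x t)"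
    by (rule continuous_on_subset[OF assms(2)]) simp
qed (use assms in auto)

lemma integral_by_parts_zero:
  fixes \<phi> \<psi> :: "real \<Rightarrow> real"
  assumes "a \<le> b" "\<And>z. (\<phi> has_real_derivative \<phi>' z) (at z)" "\<And>z. (\<psi> has_real_derivative \<psi>' z) (at z)"
    and "continuous_on UNIV \<phi>'" "continuous_on UNIV \<psi>'" "\<phi> a = 0" "\<phi> b = 0"
  shows "integral {a..b} (\<lambda>z. \<phi> z * \<psi>' z) = - integral {a..b} (\<lambda>z. \<phi>' z * \<psi> z)"
proof -
  have c: "continuous_on S \<phi>" "continuous_on S \<psi>" "continuous_on S \<phi>'" "continuous_on S \<psi>'" for S
    using assms(2-5) by (meson DERIV_isCont continuous_at_imp_continuous_on continuous_on_subset subset_UNIV)+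
  have "((\<lambda>z. \<phi> z * \<psi>' z + \<phi>' z * \<psi> z) has_integral (\<phi> b * \<psi> b - \<phi> a * \<psi> a)) {a..b}"
    using assms(1) by (intro fundamental_theorem_of_calculus)
      (auto intro!: DERIV_mult' has_field_derivative_at_within[OF assms(2)] has_field_derivative_at_within[OF assms(3)]
        simp flip: has_real_derivative_iff_has_vector_derivative)
  then have "integral {a..b} (\<lambda>z. \<phi> z * \<psi>' z + \<phi>' z * \<psi> z) = 0"
    using assms by (simp add: integral_unique)
  moreover have "integral {a..b} (\<lambda>z. \<phi> z * \<psi>' z + \<phi>' z * \<psi> z)
      = integral {a..b} (\<lambda>z. \<phi> z * \<psi>' z) + integral {a..b} (\<lambda>z. \<phi>' z * \<psi> z)"
    by (intro integral_add integrable_continuous_real continuous_intros c)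
  ultimately show ?thesis
    by simp
qed

lemma integral_quadratic_bound_real:
  fixes e \<phi> :: "real \<Rightarrow> real"
  assumes "continuous_on {a..b} e" "continuous_on {a..b} \<phi>" "a \<le> b" "b \<le> a + 1" "0 \<le> A" "0 \<le> B"
    and "\<And>x. x \<in> {a..b} \<Longrightarrow> \<bar>\<phi> x\<bar> \<le> A + B * e x + C * (e x)\<^sup>2"
  shows "\<bar>integral {a..b} \<phi>\<bar> \<le> A + B * sqrt (integral {a..b} (\<lambda>x. (e x)\<^sup>2))
    + C * integral {a..b} (\<lambda>x. (e x)\<^sup>2)"
  using integral_quadratic_bound[of a b e \<phi> A B C] assms by simp

text \<open>The zeros at both ends remove the boundary terms of vertical integrations by parts. The
  length at most 1 serves the Cauchy-Schwarz estimate, and a single constant \<open>c\<close>, at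
  least 1, lets lower powers of it be absorbed into higher ones.\<close>

locale cutoff_weight =
  fixes \<alpha> \<beta> c :: real and \<eta> \<eta>' :: "real \<Rightarrow> real"
  assumes order: "\<alpha> < \<beta>" "\<beta> \<le> \<alpha> + 1" and c: "c \<ge> 1"
    and \<eta>_DERIV: "\<And>z. (\<eta> has_real_derivative \<eta>' z) (at z)"
    and cont_\<eta>': "\<And>S. continuous_on S \<eta>'"
    and \<eta>_ends: "\<eta> \<alpha> = 0" "\<eta> \<beta> = 0"
    and \<eta>_bounds: "\<And>z. z \<in> {\<alpha>..\<beta>} \<Longrightarrow> 0 \<le> \<eta> z" "\<And>z. z \<in> {\<alpha>..\<beta>} \<Longrightarrow> \<eta> z \<le> c"
      "\<And>z. z \<in> {\<alpha>..\<beta>} \<Longrightarrow> \<bar>\<eta>' z\<bar> \<le> c"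
    and \<eta>_integral: "integral {\<alpha>..\<beta>} \<eta> = 1"
begin

lemma cont_\<eta>: "continuous_on S \<eta>"
  using \<eta>_DERIV by (meson DERIV_isCont continuous_at_imp_continuous_on)

lemma c_le: "c \<le> c\<^sup>2" "1 \<le> c\<^sup>2"
  using c by (simp_all add: power2_eq_square mult_le_cancel_left1)
    (smt (verit) mult_le_cancel_left1)

lemma weighted_bound:
  assumes "continuous_on {\<alpha>..\<beta>} e" "continuous_on {\<alpha>..\<beta>} \<phi>" "\<And>z. z \<in> {\<alpha>..\<beta>} \<Longrightarrow> 0 \<le> e z"
    "0 \<le> A" "0 \<le> B" "0 \<le> C"
    and w: "continuous_on {\<alpha>..\<beta>} w" "\<And>z. z \<in> {\<alpha>..\<beta>} \<Longrightarrow> \<bar>w z\<bar> \<le> c"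
    and bd: "\<And>z. z \<in> {\<alpha>..\<beta>} \<Longrightarrow> \<bar>\<phi> z\<bar> \<le> A + B * e z + C * (e z)\<^sup>2"
  shows "\<bar>integral {\<alpha>..\<beta>} (\<lambda>z. w z * \<phi> z)\<bar>
    \<le> c * (A + B * sqrt (integral {\<alpha>..\<beta>} (\<lambda>z. (e z)\<^sup>2)) + C * integral {\<alpha>..\<beta>} (\<lambda>z. (e z)\<^sup>2))"
proof -
  have "\<bar>w z * \<phi> z\<bar> \<le> c * A + (c * B) * e z + (c * C) * (e z)\<^sup>2" if "z \<in> {\<alpha>..\<beta>}" for z
  proof -
    have "\<bar>w z\<bar> * \<bar>\<phi> z\<bar> \<le> c * (A + B * e z + C * (e z)\<^sup>2)"
      using that w bd c by (intro mult_mono) auto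
    then show ?thesis
      by (simp add: abs_mult algebra_simps)
  qed
  then have "\<bar>integral {\<alpha>..\<beta>} (\<lambda>z. w z * \<phi> z)\<bar>
    \<le> c * A + (c * B) * sqrt (integral {\<alpha>..\<beta>} (\<lambda>z. (e z)\<^sup>2)) + (c * C) * integral {\<alpha>..\<beta>} (\<lambda>z. (e z)\<^sup>2)"
    using assms order c by (intro integral_quadratic_bound_real continuous_intros) auto
  then show ?thesis
    by (simp add: algebra_simps)
qed

lemma abs_weights: "z \<in> {\<alpha>..\<beta>} \<Longrightarrow> \<bar>\<eta> z\<bar> \<le> c" "z \<in> {\<alpha>..\<beta>} \<Longrightarrow> \<bar>\<eta>' z\<bar> \<le> c"
  using \<eta>_bounds by auto

end

text \<open>\<open>f\<close> and \<open>g\<close> are the first and third displacements, normalised so that the two phases are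
  \<open>\<partial>\<^sub>1f = \<partial>\<^sub>3g/h = 0\<close> and \<open>\<partial>\<^sub>1f = \<partial>\<^sub>3g/h = 1\<close>, restricted to a plane \<open>x\<^sub>2 = const\<close>; the indices denote
  partial derivatives, and \<open>e\<close> dominates the distance of the scaled gradient to the wells.\<close>

locale slice = cutoff_weight +
  fixes h :: real and f f1 f3 g1 g3 g13 e :: "real \<Rightarrow> real \<Rightarrow> real"
  assumes h: "h > 0"
    and cont: "continuous_on UNIV (\<lambda>(x, z). f x z)" "continuous_on UNIV (\<lambda>(x, z). f1 x z)"
      "continuous_on UNIV (\<lambda>(x, z). f3 x z)" "continuous_on UNIV (\<lambda>(x, z). g1 x z)"
      "continuous_on UNIV (\<lambda>(x, z). g3 x z)" "continuous_on UNIV (\<lambda>(x, z). g13 x z)"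
      "continuous_on UNIV (\<lambda>(x, z). e x z)"
    and deriv: "\<And>x z. ((\<lambda>x. f x z) has_real_derivative f1 x z) (at x)"
      "\<And>x z. (f x has_real_derivative f3 x z) (at z)"
      "\<And>x z. ((\<lambda>x. g3 x z) has_real_derivative g13 x z) (at x)"
      "\<And>x z. (g1 x has_real_derivative g13 x z) (at z)"
    and bounds: "\<And>x z. 0 \<le> e x z" "\<And>x z. \<bar>f1 x z - g3 x z / h\<bar> \<le> e x z" "\<And>x z. \<bar>f3 x z\<bar> \<le> h * e x z"
      "\<And>x z. \<bar>g1 x z\<bar> \<le> e x z" "\<And>x z. \<bar>f1 x z - (f1 x z)\<^sup>2\<bar> \<le> e x z + (e x z)\<^sup>2"
      "\<And>x z. \<bar>f1 x z\<bar> \<le> 1 + e x z"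
begin

lemmas cont' [continuous_intros] = cont[THEN continuous_on_compose_Pair]

lemmas cont_weights [continuous_intros] =
  continuous_on_compose2[OF cont_\<eta>[of UNIV] _ subset_UNIV]
  continuous_on_compose2[OF cont_\<eta>'[of UNIV] _ subset_UNIV]

lemma h_neq_0 [simp]: "h \<noteq> 0"
  using h by simp

abbreviation "J \<equiv> integral {\<alpha>..\<beta>}"

lemma cont_J [continuous_intros]:
  fixes k :: "'a::topological_space \<Rightarrow> real \<Rightarrow> real"
  shows "continuous_on UNIV (\<lambda>(x, z). k x z) \<Longrightarrow> continuous_on S (\<lambda>x. J (\<lambda>z. k x z))"
  by (rule continuous_on_integral_param)

definition "d x = sqrt (J (\<lambda>z. (e x z)\<^sup>2))"
definition "P x = J (\<lambda>z. \<eta> z * f1 x z)"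
definition "Q x = J (\<lambda>z. \<eta> z * (g3 x z / h))"
definition "Q' x = J (\<lambda>z. \<eta> z * (g13 x z / h))"
definition "F x = J (\<lambda>z. \<eta> z * f x z)"
text \<open>As \<open>\<eta>\<close> has integral 1, this is the covariance of \<open>g3 / h\<close>
  and \<open>f\<close> along the vertical line. Centring \<open>f\<close> leaves only its
  oscillation, of order \<open>h * d x\<close>, so that \<open>T\<close> is small with
  \<open>h\<close>.\<close>

definition "T x = J (\<lambda>z. \<eta> z * (g3 x z / h * (f x z - F x)))"
definition "T' x = J (\<lambda>z. \<eta> z * (g13 x z / h * (f x z - F x) + g3 x z / h * (f1 x z - P x)))"

lemma d_nonneg: "0 \<le> d x"
  by (auto simp: d_def intro!: integral_nonneg integrable_continuous_real continuous_intros)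

lemma d_sq: "(d x)\<^sup>2 = J (\<lambda>z. (e x z)\<^sup>2)"
  by (auto simp: d_def intro!: integral_nonneg integrable_continuous_real continuous_intros)

lemma J_bound:
  assumes "continuous_on {\<alpha>..\<beta>} \<phi>" "0 \<le> A" "0 \<le> B" "0 \<le> C"
    and "continuous_on {\<alpha>..\<beta>} w" "\<And>z. z \<in> {\<alpha>..\<beta>} \<Longrightarrow> \<bar>w z\<bar> \<le> c"
    and "\<And>z. z \<in> {\<alpha>..\<beta>} \<Longrightarrow> \<bar>\<phi> z\<bar> \<le> A + B * e x z + C * (e x z)\<^sup>2"
  shows "\<bar>J (\<lambda>z. w z * \<phi> z)\<bar> \<le> c * (A + B * d x + C * (d x)\<^sup>2)"
  unfolding d_sq unfolding d_def
  by (rule weighted_bound) (use assms bounds(1) in \<open>auto intro!: continuous_intros\<close>)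

lemma J_diff:
  fixes \<phi> \<psi> :: "real \<Rightarrow> real"
  shows "continuous_on {\<alpha>..\<beta>} \<phi> \<Longrightarrow> continuous_on {\<alpha>..\<beta>} \<psi> \<Longrightarrow> J (\<lambda>z. \<phi> z - \<psi> z) = J \<phi> - J \<psi>"
  by (intro integral_diff integrable_continuous_real)

lemma J_add:
  fixes \<phi> \<psi> :: "real \<Rightarrow> real"
  shows "continuous_on {\<alpha>..\<beta>} \<phi> \<Longrightarrow> continuous_on {\<alpha>..\<beta>} \<psi> \<Longrightarrow> J (\<lambda>z. \<phi> z + \<psi> z) = J \<phi> + J \<psi>"
  by (intro integral_add integrable_continuous_real)

lemma F_DERIV: "(F has_real_derivative P x) (at x)"
  unfolding F_def P_def
  by (rule integral_param_DERIV)
    (auto intro!: continuous_intros DERIV_cmult deriv simp: split_beta)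

lemma Q_DERIV: "(Q has_real_derivative Q' x) (at x)"
  unfolding Q_def Q'_def
  by (rule integral_param_DERIV)
    (auto intro!: continuous_intros DERIV_cmult DERIV_cdivide deriv h simp: split_beta)

lemma cont_F [continuous_intros]: "continuous_on S k \<Longrightarrow> continuous_on S (\<lambda>x. F (k x))"
  by (rule continuous_on_compose2[of UNIV F S k])
    (auto intro!: DERIV_continuous_on[of _ _ P] has_field_derivative_at_within F_DERIV)

lemma cont_P [continuous_intros]: "continuous_on S k \<Longrightarrow> continuous_on S (\<lambda>x. P (k x))"
  by (rule continuous_on_compose2[of UNIV P S k])
    (auto simp: P_def split_beta intro!: continuous_intros)

lemma cont_Q' [continuous_intros]: "continuous_on S k \<Longrightarrow> continuous_on S (\<lambda>x. Q' (k x))"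
  by (rule continuous_on_compose2[of UNIV Q' S k])
    (auto simp: Q'_def split_beta intro!: continuous_intros h)

lemma cont_d: "continuous_on S k \<Longrightarrow> continuous_on S (\<lambda>x. d (k x))"
  by (rule continuous_on_compose2[of UNIV d S k])
    (auto simp: d_def split_beta intro!: continuous_intros)

lemma cont_T': "continuous_on S T'"
  unfolding T'_def using h by (auto simp: split_beta intro!: continuous_intros)

lemma T_DERIV: "(T has_real_derivative T' x) (at x)"
  unfolding T_def T'_def
proof (rule integral_param_DERIV)
  fix x t
  show "((\<lambda>x. \<eta> t * (g3 x t / h * (f x t - F x))) has_real_derivative
      \<eta> t * (g13 x t / h * (f x t - F x) + g3 x t / h * (f1 x t - P x))) (at x)"
    using DERIV_cmult[OF DERIV_mult'[OF DERIV_cdivide[OF deriv(3)] DERIV_diff[OF deriv(1) F_DERIV]]]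
    by (simp add: add.commute)
qed (use h in \<open>auto simp: split_beta intro!: continuous_intros\<close>)

text \<open>The mixed derivative \<open>g13\<close> is a vertical derivative of \<open>g1\<close>;
  moving it to the weight leaves \<open>\<eta>' * g1\<close>, which the error bounds.\<close>

lemma Q'_bound: "\<bar>Q' x\<bar> \<le> c * d x / h"
proof -
  have "Q' x = J (\<lambda>z. \<eta> z * g13 x z) / h"
    unfolding Q'_def by (simp flip: integral_divide)
  also have "J (\<lambda>z. \<eta> z * g13 x z) = - J (\<lambda>z. \<eta>' z * g1 x z)"
    using order by (intro integral_by_parts_zero \<eta>_DERIV deriv \<eta>_ends continuous_intros) auto
  finally have "\<bar>Q' x\<bar> = \<bar>J (\<lambda>z. \<eta>' z * g1 x z)\<bar> / h"
    using h by simp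
  also have "\<dots> \<le> c * (0 + 1 * d x + 0 * (d x)\<^sup>2) / h"
    using h bounds by (intro divide_right_mono J_bound abs_weights continuous_intros) auto
  finally show ?thesis
    by simp
qed

text \<open>The vertical slope of \<open>f\<close> is at most \<open>h * e\<close> and the height at
  most 1, which bounds differences of values; \<open>F x\<close> is a weighted mean of such
  values.\<close>

lemma f_oscillation:
  assumes "z \<in> {\<alpha>..\<beta>}"
  shows "\<bar>f x z - F x\<bar> \<le> h * d x"
proof -
  have osc: "\<bar>f x s - f x t\<bar> \<le> h * d x" if "s \<in> {\<alpha>..\<beta>}" "t \<in> {\<alpha>..\<beta>}" "s \<le> t" for s t
  proof -
    have "(f3 x has_integral f x t - f x s) {s..t}"
      using \<open>s \<le> t\<close> by (intro fundamental_theorem_of_calculus)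
        (auto intro: has_field_derivative_at_within deriv simp flip: has_real_derivative_iff_has_vector_derivative)
    then have "\<bar>f x t - f x s\<bar> = norm (integral {s..t} (f3 x))"
      by (simp add: integral_unique)
    also have "\<dots> \<le> integral {s..t} (\<lambda>z. h * e x z)"
      using bounds by (intro integral_norm_bound_integral integrable_continuous_real continuous_intros) auto
    also have "\<dots> \<le> J (\<lambda>z. h * e x z)"
      using that bounds h by (intro integral_subset_le integrable_continuous_real continuous_intros) auto
    also have "\<dots> \<le> \<bar>J (\<lambda>z. h * e x z)\<bar>"
      by simp
    also have "\<dots> \<le> 0 + h * d x + 0 * (d x)\<^sup>2"
      unfolding d_sq unfolding d_def using order h bounds
      by (intro integral_quadratic_bound_real continuous_intros) (auto simp: abs_mult)
    finally show ?thesis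
      by (simp add: abs_minus_commute)
  qed
  then have osc: "\<bar>f x s - f x t\<bar> \<le> h * d x" if "s \<in> {\<alpha>..\<beta>}" "t \<in> {\<alpha>..\<beta>}" for s t
    using that by (metis abs_minus_commute linear)
  have "f x z - F x = J (\<lambda>t. \<eta> t * f x z) - J (\<lambda>t. \<eta> t * f x t)"
    by (simp add: F_def \<eta>_integral)
  also have "\<dots> = J (\<lambda>t. \<eta> t * (f x z - f x t))"
    by (subst J_diff[symmetric]) (auto intro!: continuous_intros simp: algebra_simps)
  also have "\<bar>\<dots>\<bar> \<le> J (\<lambda>t. \<eta> t * (h * d x))"
    using \<eta>_bounds osc[OF assms] unfolding real_norm_def[symmetric]
    by (intro integral_norm_bound_integral integrable_continuous_real continuous_intros)
      (auto simp: abs_mult intro!: mult_left_mono)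
  finally show ?thesis
    by (simp add: \<eta>_integral)
qed

lemma g3_bound: "\<bar>g3 x z / h\<bar> \<le> 1 + 2 * e x z"
  using bounds(2,6)[of x z] by linarith

lemma T_bound: "\<bar>T x\<bar> \<le> 2 * c * h * (d x + (d x)\<^sup>2)"
proof -
  have "\<bar>T x\<bar> \<le> c * (h * d x + (2 * (h * d x)) * d x + 0 * (d x)\<^sup>2)"
    unfolding T_def
  proof (rule J_bound)
    fix z assume z: "z \<in> {\<alpha>..\<beta>}"
    have "\<bar>g3 x z / h\<bar> * \<bar>f x z - F x\<bar> \<le> (1 + 2 * e x z) * (h * d x)"
      by (rule mult_mono) (use g3_bound f_oscillation[OF z] bounds(1) in auto)
    also have "\<dots> = h * d x + 2 * (h * d x) * e x z + 0 * (e x z)\<^sup>2"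
      by (simp add: algebra_simps)
    finally show "\<bar>g3 x z / h * (f x z - F x)\<bar> \<le> h * d x + 2 * (h * d x) * e x z + 0 * (e x z)\<^sup>2"
      unfolding abs_mult .
  qed (use h d_nonneg abs_weights in \<open>auto intro!: continuous_intros\<close>)
  also have "\<dots> \<le> 2 * c * h * (d x + (d x)\<^sup>2)"
    using h c d_nonneg[of x] by (simp add: algebra_simps power2_eq_square)
  finally show ?thesis .
qed

lemma P_minus_Q: "\<bar>P x - Q x\<bar> \<le> c * d x"
proof -
  have "P x - Q x = J (\<lambda>z. \<eta> z * (f1 x z - g3 x z / h))"
    unfolding P_def Q_def
    by (subst J_diff[symmetric]) (use h in \<open>auto intro!: continuous_intros simp: algebra_simps\<close>)
  also have "\<bar>\<dots>\<bar> \<le> c * (0 + 1 * d x + 0 * (d x)\<^sup>2)"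
    using h bounds by (intro J_bound abs_weights continuous_intros) auto
  finally show ?thesis
    by simp
qed

lemma transition_average: "\<bar>J (\<lambda>z. \<eta> z * transition (f1 x z)) - Q x\<bar> \<le> 3 * c * (d x + (d x)\<^sup>2)"
proof -
  have "J (\<lambda>z. \<eta> z * transition (f1 x z)) - P x = J (\<lambda>z. \<eta> z * (transition (f1 x z) - f1 x z))"
    unfolding P_def by (subst J_diff[symmetric]) (auto intro!: continuous_intros simp: algebra_simps)
  also have "\<bar>\<dots>\<bar> \<le> c * (0 + 2 * d x + 2 * (d x)\<^sup>2)"
  proof (rule J_bound)
    show "\<bar>transition (f1 x z) - f1 x z\<bar> \<le> 0 + 2 * e x z + 2 * (e x z)\<^sup>2" for z
      using order_trans[OF transition_diff_bound mult_left_mono[OF bounds(5)[of x z], of 2]] by simp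
  qed (auto intro!: continuous_intros abs_weights)
  finally have "\<bar>J (\<lambda>z. \<eta> z * transition (f1 x z)) - P x\<bar> \<le> 2 * c * (d x + (d x)\<^sup>2)"
    by (simp add: algebra_simps)
  moreover have "c * d x \<le> c * (d x + (d x)\<^sup>2)"
    using c by (intro mult_left_mono) auto
  ultimately show ?thesis
    using P_minus_Q[of x] by (simp add: algebra_simps)
qed

text \<open>The product \<open>p q\<close> with \<open>p = \<partial>\<^sub>1f\<close> and \<open>q = \<partial>\<^sub>3g/h\<close> is a null Lagrangian up to terms quadratic in
  the error \<open>e\<close>; hence the vertical average of \<open>p q \<approx> q\<close> differs from the product of the averages
  only by the derivative \<open>T'\<close>.\<close>

lemma Q_defect: "\<bar>Q x - (Q x)\<^sup>2 - T' x\<bar> \<le> 6 * c\<^sup>2 * (d x + (d x)\<^sup>2)"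
proof -
  \<comment> \<open>\<open>R\<close> is the remainder of a vertical integration by parts in
    \<open>T'\<close>. Each of its terms is a product of \<open>g1\<close> with
    \<open>(f - F) / h\<close> or \<open>f3 / h\<close>, hence quadratic in the error.\<close>
  define R where "R = J (\<lambda>z. (\<eta>' z * (f x z - F x) + \<eta> z * f3 x z) * g1 x z) / h"
  define M where "M = J (\<lambda>z. \<eta> z * (g3 x z / h * f1 x z))"
  have "T' x = J (\<lambda>z. (\<eta> z * (f x z - F x)) * g13 x z) / h + (M - P x * Q x)"
  proof -
    have "T' x = J (\<lambda>z. ((\<eta> z * (f x z - F x)) * g13 x z) / h + (\<eta> z * (g3 x z / h * f1 x z) - P x * (\<eta> z * (g3 x z / h))))"
      unfolding T'_def by (intro integral_cong) (simp add: algebra_simps add_divide_distrib diff_divide_distrib)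
    also have "\<dots> = J (\<lambda>z. ((\<eta> z * (f x z - F x)) * g13 x z) / h)
        + (J (\<lambda>z. \<eta> z * (g3 x z / h * f1 x z)) - J (\<lambda>z. P x * (\<eta> z * (g3 x z / h))))"
      using h by (subst J_add, (auto intro!: continuous_intros)[2], subst J_diff, (auto intro!: continuous_intros))
    finally show ?thesis
      by (simp add: M_def Q_def)
  qed
  also have "J (\<lambda>z. (\<eta> z * (f x z - F x)) * g13 x z) = - J (\<lambda>z. (\<eta>' z * (f x z - F x) + \<eta> z * f3 x z) * g1 x z)"
  proof (rule integral_by_parts_zero)
    show "((\<lambda>z. \<eta> z * (f x z - F x)) has_real_derivative \<eta>' z * (f x z - F x) + \<eta> z * f3 x z) (at z)" for z
      by (rule derivative_eq_intros deriv \<eta>_DERIV refl | simp)+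
  qed (use order in \<open>auto intro!: deriv \<eta>_DERIV continuous_intros simp: \<eta>_ends\<close>)
  finally have T': "T' x = M - P x * Q x - R"
    by (simp add: R_def)
  have R: "\<bar>R\<bar> \<le> 2 * c * (d x)\<^sup>2"
  proof -
    have "R = J (\<lambda>z. \<eta>' z * ((f x z - F x) / h * g1 x z)) + J (\<lambda>z. \<eta> z * (f3 x z / h * g1 x z))"
      unfolding R_def integral_divide[symmetric]
      using h by (subst J_add[symmetric])
        (auto intro!: continuous_intros integral_cong simp: algebra_simps add_divide_distrib diff_divide_distrib)
    moreover have "\<bar>J (\<lambda>z. \<eta>' z * ((f x z - F x) / h * g1 x z))\<bar> \<le> c * (0 + d x * d x + 0 * (d x)\<^sup>2)"
    proof (rule J_bound)
      fix z assume z: "z \<in> {\<alpha>..\<beta>}"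
      have "\<bar>f x z - F x\<bar> / h \<le> d x"
        using f_oscillation[OF z, of x] h by (simp add: pos_divide_le_eq mult.commute)
      then have "(\<bar>f x z - F x\<bar> / h) * \<bar>g1 x z\<bar> \<le> d x * e x z"
        using h bounds(1,4) d_nonneg by (intro mult_mono) auto
      then show "\<bar>(f x z - F x) / h * g1 x z\<bar> \<le> 0 + d x * e x z + 0 * (e x z)\<^sup>2"
        using h by (simp add: abs_mult)
    qed (use h d_nonneg abs_weights in \<open>auto intro!: continuous_intros\<close>)
    moreover have "\<bar>J (\<lambda>z. \<eta> z * (f3 x z / h * g1 x z))\<bar> \<le> c * (0 + 0 * d x + 1 * (d x)\<^sup>2)"
    proof (rule J_bound)
      fix z assume z: "z \<in> {\<alpha>..\<beta>}"
      have "\<bar>f3 x z\<bar> / h \<le> e x z"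
        using bounds(3)[of x z] h by (simp add: pos_divide_le_eq mult.commute)
      then have "(\<bar>f3 x z\<bar> / h) * \<bar>g1 x z\<bar> \<le> e x z * e x z"
        using h bounds by (intro mult_mono) auto
      then show "\<bar>f3 x z / h * g1 x z\<bar> \<le> 0 + 0 * e x z + 1 * (e x z)\<^sup>2"
        using h by (simp add: abs_mult power2_eq_square)
    qed (use h d_nonneg abs_weights in \<open>auto intro!: continuous_intros\<close>)
    ultimately have "\<bar>R\<bar> \<le> c * (0 + d x * d x + 0 * (d x)\<^sup>2) + c * (0 + 0 * d x + 1 * (d x)\<^sup>2)"
      by linarith
    then show ?thesis
      by (simp add: power2_eq_square)
  qed
  have M: "\<bar>M - P x\<bar> \<le> c * (2 * d x + 2 * (d x)\<^sup>2)"
  proof -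
    have "M - P x = J (\<lambda>z. \<eta> z * (g3 x z / h * f1 x z - f1 x z))"
      unfolding M_def P_def
      by (subst J_diff[symmetric]) (use h in \<open>auto intro!: continuous_intros simp: algebra_simps\<close>)
    also have "\<bar>\<dots>\<bar> \<le> c * (0 + 2 * d x + 2 * (d x)\<^sup>2)"
    proof (rule J_bound)
      fix z
      have "\<bar>g3 x z / h - f1 x z\<bar> * \<bar>f1 x z\<bar> \<le> e x z * (1 + e x z)"
        using bounds[of x z] by (intro mult_mono) (auto simp: abs_minus_commute)
      \<comment> \<open>In a pure phase both factors are the same number, 0 or 1. The identity
        splits the deviation into the mismatch of the two indicators and the defect of one of
        them.\<close>
      moreover have "g3 x z / h * f1 x z - f1 x z = (g3 x z / h - f1 x z) * f1 x z - (f1 x z - (f1 x z)\<^sup>2)"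
        by (simp add: power2_eq_square algebra_simps)
      ultimately have "\<bar>g3 x z / h * f1 x z - f1 x z\<bar> \<le> e x z * (1 + e x z) + (e x z + (e x z)\<^sup>2)"
        using bounds(5)[of x z] abs_triangle_ineq4[of "(g3 x z / h - f1 x z) * f1 x z" "f1 x z - (f1 x z)\<^sup>2"]
        by (simp add: abs_mult)
      then show "\<bar>g3 x z / h * f1 x z - f1 x z\<bar> \<le> 0 + 2 * e x z + 2 * (e x z)\<^sup>2"
        by (simp add: power2_eq_square algebra_simps)
    qed (use h abs_weights in \<open>auto intro!: continuous_intros\<close>)
    finally show ?thesis
      by simp
  qed
  have Q: "\<bar>Q x\<bar> \<le> c * (1 + 2 * d x + 0 * (d x)\<^sup>2)"
    unfolding Q_def by (rule J_bound) (use h g3_bound abs_weights in \<open>auto intro!: continuous_intros\<close>)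
  have PQ: "\<bar>(P x - Q x) * Q x\<bar> \<le> (c * d x) * (c * (1 + 2 * d x))"
    unfolding abs_mult using P_minus_Q[of x] Q c d_nonneg[of x] by (intro mult_mono) auto
  \<comment> \<open>Insert \<open>T' x = M - P x * Q x - R\<close>; every summand is then a
    difference already estimated. In total \<open>d x\<close> receives the coefficient
    \<open>4 * c\<^sup>2\<close> and its square \<open>6 * c\<^sup>2\<close>.\<close>
  have "Q x - (Q x)\<^sup>2 - T' x = (P x - Q x) * Q x - (M - P x) - (P x - Q x) + R"
    by (simp add: T' power2_eq_square algebra_simps)
  then have "\<bar>Q x - (Q x)\<^sup>2 - T' x\<bar> \<le> (c * d x) * (c * (1 + 2 * d x)) + c * (2 * d x + 2 * (d x)\<^sup>2) + c * d x + 2 * c * (d x)\<^sup>2"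
    using PQ M R P_minus_Q[of x] by linarith
  also have "\<dots> = c\<^sup>2 * d x + 2 * c\<^sup>2 * (d x)\<^sup>2 + c * (3 * d x + 4 * (d x)\<^sup>2)"
    by (simp add: power2_eq_square algebra_simps)
  also have "\<dots> \<le> c\<^sup>2 * d x + 2 * c\<^sup>2 * (d x)\<^sup>2 + c\<^sup>2 * (3 * d x + 4 * (d x)\<^sup>2)"
    using c_le d_nonneg[of x] by (intro add_left_mono mult_right_mono) auto
  also have "\<dots> \<le> 6 * c\<^sup>2 * (d x + (d x)\<^sup>2)"
    using d_nonneg[of x] c by (simp add: algebra_simps)
  finally show ?thesis .
qed

text \<open>Averaging over the horizontal length \<open>h\<close> turns \<open>T'\<close> into
  \<open>(T (x + h) - T x) / h\<close>, which is of the order of the error because \<open>T\<close>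
  carries a factor \<open>h\<close>. For this reason \<open>D\<close> contains the errors at both
  end points besides their average in between.\<close>

definition "m x = integral {0..1} (\<lambda>t. Q (x + h * t))"
definition "D x = sqrt ((d x)\<^sup>2 + (d (x + h))\<^sup>2 + integral {0..1} (\<lambda>t. (d (x + h * t))\<^sup>2))"

lemma cont_Q: "continuous_on S k \<Longrightarrow> continuous_on S (\<lambda>x. Q (k x))"
  by (rule continuous_on_compose2[of UNIV Q S k])
    (auto intro!: DERIV_continuous_on[of _ _ Q'] has_field_derivative_at_within Q_DERIV)

lemmas cont_slice [continuous_intros] = cont_Q cont_d
  continuous_on_compose2[OF cont_T'[of UNIV] _ subset_UNIV]

lemma dbar_nonneg: "0 \<le> integral {0..1} (\<lambda>t. (d (x + h * t))\<^sup>2)"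
  by (auto intro!: integral_nonneg integrable_continuous_real continuous_intros)

lemma D_sq: "(D x)\<^sup>2 = (d x)\<^sup>2 + (d (x + h))\<^sup>2 + integral {0..1} (\<lambda>t. (d (x + h * t))\<^sup>2)"
  using dbar_nonneg by (simp add: D_def)

lemma D_ge: "0 \<le> D x" "d x \<le> D x" "d (x + h) \<le> D x" "sqrt (integral {0..1} (\<lambda>t. (d (x + h * t))\<^sup>2)) \<le> D x"
  unfolding D_def using dbar_nonneg
  by (auto intro!: real_le_rsqrt)

lemma quadratic_mono: "0 \<le> s \<Longrightarrow> s \<le> t \<Longrightarrow> s + s\<^sup>2 \<le> t + t\<^sup>2" for s t :: real
  by (intro add_mono power_mono)

lemma average_bound:
  assumes "continuous_on {0..1} \<phi>" "0 \<le> B" "0 \<le> C"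
    and "\<And>t. t \<in> {0..1} \<Longrightarrow> \<bar>\<phi> t\<bar> \<le> B * d (x + h * t) + C * (d (x + h * t))\<^sup>2"
  shows "\<bar>integral {0..1} \<phi>\<bar> \<le> B * D x + C * (D x)\<^sup>2"
proof -
  have "\<bar>integral {0..1} \<phi>\<bar> \<le> 0 + B * sqrt (integral {0..1} (\<lambda>t. (d (x + h * t))\<^sup>2))
      + C * integral {0..1} (\<lambda>t. (d (x + h * t))\<^sup>2)"
    using assms by (intro integral_quadratic_bound_real continuous_intros) auto
  also have "\<dots> \<le> 0 + B * D x + C * (D x)\<^sup>2"
    using assms D_ge by (intro add_mono mult_left_mono) (auto simp: D_sq)
  finally show ?thesis by simp
qed

lemma m_DERIV: "(m has_real_derivative integral {0..1} (\<lambda>t. Q' (x + h * t))) (at x)"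
  unfolding m_def
proof (rule integral_param_DERIV)
  show "((\<lambda>x. Q (x + h * t)) has_real_derivative Q' (x + h * t)) (at x)" for x t
    using DERIV_shift[of Q "Q' (x + h * t)" x "h * t"] Q_DERIV by simp
qed (auto intro!: continuous_intros simp: split_beta)

lemma m_deriv_bound: "\<bar>integral {0..1} (\<lambda>t. Q' (x + h * t))\<bar> \<le> c * D x / h"
proof -
  have "\<bar>integral {0..1} (\<lambda>t. Q' (x + h * t))\<bar> \<le> (c / h) * D x + 0 * (D x)\<^sup>2"
    using Q'_bound h c by (intro average_bound continuous_intros) auto
  then show ?thesis by simp
qed

text \<open>A slope of order \<open>d / h\<close> acts over a length \<open>h\<close>, so the
  factors cancel and the averaged error remains.\<close>

lemma Q_oscillation: "t \<in> {0..1} \<Longrightarrow> \<bar>Q (x + h * t) - m x\<bar> \<le> c * D x"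
proof -
  have osc: "\<bar>Q (x + h * s) - Q (x + h * t)\<bar> \<le> c * D x" if "s \<in> {0..1}" "t \<in> {0..1}" "s \<le> t" for s t
  proof -
    have "((\<lambda>t. h * Q' (x + h * t)) has_integral Q (x + h * t) - Q (x + h * s)) {s..t}"
    proof (intro fundamental_theorem_of_calculus)
      fix r
      have "((\<lambda>t. x + h * t) has_real_derivative h) (at r)"
        by (auto intro!: derivative_eq_intros)
      from DERIV_chain2[OF Q_DERIV this]
      show "((\<lambda>t. Q (x + h * t)) has_vector_derivative h * Q' (x + h * r)) (at r within {s..t})"
        by (simp add: has_field_derivative_at_within mult.commute flip: has_real_derivative_iff_has_vector_derivative)
    qed (use \<open>s \<le> t\<close> in simp)
    then have "\<bar>Q (x + h * t) - Q (x + h * s)\<bar> = norm (integral {s..t} (\<lambda>t. h * Q' (x + h * t)))"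
      by (simp add: integral_unique del: integral_mult_right)
    also have "\<dots> \<le> integral {s..t} (\<lambda>t. c * d (x + h * t))"
    proof (intro integral_norm_bound_integral integrable_continuous_real continuous_intros)
      show "norm (h * Q' (x + h * t)) \<le> c * d (x + h * t)" for t
        using Q'_bound[of "x + h * t"] h by (simp add: abs_mult field_simps)
    qed
    also have "\<dots> \<le> integral {0..1} (\<lambda>t. c * d (x + h * t))"
      using that c d_nonneg by (intro integral_subset_le integrable_continuous_real continuous_intros) auto
    also have "\<dots> \<le> \<bar>integral {0..1} (\<lambda>t. c * d (x + h * t))\<bar>"
      by simp
    also have "\<dots> \<le> c * D x + 0 * (D x)\<^sup>2"
      using c d_nonneg by (intro average_bound continuous_intros) auto
    finally show ?thesis
      by (simp add: abs_minus_commute)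
  qed
  assume t: "t \<in> {0..1}"
  have osc: "\<bar>Q (x + h * t) - Q (x + h * s)\<bar> \<le> c * D x" if "s \<in> {0..1}" for s
    using osc[of s t] osc[of t s] that t by (cases "s \<le> t") (auto simp: abs_minus_commute)
  have eq: "Q (x + h * t) - m x = integral {0..1} (\<lambda>s. Q (x + h * t) - Q (x + h * s))"
    unfolding m_def by (subst integral_diff) (auto intro!: integrable_continuous_real continuous_intros)
  have "norm (integral {0..1} (\<lambda>s. Q (x + h * t) - Q (x + h * s))) \<le> integral {0..1} (\<lambda>s::real. c * D x)"
  proof (rule integral_norm_bound_integral)
    show "norm (Q (x + h * t) - Q (x + h * s)) \<le> c * D x" if "s \<in> {0..1}" for s
      using osc[OF that] by simp
    show "(\<lambda>s. Q (x + h * t) - Q (x + h * s)) integrable_on {0..1}"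
      by (intro integrable_continuous_real continuous_intros)
  qed (rule integrable_const_ivl)
  then show "\<bar>Q (x + h * t) - m x\<bar> \<le> c * D x"
    unfolding eq by simp
qed

lemma m_defect: "\<bar>m x - (m x)\<^sup>2\<bar> \<le> 12 * c\<^sup>2 * (D x + (D x)\<^sup>2)"
proof -
  let ?I = "integral {0..1::real}"
  have T: "((\<lambda>t. T' (x + h * t)) has_integral (T (x + h * 1) / h - T (x + h * 0) / h)) {0..1}"
  proof (intro fundamental_theorem_of_calculus)
    fix r
    have "((\<lambda>t. x + h * t) has_real_derivative h) (at r)"
      by (auto intro!: derivative_eq_intros)
    from DERIV_cdivide[OF DERIV_chain2[OF T_DERIV this], of h]
    show "((\<lambda>t. T (x + h * t) / h) has_vector_derivative T' (x + h * r)) (at r within {0..1})"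
      by (simp add: has_field_derivative_at_within flip: has_real_derivative_iff_has_vector_derivative)
  qed simp
  have Tb: "\<bar>T y / h\<bar> \<le> 2 * c * (D x + (D x)\<^sup>2)" if "y = x \<or> y = x + h" for y
  proof -
    have "\<bar>T y / h\<bar> = \<bar>T y\<bar> / h"
      using h by simp
    also have "\<dots> \<le> 2 * c * (d y + (d y)\<^sup>2)"
      using T_bound[of y] h by (simp add: pos_divide_le_eq mult_ac)
    also have "\<dots> \<le> 2 * c * (D x + (D x)\<^sup>2)"
      using c that d_nonneg D_ge by (intro mult_left_mono quadratic_mono) auto
    finally show ?thesis .
  qed
  \<comment> \<open>The last integral is the variance of \<open>Q\<close> over the averaging
    interval; it accounts for averaging \<open>Q\<^sup>2\<close> instead of squaring the average.
    The three parts contribute 6, 4 and 1 to the constant.\<close>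
  have "m x - (m x)\<^sup>2 = ?I (\<lambda>t. Q (x + h * t) - (Q (x + h * t))\<^sup>2 - T' (x + h * t))
      + ?I (\<lambda>t. T' (x + h * t)) + ?I (\<lambda>t. (Q (x + h * t) - m x)\<^sup>2)"
  proof -
    have "?I (\<lambda>t. Q (x + h * t) - (Q (x + h * t))\<^sup>2 - T' (x + h * t)) + ?I (\<lambda>t. T' (x + h * t))
        + ?I (\<lambda>t. (Q (x + h * t) - m x)\<^sup>2)
      = ?I (\<lambda>t. (Q (x + h * t) - (Q (x + h * t))\<^sup>2 - T' (x + h * t)) + T' (x + h * t) + (Q (x + h * t) - m x)\<^sup>2)"
      by (subst integral_add; (intro integrable_continuous_real continuous_intros)?)+ simp
    also have "\<dots> = ?I (\<lambda>t. (1 - 2 * m x) * Q (x + h * t) + (m x)\<^sup>2)"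
      by (intro integral_cong) (simp add: power2_eq_square algebra_simps)
    also have "\<dots> = (1 - 2 * m x) * m x + (m x)\<^sup>2"
      unfolding m_def by (subst integral_add; (intro integrable_continuous_real continuous_intros)?) auto
    finally show ?thesis
      by (simp add: power2_eq_square algebra_simps)
  qed
  moreover have "\<bar>?I (\<lambda>t. Q (x + h * t) - (Q (x + h * t))\<^sup>2 - T' (x + h * t))\<bar>
      \<le> (6 * c\<^sup>2) * D x + (6 * c\<^sup>2) * (D x)\<^sup>2"
    using Q_defect by (intro average_bound continuous_intros) (auto simp: distrib_left)
  moreover have "\<bar>?I (\<lambda>t. T' (x + h * t))\<bar> \<le> 4 * c * (D x + (D x)\<^sup>2)"
  proof -
    have "?I (\<lambda>t. T' (x + h * t)) = T (x + h) / h - T x / h"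
      using integral_unique[OF T] by simp
    then show ?thesis
      using Tb[of x] Tb[of "x + h"] by linarith
  qed
  moreover have "\<bar>?I (\<lambda>t. (Q (x + h * t) - m x)\<^sup>2)\<bar> \<le> ?I (\<lambda>t. (c * D x)\<^sup>2)"
    unfolding real_norm_def[symmetric]
  proof (intro integral_norm_bound_integral integrable_continuous_real continuous_intros)
    show "norm ((Q (x + h * t) - m x)\<^sup>2) \<le> (c * D x)\<^sup>2" if "t \<in> {0..1}" for t
      using Q_oscillation[OF that, of x] c D_ge(1)[of x] by (simp add: abs_le_square_iff[symmetric])
  qed
  ultimately have "\<bar>m x - (m x)\<^sup>2\<bar> \<le> 6 * c\<^sup>2 * D x + 6 * c\<^sup>2 * (D x)\<^sup>2 + 4 * c * (D x + (D x)\<^sup>2) + (c * D x)\<^sup>2"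
    by simp
  also have "\<dots> \<le> 6 * c\<^sup>2 * D x + 6 * c\<^sup>2 * (D x)\<^sup>2 + 4 * c\<^sup>2 * (D x + (D x)\<^sup>2) + (c * D x)\<^sup>2"
    using c_le D_ge(1)[of x] by (intro add_mono mult_right_mono) auto
  also have "\<dots> \<le> 12 * c\<^sup>2 * (D x + (D x)\<^sup>2)"
    using D_ge(1)[of x] by (simp add: algebra_simps power_mult_distrib)
  finally show ?thesis .
qed

lemma transition_average_bound: "\<bar>J (\<lambda>z. \<eta> z * transition (f1 x z)) - transition (m x)\<bar> \<le> 28 * c\<^sup>2 * (D x + (D x)\<^sup>2)"
proof -
  \<comment> \<open>The constant 28 is made of 3 for passing from the averaged transition to
    \<open>Q\<close>, 1 for passing from \<open>Q\<close> to \<open>m\<close>, and 2 * 12 for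
    passing from \<open>m\<close> to its transition.\<close>
  have "3 * c * (d x + (d x)\<^sup>2) \<le> 3 * c\<^sup>2 * (D x + (D x)\<^sup>2)"
    using c c_le d_nonneg D_ge by (intro mult_mono quadratic_mono) auto
  moreover have "c * D x \<le> c\<^sup>2 * (D x + (D x)\<^sup>2)"
    using c c_le D_ge(1)[of x] by (intro mult_mono) auto
  moreover have "\<bar>Q x - m x\<bar> \<le> c * D x"
    using Q_oscillation[of 0 x] by simp
  moreover have "\<bar>transition (m x) - m x\<bar> \<le> 2 * (12 * c\<^sup>2 * (D x + (D x)\<^sup>2))"
    using order_trans[OF transition_diff_bound mult_left_mono[OF m_defect[of x], of 2]] by simp
  ultimately show ?thesis
    using transition_average[of x] by linarith
qed

end

section \<open>Separation of phases for smooth functions\<close>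

lemma mult_mixing_bound:
  fixes s t :: real
  assumes "0 \<le> s" "s \<le> 1" "0 \<le> t" "t \<le> 1"
  shows "s * (1 - t) \<le> \<bar>s - t\<bar> + t * (1 - t)"
proof -
  have "(s - t) * (1 - t) \<le> \<bar>s - t\<bar> * 1"
    using assms by (intro mult_mono) auto
  then show ?thesis
    by (simp add: algebra_simps)
qed

lemma mixing_lipschitz:
  fixes s t :: real
  assumes "0 \<le> s" "s \<le> 1" "0 \<le> t" "t \<le> 1"
  shows "s * (1 - s) \<le> \<bar>s - t\<bar> + t * (1 - t)"
proof -
  have "s * (1 - s) - t * (1 - t) = (s - t) * (1 - s - t)"
    by algebra
  also have "\<dots> \<le> \<bar>s - t\<bar> * \<bar>1 - s - t\<bar>"
    by (metis abs_ge_self abs_mult)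
  also have "\<dots> \<le> \<bar>s - t\<bar> * 1"
    using assms by (intro mult_left_mono) auto
  finally show ?thesis
    by simp
qed

section \<open>Separation of two phases on a rectangle of the plane\<close>

lemma FTC_bound:
  fixes F F' H :: "real \<Rightarrow> real"
  assumes "\<And>s. (F has_real_derivative F' s) (at s)" "\<And>s. \<bar>F' s\<bar> \<le> H s"
    and "continuous_on UNIV H" and st: "s \<in> {a..b}" "t \<in> {a..b}"
  shows "\<bar>F s - F t\<bar> \<le> integral {a..b} H"
proof -
  have H: "H integrable_on {u..v}" for u v
    by (rule integrable_continuous_real, rule continuous_on_subset[OF assms(3)]) simp
  have *: "\<bar>F t - F s\<bar> \<le> integral {a..b} H" if "s \<in> {a..b}" "t \<in> {a..b}" "s \<le> t" for s t
  proof -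
    have F': "(F' has_integral F t - F s) {s..t}"
      using \<open>s \<le> t\<close> assms(1) by (intro fundamental_theorem_of_calculus)
        (auto intro: has_field_derivative_at_within simp flip: has_real_derivative_iff_has_vector_derivative)
    then have "\<bar>F t - F s\<bar> = norm (integral {s..t} F')"
      by (simp add: integral_unique)
    also have "\<dots> \<le> integral {s..t} H"
      using F' assms(2) H by (intro integral_norm_bound_integral) (auto simp: has_integral_integrable)
    also have "\<dots> \<le> integral {a..b} H"
      using that assms(2) H by (intro integral_subset_le) (auto intro: order_trans[OF abs_ge_zero])
    finally show ?thesis .
  qed
  show ?thesis
    using *[of s t] *[of t s] st by (cases "s \<le> t") (auto simp: abs_minus_commute)
qed

text \<open>By Fubini, integrating out a variable and spreading the result again over that variable
  multiplies the integral by a measure of at most 1. The second form has the factors exchanged, for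
  the vertical counterpart.\<close>

lemma integral_slab_le:
  fixes G :: "'a::euclidean_space \<Rightarrow> 'b::euclidean_space \<Rightarrow> real"
  assumes "continuous_on UNIV (\<lambda>(x, y). G x y)" "\<And>x y. 0 \<le> G x y"
    and "measure lborel (cbox a b) \<le> 1"
  shows "integral (cbox (a, c) (b, d)) (\<lambda>(x, y). integral (cbox a b) (\<lambda>s. G s y))
    \<le> integral (cbox (a, c) (b, d)) (\<lambda>(x, y). G x y)"
    and "integral (cbox (c, a) (d, b)) (\<lambda>(y, x). integral (cbox a b) (\<lambda>s. G s y))
    \<le> integral (cbox (a, c) (b, d)) (\<lambda>(x, y). G x y)"
proof -
  have swap: "continuous_on UNIV (\<lambda>(y, x). G x y)"
    using continuous_on_compose2[OF assms(1) continuous_on_swap] by (simp add: split_beta prod.swap_def)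
  have c: "continuous_on UNIV (\<lambda>y. integral (cbox a b) (\<lambda>s. G s y))"
    by (rule integral_continuous_on_param, rule continuous_on_subset[OF swap]) simp
  have c1: "continuous_on S (\<lambda>(x, y). integral (cbox a b) (\<lambda>s. G s y))" for S :: "('a \<times> 'b) set"
    unfolding split_beta by (rule continuous_on_compose2[OF c]) (auto intro: continuous_intros)
  have c2: "continuous_on S (\<lambda>(y, x). integral (cbox a b) (\<lambda>s. G s y))" for S :: "('b \<times> 'a) set"
    unfolding split_beta by (rule continuous_on_compose2[OF c]) (auto intro: continuous_intros)
  define I where "I = integral (cbox c d) (\<lambda>y. integral (cbox a b) (\<lambda>s. G s y))"
  have I: "integral (cbox (a, c) (b, d)) (\<lambda>(x, y). G x y) = I"
  proof -
    have "integral (cbox (a, c) (b, d)) (\<lambda>(x, y). G x y) = integral (cbox a b) (\<lambda>x. integral (cbox c d) (G x))"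
      by (subst integral_prod_continuous) (use assms(1) in \<open>auto intro: continuous_on_subset\<close>)
    also have "\<dots> = I"
      unfolding I_def by (rule integral_swap_continuous) (use assms(1) in \<open>auto intro: continuous_on_subset\<close>)
    finally show ?thesis .
  qed
  have "0 \<le> I"
    unfolding I[symmetric] by (intro integral_nonneg integrable_continuous)
      (use assms in \<open>auto intro: continuous_on_subset\<close>)
  then have le: "measure lborel (cbox a b) * I \<le> I"
    using assms(3) by (simp add: mult_left_le_one_le)
  have "integral (cbox (a, c) (b, d)) (\<lambda>(x, y). integral (cbox a b) (\<lambda>s. G s y)) = measure lborel (cbox a b) * I"
    by (subst integral_prod_continuous[OF c1]) (simp add: I_def)
  with le show "integral (cbox (a, c) (b, d)) (\<lambda>(x, y). integral (cbox a b) (\<lambda>s. G s y))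
    \<le> integral (cbox (a, c) (b, d)) (\<lambda>(x, y). G x y)"
    by (simp add: I)
  have "integral (cbox (c, a) (d, b)) (\<lambda>(y, x). integral (cbox a b) (\<lambda>s. G s y)) = measure lborel (cbox a b) * I"
    by (subst integral_prod_continuous[OF c2]) (simp add: I_def)
  with le show "integral (cbox (c, a) (d, b)) (\<lambda>(y, x). integral (cbox a b) (\<lambda>s. G s y))
    \<le> integral (cbox (a, c) (b, d)) (\<lambda>(x, y). G x y)"
    by (simp add: I)
qed

lemma content_rectangle_le_1:
  fixes a b a' b' :: real
  assumes "a \<le> b" "b \<le> a + 1" "a' \<le> b'" "b' \<le> a' + 1"
  shows "measure lborel (cbox (a, a') (b, b')) \<le> 1"
  using assms by (simp add: content_Pair mult_le_one)

text \<open>A function whose gradient is small in L1 differs little between most pairs of points: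
  join them by a path with one corner and integrate over both points. A value close to 0 or 1
  everywhere must then be close to the same one, which the product of the two phase masses
  expresses.\<close>

lemma separation_2d:
  fixes F F1 F2 \<theta> D :: "real \<Rightarrow> real \<Rightarrow> real"
  assumes box: "a \<le> b" "b \<le> a + 1" "a' \<le> b'" "b' \<le> a' + 1"
    and cont: "continuous_on UNIV (\<lambda>(x, y). F x y)" "continuous_on UNIV (\<lambda>(x, y). \<theta> x y)"
      "continuous_on UNIV (\<lambda>(x, y). D x y)"
    and deriv: "\<And>x y. ((\<lambda>x. F x y) has_real_derivative F1 x y) (at x)"
      "\<And>x y. (F x has_real_derivative F2 x y) (at y)"
    and bounds: "\<And>x y. \<bar>F1 x y\<bar> \<le> L * (D x y)\<^sup>2" "\<And>x y. \<bar>F2 x y\<bar> \<le> L * (D x y)\<^sup>2"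
      "\<And>x y. 0 \<le> \<theta> x y" "\<And>x y. \<theta> x y \<le> 1" "\<And>x y. 0 \<le> F x y" "\<And>x y. F x y \<le> 1"
      "\<And>x y. \<bar>\<theta> x y - F x y\<bar> \<le> K * D x y" "\<And>x y. F x y * (1 - F x y) \<le> K * D x y" "\<And>x y. 0 \<le> D x y"
    and K: "0 \<le> K" "0 \<le> L"
  shows "integral (cbox (a, a') (b, b')) (\<lambda>(x, y). \<theta> x y) * integral (cbox (a, a') (b, b')) (\<lambda>(x, y). 1 - \<theta> x y)
    \<le> 2 * L * integral (cbox (a, a') (b, b')) (\<lambda>(x, y). (D x y)\<^sup>2)
      + 5 * K * sqrt (integral (cbox (a, a') (b, b')) (\<lambda>(x, y). (D x y)\<^sup>2))"
proof -
  let ?I = "integral (cbox (a, a') (b, b'))"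
  note cont' [continuous_intros] = cont[THEN continuous_on_compose_Pair]
  note unit = content_rectangle_le_1[OF box]
  define H where "H x y = L * (D x y)\<^sup>2" for x y
  define A where "A y = integral {a..b} (\<lambda>s. H s y)" for y
  define B where "B x = integral {a'..b'} (\<lambda>s. H x s)" for x
  have cH: "continuous_on UNIV (\<lambda>(x, y). H x y)"
    unfolding H_def split_beta by (intro continuous_intros)
  have cH': "continuous_on UNIV (\<lambda>(y, x). H x y)"
    unfolding H_def split_beta by (intro continuous_intros)
  note cH2 [continuous_intros] = continuous_on_compose_Pair[OF cH]
  have "continuous_on UNIV A"
    unfolding A_def by (rule continuous_on_integral_param[OF cH'])
  note cA [continuous_intros] = continuous_on_compose2[OF this _ subset_UNIV]
  have "continuous_on UNIV B"
    unfolding B_def by (rule continuous_on_integral_param[OF cH])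
  note cB [continuous_intros] = continuous_on_compose2[OF this _ subset_UNIV]
  have H_nonneg: "0 \<le> H x y" for x y
    using K by (simp add: H_def)
  \<comment> \<open>The path runs horizontally at height \<open>y\<close> and then vertically at
    abscissa \<open>x'\<close>. Each leg is bounded by the integral over a full line, so the bound
    splits into functions of \<open>y\<close> and of \<open>x'\<close> alone.\<close>
  have osc: "\<bar>F x y - F x' y'\<bar> \<le> A y + B x'" if "(x, y) \<in> cbox (a, a') (b, b')" "(x', y') \<in> cbox (a, a') (b, b')" for x y x' y'
  proof -
    have "\<bar>F x y - F x' y\<bar> \<le> A y"
      unfolding A_def
      by (rule FTC_bound[OF deriv(1)]) (use bounds(1) that in \<open>auto simp flip: H_def intro: continuous_intros\<close>)
    moreover have "\<bar>F x' y - F x' y'\<bar> \<le> B x'"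
      unfolding B_def
      by (rule FTC_bound[OF deriv(2)]) (use bounds(2) that in \<open>auto simp flip: H_def intro: continuous_intros\<close>)
    ultimately show ?thesis by linarith
  qed
  \<comment> \<open>At the second point \<open>K * D\<close> arises three times: from exchanging
    \<open>\<theta>\<close> for \<open>F\<close> in the difference and in the mixing term, and from
    \<open>F * (1 - F)\<close>. The factor 4 is rounded up.\<close>
  have pt: "\<theta> x y * (1 - \<theta> x' y') \<le> A y + B x' + K * D x y + 4 * K * D x' y'"
    if "(x, y) \<in> cbox (a, a') (b, b')" "(x', y') \<in> cbox (a, a') (b, b')" for x y x' y'
  proof -
    have "\<theta> x y * (1 - \<theta> x' y') \<le> \<bar>\<theta> x y - \<theta> x' y'\<bar> + \<theta> x' y' * (1 - \<theta> x' y')"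
      by (rule mult_mixing_bound) (use bounds in auto)
    moreover have "\<theta> x' y' * (1 - \<theta> x' y') \<le> \<bar>\<theta> x' y' - F x' y'\<bar> + F x' y' * (1 - F x' y')"
      by (rule mixing_lipschitz) (use bounds in auto)
    moreover have "\<bar>\<theta> x y - \<theta> x' y'\<bar> \<le> \<bar>\<theta> x y - F x y\<bar> + \<bar>F x y - F x' y'\<bar> + \<bar>\<theta> x' y' - F x' y'\<bar>"
      by linarith
    ultimately show ?thesis
      using osc[OF that] bounds(7)[of x y] bounds(7,8)[of x' y'] bounds(9)[of x' y'] K
        mult_nonneg_nonneg[of K "D x' y'"] by linarith
  qed
  define IA where "IA = ?I (\<lambda>(x, y). A y)"
  define IB where "IB = ?I (\<lambda>(x, y). B x)"
  define ID where "ID = ?I (\<lambda>(x, y). D x y)"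
  have int: "continuous_on UNIV \<phi> \<Longrightarrow> \<phi> integrable_on cbox (a, a') (b, b')" for \<phi> :: "real \<times> real \<Rightarrow> real"
    by (rule integrable_continuous, rule continuous_on_subset) auto
  have int2: "(\<lambda>(x, y). A y) integrable_on cbox (a, a') (b, b')" "(\<lambda>(x, y). B x) integrable_on cbox (a, a') (b, b')"
    "(\<lambda>(x, y). D x y) integrable_on cbox (a, a') (b, b')" "(\<lambda>(x, y). \<theta> x y) integrable_on cbox (a, a') (b, b')"
    "(\<lambda>(x, y). 1 - \<theta> x y) integrable_on cbox (a, a') (b, b')"
    unfolding split_beta by (intro int continuous_intros)+
  have const: "?I (\<lambda>p. k) \<le> k" if "0 \<le> k" for k :: real
    using unit that mult_left_le_one_le[of k "measure lborel (cbox (a, a') (b, b'))"] by simp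
  have nonneg: "0 \<le> B x" "0 \<le> D x y" for x y
    using H_nonneg bounds(9) unfolding B_def by (auto intro!: integral_nonneg integrable_continuous_real continuous_intros)
  have step: "?I (\<lambda>(x, y). \<theta> x y) * (1 - \<theta> x' y') \<le> IA + B x' + K * ID + 4 * K * D x' y'"
    if "(x', y') \<in> cbox (a, a') (b, b')" for x' y'
  proof -
    have "?I (\<lambda>(x, y). \<theta> x y) * (1 - \<theta> x' y') = ?I (\<lambda>p. (case p of (x, y) \<Rightarrow> \<theta> x y) * (1 - \<theta> x' y'))"
      by (rule integral_mult_left[symmetric])
    also have "\<dots> \<le> ?I (\<lambda>p. (case p of (x, y) \<Rightarrow> A y) + K * (case p of (x, y) \<Rightarrow> D x y) + (B x' + 4 * K * D x' y'))"
      using pt[OF _ that]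
      by (intro integral_le int) (auto simp: split_beta algebra_simps intro!: continuous_intros)
    also have "\<dots> = IA + K * ID + ?I (\<lambda>p. B x' + 4 * K * D x' y')"
      unfolding IA_def ID_def using int2
      by (intro integral_unique has_integral_add has_integral_mult_right integrable_integral) auto
    also have "\<dots> \<le> IA + K * ID + (B x' + 4 * K * D x' y')"
      using nonneg K by (intro add_left_mono const) auto
    finally show ?thesis
      by simp
  qed
  have AI: "0 \<le> IA + K * ID"
    unfolding IA_def ID_def A_def using K bounds(9) H_nonneg
    by (intro add_nonneg_nonneg mult_nonneg_nonneg integral_nonneg)
      (auto intro!: integral_nonneg integrable_continuous_real continuous_intros int2[unfolded A_def])
  have "?I (\<lambda>(x, y). \<theta> x y) * ?I (\<lambda>(x, y). 1 - \<theta> x y) = ?I (\<lambda>p. ?I (\<lambda>(x, y). \<theta> x y) * (case p of (x, y) \<Rightarrow> 1 - \<theta> x y))"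
    by (rule integral_mult_right[symmetric])
  also have "\<dots> \<le> ?I (\<lambda>p. (case p of (x, y) \<Rightarrow> B x) + 4 * K * (case p of (x, y) \<Rightarrow> D x y) + (IA + K * ID))"
    using step by (intro integral_le int) (auto simp: split_beta algebra_simps intro!: continuous_intros)
  also have "\<dots> = IB + 4 * K * ID + ?I (\<lambda>p. IA + K * ID)"
    unfolding IB_def ID_def using int2
    by (intro integral_unique has_integral_add has_integral_mult_right integrable_integral) auto
  also have "\<dots> \<le> IB + 4 * K * ID + (IA + K * ID)"
    using AI by (intro add_left_mono const) auto
  finally have main: "?I (\<lambda>(x, y). \<theta> x y) * ?I (\<lambda>(x, y). 1 - \<theta> x y) \<le> IA + IB + 5 * K * ID"
    by (simp add: algebra_simps)
  have "IA \<le> ?I (\<lambda>(x, y). H x y)"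
    unfolding IA_def A_def using integral_slab_le(1)[OF cH H_nonneg, of a b a' b'] box by simp
  moreover have "IB \<le> ?I (\<lambda>(x, y). H x y)"
  proof -
    \<comment> \<open>\<open>integral_slab_le\<close> for vertical lines lives on the rectangle with
      exchanged factors; Fubini identifies the two integrals of \<open>H\<close>.\<close>
    have "integral (cbox (a', a) (b', b)) (\<lambda>(y, x). H x y)
        = integral (cbox a' b') (\<lambda>y. integral (cbox a b) (\<lambda>x. H x y))"
      by (subst integral_prod_continuous) (rule continuous_on_subset[OF cH'], simp_all)
    also have "\<dots> = integral (cbox a b) (\<lambda>x. integral (cbox a' b') (H x))"
      by (rule integral_swap_continuous[symmetric], rule continuous_on_subset[OF cH]) simp
    also have "\<dots> = ?I (\<lambda>(x, y). H x y)"
      by (subst integral_prod_continuous) (rule continuous_on_subset[OF cH], simp_all)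
    finally have "integral (cbox (a', a) (b', b)) (\<lambda>(y, x). H x y) = ?I (\<lambda>(x, y). H x y)" .
    then show ?thesis
      unfolding IB_def B_def using integral_slab_le(2)[OF cH' H_nonneg, of a' b' a b] box by simp
  qed
  moreover have "?I (\<lambda>(x, y). H x y) = L * ?I (\<lambda>(x, y). (D x y)\<^sup>2)"
    unfolding H_def split_beta by (rule integral_mult_right)
  moreover have "5 * K * ID \<le> 5 * K * sqrt (?I (\<lambda>(x, y). (D x y)\<^sup>2))"
    unfolding ID_def split_beta using unit K
    by (intro mult_left_mono integral_Cauchy_Schwarz_unit continuous_intros) auto
  ultimately show ?thesis
    using main by linarith
qed

section \<open>Integrals of horizontally shifted and averaged functions\<close>

lemma continuous_on_average_param:
  fixes k :: "real \<Rightarrow> real \<Rightarrow> real"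
  assumes "continuous_on UNIV (\<lambda>(x, y). k x y)"
  shows "continuous_on UNIV (\<lambda>(x, y). integral {0..1} (\<lambda>t. k (x + h * t) y))"
  unfolding split_beta
  by (rule continuous_on_integral_param)
    (auto simp: split_beta intro!: continuous_intros continuous_on_compose_Pair[OF assms])

lemma integral_average_le:
  fixes k :: "real \<Rightarrow> real \<Rightarrow> real"
  assumes k: "continuous_on UNIV (\<lambda>(x, y). k x y)" and nonneg: "\<And>x y. 0 \<le> k x y"
    and "0 \<le> h" "a \<le> b" "0 \<le> t" "t \<le> 1"
  shows "integral (cbox (a, a') (b, b')) (\<lambda>(x, y). k (x + h * t) y)
    \<le> integral (cbox (a, a') (b + h, b')) (\<lambda>(x, y). k x y)"
proof -
  note cont [continuous_intros] = continuous_on_compose_Pair[OF k]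
  define K where "K x = integral {a'..b'} (k x)" for x
  have cK: "continuous_on S K" for S
    unfolding K_def by (rule continuous_on_integral_param[OF k])
  have "integral (cbox (a, a') (b, b')) (\<lambda>(x, y). k (x + h * t) y) = integral {a..b} (K \<circ> (\<lambda>x. x + h * t))"
    unfolding K_def o_def split_beta
    by (subst integral_prod_continuous) (auto intro!: continuous_intros)
  also have "\<dots> = integral {a + h * t..b + h * t} K"
    by (rule integral_shift[OF cK])
  also have "\<dots> \<le> integral {a..b + h} K"
  proof (rule integral_subset_le)
    have "h * t \<le> h" "0 \<le> h * t"
      using assms by (auto intro: mult_left_le)
    then show "{a + h * t..b + h * t} \<subseteq> {a..b + h}"
      by auto
  qed (use nonneg in \<open>auto simp: K_def intro!: integral_nonneg integrable_continuous_real continuous_intros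
      cK[unfolded K_def]\<close>)
  also have "\<dots> = integral (cbox (a, a') (b + h, b')) (\<lambda>(x, y). k x y)"
    unfolding K_def split_beta
    by (subst integral_prod_continuous) (auto intro!: continuous_intros)
  finally show ?thesis .
qed

lemma integral_double_average_le:
  fixes k :: "real \<Rightarrow> real \<Rightarrow> real"
  assumes k: "continuous_on UNIV (\<lambda>(x, y). k x y)" and nonneg: "\<And>x y. 0 \<le> k x y"
    and "0 \<le> h" "a \<le> b"
  shows "integral (cbox (a, a') (b, b')) (\<lambda>(x, y). integral {0..1} (\<lambda>t. k (x + h * t) y))
    \<le> integral (cbox (a, a') (b + h, b')) (\<lambda>(x, y). k x y)"
proof -
  note cont [continuous_intros] = continuous_on_compose_Pair[OF k]
  let ?E = "integral (cbox (a, a') (b + h, b')) (\<lambda>(x, y). k x y)"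
  have "integral (cbox (a, a') (b, b')) (\<lambda>(x, y). integral {0..1} (\<lambda>t. k (x + h * t) y))
      = integral (cbox (a, a') (b, b')) (\<lambda>p. integral (cbox 0 1) (\<lambda>t. k (fst p + h * t) (snd p)))"
    unfolding split_beta cbox_interval by (rule refl)
  also have "\<dots> = integral (cbox 0 1) (\<lambda>t. integral (cbox (a, a') (b, b')) (\<lambda>p. k (fst p + h * t) (snd p)))"
    by (rule integral_swap_continuous) (auto simp: split_beta intro!: continuous_intros)
  also have "\<dots> \<le> integral (cbox 0 1) (\<lambda>t::real. ?E)"
  proof (rule integral_le)
    show "(\<lambda>t. integral (cbox (a, a') (b, b')) (\<lambda>p. k (fst p + h * t) (snd p))) integrable_on cbox 0 1"
      by (intro integrable_continuous integral_continuous_on_param)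
        (auto simp: split_beta intro!: continuous_intros)
    show "integral (cbox (a, a') (b, b')) (\<lambda>p. k (fst p + h * t) (snd p)) \<le> ?E" if "t \<in> cbox 0 1" for t
      using integral_average_le[OF assms, of t a' b'] that by (simp add: case_prod_unfold)
  qed (rule integrable_const)
  also have "\<dots> = ?E"
    by simp
  finally show ?thesis .
qed

text \<open>The functions are kept apart from the weight, since the weight depends on the box and is
  chosen only in \<open>cell_separation\<close>. Besides its derivatives, \<open>g\<close> itself is
  recorded because the second horizontal derivative of the average is computed from it.\<close>

locale cell_functions =
  fixes h :: real and f f1 f3 g g1 g2 g3 g13 e :: "real \<Rightarrow> real \<Rightarrow> real \<Rightarrow> real"
  assumes h: "h > 0"
    and cont: "continuous_on UNIV (\<lambda>(x, y, z). f x y z)" "continuous_on UNIV (\<lambda>(x, y, z). f1 x y z)"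
      "continuous_on UNIV (\<lambda>(x, y, z). f3 x y z)" "continuous_on UNIV (\<lambda>(x, y, z). g x y z)"
      "continuous_on UNIV (\<lambda>(x, y, z). g1 x y z)" "continuous_on UNIV (\<lambda>(x, y, z). g2 x y z)"
      "continuous_on UNIV (\<lambda>(x, y, z). g3 x y z)" "continuous_on UNIV (\<lambda>(x, y, z). g13 x y z)"
      "continuous_on UNIV (\<lambda>(x, y, z). e x y z)"
    and deriv: "\<And>x y z. ((\<lambda>x. f x y z) has_real_derivative f1 x y z) (at x)"
      "\<And>x y z. (f x y has_real_derivative f3 x y z) (at z)"
      "\<And>x y z. ((\<lambda>y. g x y z) has_real_derivative g2 x y z) (at y)"
      "\<And>x y z. (g x y has_real_derivative g3 x y z) (at z)"
      "\<And>x y z. ((\<lambda>x. g3 x y z) has_real_derivative g13 x y z) (at x)"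
      "\<And>x y z. (g1 x y has_real_derivative g13 x y z) (at z)"
    and bounds: "\<And>x y z. 0 \<le> e x y z" "\<And>x y z. \<bar>f1 x y z - g3 x y z / h\<bar> \<le> e x y z"
      "\<And>x y z. \<bar>f3 x y z\<bar> \<le> h * e x y z" "\<And>x y z. \<bar>g1 x y z\<bar> \<le> e x y z" "\<And>x y z. \<bar>g2 x y z\<bar> \<le> e x y z"
      "\<And>x y z. \<bar>f1 x y z - (f1 x y z)\<^sup>2\<bar> \<le> e x y z + (e x y z)\<^sup>2" "\<And>x y z. \<bar>f1 x y z\<bar> \<le> 1 + e x y z"

locale cell = cutoff_weight + cell_functions
begin

lemmas cont3 = cont[THEN continuous_on_compose_Triple]
lemmas cont_weights =
  continuous_on_compose2[OF cont_\<eta>[of UNIV] _ subset_UNIV]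
  continuous_on_compose2[OF cont_\<eta>'[of UNIV] _ subset_UNIV]

lemma slice: "slice \<alpha> \<beta> c \<eta> \<eta>' h (\<lambda>x z. f x y z) (\<lambda>x z. f1 x y z) (\<lambda>x z. f3 x y z)
    (\<lambda>x z. g1 x y z) (\<lambda>x z. g3 x y z) (\<lambda>x z. g13 x y z) (\<lambda>x z. e x y z)"
proof (unfold_locales, goal_cases)
  case 1 show ?case by (rule h)
qed (use deriv bounds in \<open>auto simp: split_beta intro!: cont3 continuous_intros\<close>)

abbreviation "J \<equiv> integral {\<alpha>..\<beta>}"

definition "d2 x y = J (\<lambda>z. (e x y z)\<^sup>2)"
definition "Q x y = J (\<lambda>z. \<eta> z * (g3 x y z / h))"
definition "Q1 x y = J (\<lambda>z. \<eta> z * (g13 x y z / h))"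
definition "Q2 x y = - J (\<lambda>z. \<eta>' z * (g2 x y z / h))"
definition "m x y = integral {0..1} (\<lambda>t. Q (x + h * t) y)"
definition "m1 x y = integral {0..1} (\<lambda>t. Q1 (x + h * t) y)"
definition "m2 x y = integral {0..1} (\<lambda>t. Q2 (x + h * t) y)"
definition "D x y = sqrt (d2 x y + d2 (x + h) y + integral {0..1} (\<lambda>t. d2 (x + h * t) y))"
definition "\<theta> x y = J (\<lambda>z. \<eta> z * transition (f1 x y z))"

lemma cont_J_param:
  fixes k :: "real \<Rightarrow> real \<Rightarrow> real \<Rightarrow> real"
  assumes "continuous_on UNIV (\<lambda>(x, y, z). k x y z)"
  shows "continuous_on UNIV (\<lambda>(x, y). J (\<lambda>z. k x y z))"
  unfolding split_beta
  by (rule continuous_on_integral_param)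
    (auto simp: split_beta intro!: continuous_intros continuous_on_compose_Triple[OF assms])

lemma cont_pairs:
  "continuous_on UNIV (\<lambda>(x, y). d2 x y)" "continuous_on UNIV (\<lambda>(x, y). Q x y)"
  "continuous_on UNIV (\<lambda>(x, y). Q1 x y)" "continuous_on UNIV (\<lambda>(x, y). Q2 x y)"
  "continuous_on UNIV (\<lambda>(x, y). \<theta> x y)"
proof -
  show "continuous_on UNIV (\<lambda>(x, y). d2 x y)"
    unfolding d2_def by (rule cont_J_param) (auto simp: split_beta intro!: continuous_intros cont3)
  show "continuous_on UNIV (\<lambda>(x, y). Q x y)"
    unfolding Q_def by (rule cont_J_param)
      (use h in \<open>auto simp: split_beta intro!: continuous_intros cont3 cont_weights\<close>)
  show "continuous_on UNIV (\<lambda>(x, y). Q1 x y)"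
    unfolding Q1_def by (rule cont_J_param)
      (use h in \<open>auto simp: split_beta intro!: continuous_intros cont3 cont_weights\<close>)
  have "continuous_on UNIV (\<lambda>(x, y). J (\<lambda>z. \<eta>' z * (g2 x y z / h)))"
    by (rule cont_J_param)
      (use h in \<open>auto simp: split_beta intro!: continuous_intros cont3 cont_weights\<close>)
  then show "continuous_on UNIV (\<lambda>(x, y). Q2 x y)"
    unfolding Q2_def split_beta by (rule continuous_on_minus)
  show "continuous_on UNIV (\<lambda>(x, y). \<theta> x y)"
    unfolding \<theta>_def by (rule cont_J_param)
      (auto simp: split_beta intro!: continuous_intros cont3 cont_weights)
qed

lemma cont_averages:
  "continuous_on UNIV (\<lambda>(x, y). m x y)" "continuous_on UNIV (\<lambda>(x, y). m1 x y)"
  "continuous_on UNIV (\<lambda>(x, y). m2 x y)" "continuous_on UNIV (\<lambda>(x, y). integral {0..1} (\<lambda>t. d2 (x + h * t) y))"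
  unfolding m_def m1_def m2_def by (intro continuous_on_average_param cont_pairs)+

lemma cont_D: "continuous_on UNIV (\<lambda>(x, y). D x y)"
  unfolding D_def split_beta
  by (intro continuous_intros continuous_on_compose_Pair[OF cont_pairs(1)] continuous_on_compose_Pair[OF cont_averages(4)])

lemma slice_eqs:
  "slice.Q \<alpha> \<beta> \<eta> h (\<lambda>x z. g3 x y z) = (\<lambda>x. Q x y)"
  "slice.Q' \<alpha> \<beta> \<eta> h (\<lambda>x z. g13 x y z) = (\<lambda>x. Q1 x y)"
  "slice.m \<alpha> \<beta> \<eta> h (\<lambda>x z. g3 x y z) = (\<lambda>x. m x y)"
  "(slice.d \<alpha> \<beta> (\<lambda>x z. e x y z) x)\<^sup>2 = d2 x y"
  "slice.D \<alpha> \<beta> h (\<lambda>x z. e x y z) = (\<lambda>x. D x y)"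
proof -
  show Q: "slice.Q \<alpha> \<beta> \<eta> h (\<lambda>x z. g3 x y z) = (\<lambda>x. Q x y)"
    by (rule ext) (simp add: slice.Q_def[OF slice] Q_def)
  show "slice.Q' \<alpha> \<beta> \<eta> h (\<lambda>x z. g13 x y z) = (\<lambda>x. Q1 x y)"
    by (rule ext) (simp add: slice.Q'_def[OF slice] Q1_def)
  show "slice.m \<alpha> \<beta> \<eta> h (\<lambda>x z. g3 x y z) = (\<lambda>x. m x y)"
    by (rule ext) (simp add: slice.m_def[OF slice] Q m_def)
  show d: "(slice.d \<alpha> \<beta> (\<lambda>x z. e x y z) x)\<^sup>2 = d2 x y" for x
    by (simp add: slice.d_sq[OF slice] d2_def)
  show "slice.D \<alpha> \<beta> h (\<lambda>x z. e x y z) = (\<lambda>x. D x y)"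
    by (rule ext) (simp add: slice.D_def[OF slice] d D_def)
qed

lemma d2_nonneg: "0 \<le> d2 x y"
  by (simp flip: slice_eqs(4))

lemma D_nonneg: "0 \<le> D x y"
  using slice.D_ge(1)[OF slice] by (simp add: slice_eqs)

lemma D_sq: "(D x y)\<^sup>2 = d2 x y + d2 (x + h) y + integral {0..1} (\<lambda>t. d2 (x + h * t) y)"
  using slice.D_sq[OF slice] by (simp add: slice_eqs)

lemma m_defect: "\<bar>m x y - (m x y)\<^sup>2\<bar> \<le> 12 * c\<^sup>2 * (D x y + (D x y)\<^sup>2)"
  using slice.m_defect[OF slice, of y x] by (simp add: slice_eqs)

lemma m_DERIV1: "((\<lambda>x. m x y) has_real_derivative m1 x y) (at x)"
  and m1_bound: "\<bar>m1 x y\<bar> \<le> c * D x y / h"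
  using slice.m_DERIV[OF slice, of y x] slice.m_deriv_bound[OF slice, of y x]
  by (simp_all add: slice_eqs m1_def)

lemma \<theta>_bound: "\<bar>\<theta> x y - transition (m x y)\<bar> \<le> 28 * c\<^sup>2 * (D x y + (D x y)\<^sup>2)"
  using slice.transition_average_bound[OF slice, of x y] by (simp add: slice_eqs \<theta>_def)

text \<open>Freed of the vertical derivative, the average can be differentiated in \<open>y\<close>
  under the integral, and only \<open>g2\<close> appears.\<close>

lemma Q_by_parts: "Q x y = - J (\<lambda>z. \<eta>' z * (g x y z / h))"
  unfolding Q_def
  using order h by (intro integral_by_parts_zero \<eta>_DERIV DERIV_cdivide deriv \<eta>_ends continuous_intros cont_weights cont3) auto

lemma m_DERIV2: "(m x has_real_derivative m2 x y) (at y)"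
proof -
  have Q: "((\<lambda>y. Q x y) has_real_derivative Q2 x y) (at y)" for x y
    unfolding Q_by_parts Q2_def
    by (rule DERIV_minus, rule integral_param_DERIV)
      (use h in \<open>auto simp: split_beta intro!: DERIV_cmult DERIV_cdivide deriv continuous_intros cont3 cont_weights\<close>)
  show ?thesis
    unfolding m_def[abs_def] m2_def
    by (rule integral_param_DERIV)
      (auto simp: split_beta intro!: Q continuous_intros cont_pairs[THEN continuous_on_compose_Pair])
qed

lemma m2_bound: "\<bar>m2 x y\<bar> \<le> c * D x y / h"
proof -
  have Q2: "\<bar>Q2 x y\<bar> \<le> (c / h) * slice.d \<alpha> \<beta> (\<lambda>x z. e x y z) x + 0 * (slice.d \<alpha> \<beta> (\<lambda>x z. e x y z) x)\<^sup>2" for x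
  proof -
    have "\<bar>J (\<lambda>z. \<eta>' z * (g2 x y z / h))\<bar> \<le> c * (0 + (1 / h) * slice.d \<alpha> \<beta> (\<lambda>x z. e x y z) x
        + 0 * (slice.d \<alpha> \<beta> (\<lambda>x z. e x y z) x)\<^sup>2)"
      using h bounds(5) abs_weights
      by (intro slice.J_bound[OF slice]) (auto intro!: continuous_intros cont3 cont_weights divide_right_mono)
    then show ?thesis
      by (simp add: Q2_def)
  qed
  have "\<bar>m2 x y\<bar> \<le> (c / h) * slice.D \<alpha> \<beta> h (\<lambda>x z. e x y z) x + 0 * (slice.D \<alpha> \<beta> h (\<lambda>x z. e x y z) x)\<^sup>2"
    unfolding m2_def using c h Q2
    by (intro slice.average_bound[OF slice]) (auto intro!: continuous_intros cont_pairs[THEN continuous_on_compose_Pair])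
  then show ?thesis
    by (simp add: slice_eqs)
qed

lemma \<theta>_range: "0 \<le> \<theta> x y" "\<theta> x y \<le> 1"
proof -
  show "0 \<le> \<theta> x y"
    unfolding \<theta>_def using \<eta>_bounds transition_bounds
    by (intro integral_nonneg integrable_continuous_real continuous_intros cont3 cont_weights) auto
  have "\<theta> x y \<le> J (\<lambda>z. \<eta> z * 1)"
    unfolding \<theta>_def using \<eta>_bounds transition_bounds
    by (intro integral_le integrable_continuous_real continuous_intros cont3 cont_weights mult_left_mono) auto
  then show "\<theta> x y \<le> 1"
    by (simp add: \<eta>_integral)
qed

lemma separation:
  assumes box: "a \<le> b" "b \<le> a + 1" "a' \<le> b'" "b' \<le> a' + 1"
  defines "E \<equiv> integral (cbox (a, a') (b + h, b')) (\<lambda>(x, y). d2 x y)"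
  shows "integral (cbox (a, a') (b, b')) (\<lambda>(x, y). \<theta> x y) * integral (cbox (a, a') (b, b')) (\<lambda>(x, y). 1 - \<theta> x y)
    \<le> 1200 * c^3 * (E / h) + 1000 * c\<^sup>2 * sqrt E"
proof -
  let ?I = "integral (cbox (a, a') (b, b'))"
  define ID where "ID = ?I (\<lambda>(x, y). (D x y)\<^sup>2)"
  have c2: "1 \<le> c\<^sup>2"
    using c by simp
  \<comment> \<open>\<open>m_defect\<close> contributes 8 * 12 = 96 to a quadratic bound, and the
    bound 2 of the slope makes it linear: 2 * 96 + 2 is at most 200. A remaining square would
    produce a third power of \<open>D\<close> in the gradient, which an L2 bound cannot
    integrate.\<close>
  have td: "\<bar>transition_deriv (m x y)\<bar> \<le> 200 * c\<^sup>2 * D x y" for x y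
  proof -
    have "\<bar>transition_deriv (m x y)\<bar> \<le> 96 * c\<^sup>2 * (D x y + (D x y)\<^sup>2)"
      using order_trans[OF transition_deriv_bound1 mult_left_mono[OF m_defect[of x y], of 8]] by simp
    then have "\<bar>transition_deriv (m x y)\<bar> \<le> (2 * (96 * c\<^sup>2) + 2) * D x y"
      by (intro min_quadratic_bound transition_deriv_bound2 D_nonneg) auto
    also have "\<dots> \<le> 200 * c\<^sup>2 * D x y"
      using c2 D_nonneg by (intro mult_right_mono) auto
    finally show ?thesis .
  qed
  have prod: "\<bar>transition_deriv (m x y) * v\<bar> \<le> 200 * c^3 / h * (D x y)\<^sup>2" if "\<bar>v\<bar> \<le> c * D x y / h" for v x y
  proof -
    have "\<bar>transition_deriv (m x y)\<bar> * \<bar>v\<bar> \<le> (200 * c\<^sup>2 * D x y) * (c * D x y / h)"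
      using td[of x y] that by (intro mult_mono) auto
    then show ?thesis
      by (simp add: abs_mult power2_eq_square power3_eq_cube mult_ac)
  qed
  have "?I (\<lambda>(x, y). \<theta> x y) * ?I (\<lambda>(x, y). 1 - \<theta> x y) \<le> 2 * (200 * c^3 / h) * ID + 5 * (100 * c\<^sup>2) * sqrt ID"
    unfolding ID_def
  proof (rule separation_2d[where F = "\<lambda>x y. transition (m x y)"])
    show "((\<lambda>x. transition (m x y)) has_real_derivative transition_deriv (m x y) * m1 x y) (at x)" for x y
      by (rule DERIV_chain2[OF transition_DERIV m_DERIV1])
    show "((\<lambda>y. transition (m x y)) has_real_derivative transition_deriv (m x y) * m2 x y) (at y)" for x y
      by (rule DERIV_chain2[OF transition_DERIV m_DERIV2])
    show "\<bar>transition_deriv (m x y) * m1 x y\<bar> \<le> 200 * c^3 / h * (D x y)\<^sup>2"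
      "\<bar>transition_deriv (m x y) * m2 x y\<bar> \<le> 200 * c^3 / h * (D x y)\<^sup>2" for x y
      by (intro prod m1_bound m2_bound)+
    show "continuous_on UNIV (\<lambda>(x, y). transition (m x y))"
      using cont_averages(1) unfolding split_beta by (rule continuous_on_transition)
    show "\<bar>\<theta> x y - transition (m x y)\<bar> \<le> 100 * c\<^sup>2 * D x y" for x y
    proof -
      have "\<bar>\<theta> x y - transition (m x y)\<bar> \<le> (2 * (28 * c\<^sup>2) + 1) * D x y"
        using \<theta>_range[of x y] transition_bounds[of "m x y"]
        by (intro min_quadratic_bound \<theta>_bound D_nonneg) auto
      also have "\<dots> \<le> 100 * c\<^sup>2 * D x y"
        using c2 D_nonneg by (intro mult_right_mono) auto
      finally show ?thesis .
    qed
    show "transition (m x y) * (1 - transition (m x y)) \<le> 100 * c\<^sup>2 * D x y" for x y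
    proof -
      have "transition (m x y) * (1 - transition (m x y)) \<le> 48 * c\<^sup>2 * (D x y + (D x y)\<^sup>2)"
        using order_trans[OF transition_mixing_bound(1) mult_left_mono[OF m_defect[of x y], of 4]] by simp
      then have "transition (m x y) * (1 - transition (m x y)) \<le> (2 * (48 * c\<^sup>2) + 1) * D x y"
        by (intro min_quadratic_bound transition_mixing_bound(2) D_nonneg) auto
      also have "\<dots> \<le> 100 * c\<^sup>2 * D x y"
        using c2 D_nonneg by (intro mult_right_mono) auto
      finally show ?thesis .
    qed
  qed (use box c h in \<open>auto intro: cont_pairs cont_D \<theta>_range transition_bounds D_nonneg\<close>)
  then have main: "?I (\<lambda>(x, y). \<theta> x y) * ?I (\<lambda>(x, y). 1 - \<theta> x y) \<le> 2 * (200 * c^3 / h) * ID + 5 * (100 * c\<^sup>2) * sqrt ID" .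
  \<comment> \<open>Each of the three terms of \<open>D\<^sup>2\<close> integrates to at most
    \<open>E\<close>; the domain of \<open>E\<close> is longer by \<open>h\<close> in order to
    contain all horizontal shifts.\<close>
  have ID: "ID \<le> 3 * E"
  proof -
    have 1: "?I (\<lambda>(x, y). d2 (x + h * t) y) \<le> E" if "0 \<le> t" "t \<le> 1" for t
      unfolding E_def using h box that by (intro integral_average_le cont_pairs d2_nonneg) auto
    have 2: "?I (\<lambda>(x, y). integral {0..1} (\<lambda>t. d2 (x + h * t) y)) \<le> E"
      unfolding E_def using h box by (intro integral_double_average_le cont_pairs d2_nonneg) auto
    have "ID = ?I (\<lambda>p. ((case p of (x, y) \<Rightarrow> d2 (x + h * 0) y) + (case p of (x, y) \<Rightarrow> d2 (x + h * 1) y))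
      + (case p of (x, y) \<Rightarrow> integral {0..1} (\<lambda>t. d2 (x + h * t) y)))"
      unfolding ID_def by (intro integral_cong) (auto simp: D_sq)
    also have "\<dots> = ?I (\<lambda>(x, y). d2 (x + h * 0) y) + ?I (\<lambda>(x, y). d2 (x + h * 1) y)
      + ?I (\<lambda>(x, y). integral {0..1} (\<lambda>t. d2 (x + h * t) y))"
      by (intro integral_unique has_integral_add integrable_integral integrable_continuous)
        (auto simp: split_beta intro!: continuous_intros cont_pairs[THEN continuous_on_compose_Pair]
          cont_averages[THEN continuous_on_compose_Pair])
    finally show ?thesis
      using 1[of 0] 1[of 1] 2 by linarith
  qed
  have "0 \<le> E"
    unfolding E_def split_beta using d2_nonneg
    by (intro integral_nonneg integrable_continuous continuous_on_compose_Pair[OF cont_pairs(1)] continuous_intros) auto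
  have "sqrt ID \<le> sqrt (4 * E)"
    using ID \<open>0 \<le> E\<close> by (intro real_sqrt_le_mono) linarith
  then have "sqrt ID \<le> 2 * sqrt E"
    by (simp add: real_sqrt_mult)
  then have "5 * (100 * c\<^sup>2) * sqrt ID \<le> 5 * (100 * c\<^sup>2) * (2 * sqrt E)"
    by (intro mult_left_mono) auto
  moreover have "2 * (200 * c^3 / h) * ID \<le> 2 * (200 * c^3 / h) * (3 * E)"
    using ID h c by (intro mult_left_mono) auto
  moreover have "2 * (200 * c^3 / h) * (3 * E) = 1200 * c^3 * (E / h)"
    "5 * (100 * c\<^sup>2) * (2 * sqrt E) = 1000 * c\<^sup>2 * sqrt E"
    by simp_all
  ultimately show ?thesis
    using main by linarith
qed

end

section \<open>From vectors of three components to iterated integrals\<close>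

lemma integral_cbox_vec3:
  fixes k :: "real^3 \<Rightarrow> real"
  assumes "continuous_on UNIV k"
  shows "integral (cbox l u) k
    = integral (cbox (l$1, l$2, l$3) (u$1, u$2, u$3)) (\<lambda>(x, y, z). k (vector [x, y, z]))"
proof -
  \<comment> \<open>\<open>G\<close> and its inverse \<open>H\<close> identify triples with vectors.
    They carry boxes to boxes of equal content, so the change of variables has factor 1.\<close>
  define G where "G = (\<lambda>(x, y, z). vector [x, y, z] :: real^3)"
  define H where "H v = (v$1, v$2, v$3)" for v :: "real^3"
  have HG: "H (G p) = p" for p
    by (cases p) (simp add: H_def G_def)
  have GH: "G (H v) = v" for v
    by (simp add: H_def G_def vec_eq_iff forall_3)
  have mem: "G s \<in> cbox (G p) (G q) \<longleftrightarrow> s \<in> cbox p q" for s p q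
    by (cases s; cases p; cases q) (auto simp: G_def mem_box_cart forall_3 cbox_Pair_eq)
  have img: "G ` cbox p q = cbox (G p) (G q)" for p q
  proof (intro equalityI subsetI)
    fix v assume "v \<in> cbox (G p) (G q)"
    then have "H v \<in> cbox p q"
      using mem[of "H v" p q] by (simp add: GH)
    then show "v \<in> G ` cbox p q"
      by (intro image_eqI[of _ _ "H v"]) (simp_all add: GH)
  qed (auto simp: mem)
  have imgH: "H ` cbox v w = cbox (H v) (H w)" for v w
  proof -
    have "H ` cbox v w = H ` G ` cbox (H v) (H w)"
      by (simp add: img GH)
    then show ?thesis
      by (simp add: image_image HG)
  qed
  have content: "measure lborel (G ` cbox p q) = 1 * measure lborel (cbox p q)" for p q
  proof -
    obtain p1 p2 p3 q1 q2 q3 where pq: "p = (p1, p2, p3)" "q = (q1, q2, q3)"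
      by (cases p; cases q) auto
    have ne: "cbox (G p) (G q) = {} \<longleftrightarrow> cbox p q = {}"
      using img[of p q] by auto
    show ?thesis
    proof (cases "cbox p q = {}")
      case True
      then show ?thesis
        by simp
    next
      case False
      then have le: "p1 \<le> q1" "p2 \<le> q2" "p3 \<le> q3"
        by (auto simp: pq cbox_Pair_eq)
      have "measure lborel (cbox (G p) (G q)) = (\<Prod>i\<in>UNIV. G q $ i - G p $ i)"
        using False ne by (intro content_cbox_cart) blast
      also have "\<dots> = (q1 - p1) * ((q2 - p2) * (q3 - p3))"
        unfolding UNIV_3 by (simp add: pq G_def)
      also have "\<dots> = measure lborel (cbox p q)"
        using le by (simp add: pq content_Pair)
      finally show ?thesis
        by (simp add: img)
    qed
  qed
  have lin: "linear G"
    unfolding G_def by (intro linearI) (auto simp: vec_eq_iff forall_3)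
  have "(k has_integral integral (cbox l u) k) (cbox l u)"
    using assms by (intro integrable_integral integrable_continuous) (auto intro: continuous_on_subset)
  then have "((\<lambda>p. k (G p)) has_integral (1 / 1) *\<^sub>R integral (cbox l u) k) (H ` cbox l u)"
  proof (rule has_integral_twiddle[rotated -1])
    show "continuous (at p) G" for p
      using lin by (simp add: linear_continuous_at linear_conv_bounded_linear)
    show "\<exists>w z. G ` cbox p q = cbox w z" for p q
      using img by blast
    show "\<exists>w z. H ` cbox p q = cbox w z" for p q
      using imgH by blast
  qed (use HG GH content in auto)
  then show ?thesis
    unfolding imgH unfolding H_def G_def by (simp add: integral_unique case_prod_unfold)
qed

lemma integral_cbox_triple:
  fixes k :: "real \<Rightarrow> real \<Rightarrow> real \<Rightarrow> real"
  assumes k: "continuous_on UNIV (\<lambda>(x, y, z). k x y z)"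
  shows "integral (cbox (a1, a2, a3) (b1, b2, b3)) (\<lambda>(x, y, z). k x y z)
    = integral (cbox (a1, a2) (b1, b2)) (\<lambda>(x, y). integral {a3..b3} (k x y))"
proof -
  note cont [continuous_intros] = continuous_on_compose_Triple[OF k]
  have "continuous_on UNIV (\<lambda>(x, y). integral {a3..b3} (k x y))"
    unfolding split_beta by (rule continuous_on_integral_param) (auto simp: split_beta intro!: continuous_intros)
  then have "integral (cbox (a1, a2) (b1, b2)) (\<lambda>(x, y). integral {a3..b3} (k x y))
      = integral (cbox a1 b1) (\<lambda>x. integral (cbox a2 b2) (\<lambda>y. integral {a3..b3} (k x y)))"
    by (subst integral_prod_continuous) (auto intro: continuous_on_subset)
  also have "\<dots> = integral (cbox a1 b1) (\<lambda>x. integral (cbox (a2, a3) (b2, b3)) (\<lambda>(y, z). k x y z))"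
    by (subst integral_prod_continuous) (auto simp: split_beta intro!: continuous_intros)
  also have "\<dots> = integral (cbox (a1, a2, a3) (b1, b2, b3)) (\<lambda>(x, y, z). k x y z)"
    using integral_prod_continuous[OF continuous_on_subset[OF k], of a1 "(a2, a3)" b1 "(b2, b3)"] by simp
  finally show ?thesis by (rule sym)
qed

lemma integral_cbox_vec3_iterated:
  fixes k :: "real \<Rightarrow> real \<Rightarrow> real \<Rightarrow> real"
  assumes k: "continuous_on UNIV (\<lambda>(x, y, z). k x y z)"
  shows "integral (cbox l u) (\<lambda>v::real^3. k (v$1) (v$2) (v$3))
    = integral (cbox (l$1, l$2) (u$1, u$2)) (\<lambda>(x, y). integral {l$3..u$3} (k x y))"
proof -
  have "continuous_on UNIV (\<lambda>v::real^3. k (v$1) (v$2) (v$3))"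
    by (intro continuous_on_compose_Triple[OF k] continuous_intros)
  from integral_cbox_vec3[OF this] show ?thesis
    using integral_cbox_triple[OF k] by simp
qed

text \<open>The parabola with zeros at both ends has integral \<open>L^3 / 6\<close>, which explains
  the normalisation. Its slope is extremal at the ends, with size \<open>6 * L / L^3\<close>, and
  this value serves as the constant.\<close>

lemma cutoff_weight_parabola:
  fixes \<alpha> L :: real
  assumes L: "0 < L" "L \<le> 1"
  shows "cutoff_weight \<alpha> (\<alpha> + L) (6 / L\<^sup>2) (\<lambda>z. 6 * (z - \<alpha>) * (\<alpha> + L - z) / L^3)
    (\<lambda>z. 6 * (2 * \<alpha> + L - 2 * z) / L^3)"
proof unfold_locales
  have L2: "L\<^sup>2 \<le> 1"
    using L by (simp add: power_le_one)
  show "1 \<le> 6 / L\<^sup>2"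
    using L L2 by (simp add: pos_le_divide_eq)
  show "((\<lambda>z. 6 * (z - \<alpha>) * (\<alpha> + L - z) / L^3) has_real_derivative 6 * (2 * \<alpha> + L - 2 * z) / L^3) (at z)" for z
    by (rule derivative_eq_intros refl)+ (use L in \<open>auto simp: field_simps\<close>)
  show "continuous_on S (\<lambda>z. 6 * (2 * \<alpha> + L - 2 * z) / L^3)" for S
    using L by (intro continuous_intros) auto
  fix z assume z: "z \<in> {\<alpha>..\<alpha> + L}"
  show "0 \<le> 6 * (z - \<alpha>) * (\<alpha> + L - z) / L^3"
    using z L by auto
  have "(z - \<alpha>) * (\<alpha> + L - z) \<le> L * 1"
    using z L by (intro mult_mono) auto
  then have "6 * (z - \<alpha>) * (\<alpha> + L - z) \<le> 6 * L"
    unfolding mult.assoc by linarith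
  then have "6 * (z - \<alpha>) * (\<alpha> + L - z) / L^3 \<le> 6 * L / L^3"
    using L by (intro divide_right_mono) auto
  then show "6 * (z - \<alpha>) * (\<alpha> + L - z) / L^3 \<le> 6 / L\<^sup>2"
    using L by (simp add: power3_eq_cube power2_eq_square)
  have "\<bar>6 * (2 * \<alpha> + L - 2 * z)\<bar> / L^3 \<le> 6 * L / L^3"
    using z L by (intro divide_right_mono) (auto simp: abs_le_iff)
  then show "\<bar>6 * (2 * \<alpha> + L - 2 * z) / L^3\<bar> \<le> 6 / L\<^sup>2"
    using L by (simp add: power3_eq_cube power2_eq_square)
next
  show "integral {\<alpha>..\<alpha> + L} (\<lambda>z. 6 * (z - \<alpha>) * (\<alpha> + L - z) / L^3) = 1"
  proof (rule integral_unique)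
    define P where "P z = (3 * L * (z - \<alpha>)\<^sup>2 - 2 * (z - \<alpha>)^3) / L^3" for z
    have "((\<lambda>z. 6 * (z - \<alpha>) * (\<alpha> + L - z) / L^3) has_integral P (\<alpha> + L) - P \<alpha>) {\<alpha>..\<alpha> + L}"
    proof (rule fundamental_theorem_of_calculus)
      fix z
      have "(P has_real_derivative 6 * (z - \<alpha>) * (\<alpha> + L - z) / L^3) (at z)"
        unfolding P_def
        by (rule derivative_eq_intros refl)+ (use L in \<open>auto simp: field_simps power2_eq_square\<close>)
      then show "(P has_vector_derivative 6 * (z - \<alpha>) * (\<alpha> + L - z) / L^3) (at z within {\<alpha>..\<alpha> + L})"
        by (simp add: has_field_derivative_at_within flip: has_real_derivative_iff_has_vector_derivative)
    qed (use L in simp)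
    then show "((\<lambda>z. 6 * (z - \<alpha>) * (\<alpha> + L - z) / L^3) has_integral 1) {\<alpha>..\<alpha> + L}"
      using L by (simp add: P_def power2_eq_square power3_eq_cube)
  qed
qed (use L in auto)

lemma weighted_integral_ge:
  fixes \<eta> k :: "real \<Rightarrow> real"
  assumes "continuous_on {\<alpha>..\<beta>} \<eta>" "continuous_on {\<alpha>..\<beta>} k" "{a..b} \<subseteq> {\<alpha>..\<beta>}"
    and "\<And>z. z \<in> {\<alpha>..\<beta>} \<Longrightarrow> 0 \<le> \<eta> z" "\<And>z. z \<in> {\<alpha>..\<beta>} \<Longrightarrow> 0 \<le> k z" "\<And>z. z \<in> {a..b} \<Longrightarrow> 1 \<le> \<eta> z"
  shows "integral {a..b} k \<le> integral {\<alpha>..\<beta>} (\<lambda>z. \<eta> z * k z)"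
proof -
  have sub: "continuous_on {a..b} \<eta>" "continuous_on {a..b} k"
    using assms continuous_on_subset by blast+
  have "integral {a..b} k \<le> integral {a..b} (\<lambda>z. \<eta> z * k z)"
  proof (rule integral_le)
    show "k z \<le> \<eta> z * k z" if "z \<in> {a..b}" for z
      using mult_right_mono[of 1 "\<eta> z" "k z"] assms that by auto
  qed (auto intro!: integrable_continuous_real continuous_intros sub)
  also have "\<dots> \<le> integral {\<alpha>..\<beta>} (\<lambda>z. \<eta> z * k z)"
    using assms by (intro integral_subset_le) (auto intro!: integrable_continuous_real continuous_intros sub)
  finally show ?thesis .
qed

text \<open>The phases are measured on a cube of half width \<open>r\<close> and the error on one of
  half width \<open>2 * r\<close>. The margin leaves room for the horizontal shift by
  \<open>h\<close> and for the weight, which vanishes at the outer ends but must dominate 1 above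
  the inner cube.\<close>

lemma cell_separation:
  fixes p :: "real^3" and r h :: real and f f1 f3 g g1 g2 g3 g13 e :: "real \<Rightarrow> real \<Rightarrow> real \<Rightarrow> real"
  assumes r: "0 < r" "4 * r \<le> 1" and hr: "h \<le> r"
    and "cell_functions h f f1 f3 g g1 g2 g3 g13 e"
  defines "c \<equiv> 6 / (4 * r)\<^sup>2"
    and "\<Phi> \<equiv> \<lambda>v. transition (f1 (v$1) (v$2) (v$3))"
    and "E \<equiv> integral (cbox (p - vec (2 * r)) (p + vec (2 * r))) (\<lambda>v. (e (v$1) (v$2) (v$3))\<^sup>2)"
  shows "integral (cbox (p - vec r) (p + vec r)) \<Phi> * integral (cbox (p - vec r) (p + vec r)) (\<lambda>v. 1 - \<Phi> v)
    \<le> (1200 * c^3 + 1000 * c\<^sup>2) * (E / h + sqrt E)"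
proof -
  interpret cell_functions h f f1 f3 g g1 g2 g3 g13 e
    by fact
  define \<alpha> where "\<alpha> = p$3 - 2 * r"
  have \<alpha>_end: "\<alpha> + 4 * r = p$3 + 2 * r"
    by (simp add: \<alpha>_def)
  define \<eta> where "\<eta> z = 6 * (z - \<alpha>) * (\<alpha> + 4 * r - z) / (4 * r)^3" for z
  define \<eta>' where "\<eta>' z = 6 * (2 * \<alpha> + 4 * r - 2 * z) / (4 * r)^3" for z
  interpret cutoff_weight \<alpha> "\<alpha> + 4 * r" c \<eta> \<eta>'
    unfolding c_def \<eta>_def[abs_def] \<eta>'_def[abs_def] by (rule cutoff_weight_parabola) (use r in auto)
  interpret cell \<alpha> "\<alpha> + 4 * r" c \<eta> \<eta>' h f f1 f3 g g1 g2 g3 g13 e ..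
  let ?I = "integral (cbox (p$1 - r, p$2 - r) (p$1 + r, p$2 + r))"
  have cont\<Phi>: "continuous_on UNIV (\<lambda>(x, y, z). transition (f1 x y z))"
    "continuous_on UNIV (\<lambda>(x, y, z). 1 - transition (f1 x y z))"
    "continuous_on UNIV (\<lambda>(x, y, z). (e x y z)\<^sup>2)"
    unfolding split_beta by (intro continuous_intros cont3)+
  \<comment> \<open>The product of the distances to the two ends is \<open>4 * r\<^sup>2\<close> at
    the centre and loses at most \<open>r\<^sup>2\<close>. Times 6 this is at least
    \<open>18 * r\<^sup>2\<close>, while \<open>(4 * r)^3\<close> is at most
    \<open>16 * r\<^sup>2\<close> because \<open>4 * r\<close> is at most 1.\<close>
  have \<eta>_ge: "1 \<le> \<eta> z" if z: "z \<in> {p$3 - r..p$3 + r}" for z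
  proof -
    have "(z - p$3)\<^sup>2 \<le> r\<^sup>2"
      using z r by (intro abs_le_square_iff[THEN iffD1]) auto
    then have "3 * r\<^sup>2 \<le> (z - \<alpha>) * (\<alpha> + 4 * r - z)"
      by (simp add: \<alpha>_def power2_eq_square algebra_simps)
    moreover have "(4 * r)^3 \<le> 18 * r\<^sup>2"
      using r mult_right_mono[of "64 * r" 16 "r\<^sup>2"] by (simp add: power2_eq_square power3_eq_cube)
    ultimately have "(4 * r)^3 \<le> 6 * (z - \<alpha>) * (\<alpha> + 4 * r - z)"
      unfolding mult.assoc by linarith
    then show ?thesis
      using r by (simp add: \<eta>_def)
  qed
  have int: "continuous_on UNIV (\<lambda>(x, y). k x y) \<Longrightarrow> (\<lambda>(x, y). k x y) integrable_on cbox a b"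
    for k :: "real \<Rightarrow> real \<Rightarrow> real" and a b
    by (rule integrable_continuous, rule continuous_on_subset) auto
  have iter: "continuous_on UNIV (\<lambda>(x, y). integral {a..b} (k x y))"
    if k: "continuous_on UNIV (\<lambda>(x, y, z). k x y z)" for k :: "real \<Rightarrow> real \<Rightarrow> real \<Rightarrow> real" and a b
    unfolding split_beta
    by (rule continuous_on_integral_param)
      (auto simp: split_beta intro!: continuous_intros continuous_on_compose_Triple[OF k])
  have lower: "integral (cbox (p - vec r) (p + vec r)) (\<lambda>v. k (v$1) (v$2) (v$3))
      \<le> ?I (\<lambda>(x, y). J (\<lambda>z. \<eta> z * k x y z))"
    if k: "continuous_on UNIV (\<lambda>(x, y, z). k x y z)" and nonneg: "\<And>x y z. 0 \<le> k x y z"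
    for k :: "real \<Rightarrow> real \<Rightarrow> real \<Rightarrow> real"
  proof -
    have "?I (\<lambda>(x, y). integral {p$3 - r..p$3 + r} (k x y)) \<le> ?I (\<lambda>(x, y). J (\<lambda>z. \<eta> z * k x y z))"
    proof (rule integral_le)
      show "(\<lambda>(x, y). integral {p$3 - r..p$3 + r} (k x y)) integrable_on cbox (p$1 - r, p$2 - r) (p$1 + r, p$2 + r)"
        by (rule int[OF iter[OF k]])
      show "(\<lambda>(x, y). J (\<lambda>z. \<eta> z * k x y z)) integrable_on cbox (p$1 - r, p$2 - r) (p$1 + r, p$2 + r)"
        by (intro int cont_J_param)
          (auto simp: split_beta intro!: continuous_intros cont_weights continuous_on_compose_Triple[OF k])
      have "integral {p$3 - r..p$3 + r} (k x y) \<le> J (\<lambda>z. \<eta> z * k x y z)" for x y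
        using r \<eta>_bounds \<eta>_ge nonneg
        by (intro weighted_integral_ge) (auto simp: \<alpha>_def intro!: cont_\<eta> continuous_intros continuous_on_compose_Triple[OF k])
      then show "(case q of (x, y) \<Rightarrow> integral {p$3 - r..p$3 + r} (k x y))
          \<le> (case q of (x, y) \<Rightarrow> J (\<lambda>z. \<eta> z * k x y z))" for q
        by (cases q) simp
    qed
    then show ?thesis
      by (subst integral_cbox_vec3_iterated[OF k]) simp
  qed
  have N1: "integral (cbox (p - vec r) (p + vec r)) \<Phi> \<le> ?I (\<lambda>(x, y). \<theta> x y)"
    unfolding \<Phi>_def \<theta>_def by (rule lower[OF cont\<Phi>(1) transition_bounds(1)])
  have one_minus: "J (\<lambda>z. \<eta> z * (1 - transition (f1 x y z))) = 1 - \<theta> x y" for x y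
  proof -
    have "J (\<lambda>z. \<eta> z - \<eta> z * transition (f1 x y z)) = J \<eta> - \<theta> x y"
      unfolding \<theta>_def
      by (intro integral_diff integrable_continuous_real continuous_intros cont_\<eta> cont3)
    then show ?thesis
      by (simp add: \<eta>_integral right_diff_distrib)
  qed
  have N0: "integral (cbox (p - vec r) (p + vec r)) (\<lambda>v. 1 - \<Phi> v) \<le> ?I (\<lambda>(x, y). 1 - \<theta> x y)"
    using lower[OF cont\<Phi>(2)] transition_bounds(2) unfolding \<Phi>_def one_minus by simp
  define E0 where "E0 = integral (cbox (p$1 - r, p$2 - r) (p$1 + r + h, p$2 + r)) (\<lambda>(x, y). d2 x y)"
  have "E0 \<le> integral (cbox (p$1 - 2 * r, p$2 - 2 * r) (p$1 + 2 * r, p$2 + 2 * r)) (\<lambda>(x, y). d2 x y)"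
    unfolding E0_def using r hr d2_nonneg
    by (intro integral_subset_le int cont_pairs) (auto simp: cbox_Pair_eq)
  also have "\<dots> = E"
    unfolding E_def d2_def by (subst integral_cbox_vec3_iterated[OF cont\<Phi>(3)]) (simp add: \<alpha>_end, simp add: \<alpha>_def)
  finally have E0: "E0 \<le> E" .
  have \<Phi>: "0 \<le> \<Phi> v" "0 \<le> 1 - \<Phi> v" "continuous_on S \<Phi>" for v S
    unfolding \<Phi>_def using transition_bounds
    by (auto intro!: continuous_intros cont3)
  have "integral (cbox (p - vec r) (p + vec r)) \<Phi> * integral (cbox (p - vec r) (p + vec r)) (\<lambda>v. 1 - \<Phi> v)
    \<le> ?I (\<lambda>(x, y). \<theta> x y) * ?I (\<lambda>(x, y). 1 - \<theta> x y)"
  proof (intro mult_mono N1 N0)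
    show "0 \<le> ?I (\<lambda>(x, y). \<theta> x y)"
      by (rule integral_nonneg[OF int[OF cont_pairs(5)]]) (auto simp: \<theta>_range)
    show "0 \<le> integral (cbox (p - vec r) (p + vec r)) (\<lambda>v. 1 - \<Phi> v)"
      using \<Phi>(2) by (intro integral_nonneg integrable_continuous continuous_intros \<Phi>(3)) auto
  qed
  also have "\<dots> \<le> 1200 * c^3 * (E0 / h) + 1000 * c\<^sup>2 * sqrt E0"
    unfolding E0_def using r by (intro separation) auto
  also have "\<dots> \<le> 1200 * c^3 * (E / h) + 1000 * c\<^sup>2 * sqrt E"
    using E0 c h by (intro add_mono mult_left_mono divide_right_mono) auto
  also have "\<dots> \<le> (1200 * c^3 + 1000 * c\<^sup>2) * (E / h + sqrt E)"
  proof -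
    have "0 \<le> E0"
      unfolding E0_def using d2_nonneg by (intro integral_nonneg int cont_pairs) auto
    then have "0 \<le> c^3 * sqrt E" "0 \<le> c\<^sup>2 * (E / h)"
      using E0 c h by (auto intro!: mult_nonneg_nonneg)
    moreover have "(1200 * c^3 + 1000 * c\<^sup>2) * (s + t)
        = 1200 * c^3 * s + 1000 * c\<^sup>2 * t + (1200 * (c^3 * t) + 1000 * (c\<^sup>2 * s))" for s t
      by algebra
    ultimately show ?thesis
      by simp
  qed
  finally show ?thesis .
qed

section \<open>Mollification\<close>

lemma smooth_deriv_support:
  fixes k :: "real \<Rightarrow> real"
  assumes "\<And>t. \<bar>t\<bar> > R \<Longrightarrow> k t = 0" and "\<bar>t\<bar> > R"
  shows "deriv k t = 0"
proof -
  have "open {t::real. R < \<bar>t\<bar>}"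
    by (intro open_Collect_less continuous_intros)
  then have "(k has_real_derivative 0) (at t)"
    by (rule has_field_derivative_transform_within_open[OF DERIV_const[of 0]]) (use assms in auto)
  then show ?thesis
    by (rule DERIV_imp_deriv)
qed

text \<open>Sign and mass are left to \<open>mollifier\<close>, so that this class is stable under
  partial differentiation. The support is a cube and not a ball, as befits products.\<close>

definition smooth_kernel :: "real \<Rightarrow> ('n::finite \<Rightarrow> real \<Rightarrow> real) \<Rightarrow> bool" where
  "smooth_kernel R k \<longleftrightarrow> (\<forall>i. smooth (k i)) \<and> (\<forall>i t. \<bar>t\<bar> > R \<longrightarrow> k i t = 0)"

lemma kernel_smooth: "smooth_kernel R k \<Longrightarrow> smooth (k i)"
  by (simp add: smooth_kernel_def)

lemma kernel_deriv: "smooth_kernel R k \<Longrightarrow> smooth_kernel R (k(j := deriv (k j)))"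
  unfolding smooth_kernel_def by (auto intro: smooth_deriv smooth_deriv_support)

lemma tensor_eq_0: "smooth_kernel R k \<Longrightarrow> \<bar>x $ i\<bar> > R \<Longrightarrow> tensor k x = 0"
  unfolding tensor_def smooth_kernel_def by (intro prod_zero) auto

lemma kernel_bounded:
  assumes "smooth_kernel R k"
  obtains C where "C \<ge> 0" "\<And>x. \<bar>tensor k x\<bar> \<le> C"
proof -
  have "\<exists>c\<ge>0. \<forall>t. \<bar>k i t\<bar> \<le> c" for i
  proof -
    have "bounded (k i ` {-R..R})"
      using assms by (intro compact_imp_bounded compact_continuous_image smooth_continuous) (auto simp: smooth_kernel_def)
    then obtain c where c: "\<And>t. t \<in> {-R..R} \<Longrightarrow> \<bar>k i t\<bar> \<le> c"
      unfolding bounded_iff by (metis imageI real_norm_def)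
    have "\<bar>k i t\<bar> \<le> max c 0" for t
      using c[of t] assms by (cases "t \<in> {-R..R}") (auto simp: smooth_kernel_def abs_le_iff)
    then show ?thesis
      by (intro exI[of _ "max c 0"]) auto
  qed
  then obtain c where c: "\<And>i. c i \<ge> 0" "\<And>i t. \<bar>k i t\<bar> \<le> c i"
    by metis
  show ?thesis
  proof
    show "0 \<le> (\<Prod>i\<in>UNIV. c i)"
      using c by (intro prod_nonneg) auto
    show "\<bar>tensor k x\<bar> \<le> (\<Prod>i\<in>UNIV. c i)" for x
      unfolding tensor_def abs_prod using c by (intro prod_mono) auto
  qed
qed

lemma tensor_line_DERIV:
  assumes "\<And>i. smooth (k i)"
  shows "((\<lambda>s. tensor k (v + s *\<^sub>R axis j 1)) has_real_derivative
    tensor (k(j := deriv (k j))) (v + s *\<^sub>R axis j 1)) (at s)"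
proof -
  have eq: "tensor (k(j := l)) (v + s *\<^sub>R axis j 1) = l (v $ j + s) * (\<Prod>i\<in>UNIV - {j}. k i (v $ i))" for l s
    unfolding tensor_upd by (intro arg_cong2[where f = "(*)"] prod.cong) (auto simp: axis_def)
  have "((\<lambda>s. k j (v $ j + s)) has_real_derivative deriv (k j) (v $ j + s)) (at s)"
    using DERIV_shift[of "k j" "deriv (k j) (v $ j + s)" s "v $ j"] smooth_DERIV[OF assms]
    by (simp add: add.commute)
  then show ?thesis
    unfolding eq using eq[of "k j"] by (simp add: DERIV_cmult_right)
qed

lemma tensor_borel_measurable [measurable]:
  "(\<And>i. smooth (k i)) \<Longrightarrow> tensor k \<in> borel_measurable borel"
  by (intro borel_measurable_continuous_onI continuous_on_tensor)

definition convolve :: "('n::finite \<Rightarrow> real \<Rightarrow> real) \<Rightarrow> (real^'n \<Rightarrow> real) \<Rightarrow> real^'n \<Rightarrow> real" where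
  "convolve k f x = (LINT w|lborel. tensor k (x - w) * f w)"

lemma tensor_shift_measurable:
  assumes "smooth_kernel R k"
  shows "(\<lambda>w. tensor k (x - w)) \<in> borel_measurable borel"
proof (rule measurable_compose[OF _ tensor_borel_measurable])
  show "(\<lambda>w. x - w) \<in> borel_measurable borel"
    by (intro borel_measurable_continuous_onI continuous_intros)
qed (rule kernel_smooth[OF assms])

lemma integrable_kernel_mult:
  assumes "smooth_kernel R k" "integrable lborel f"
  shows "integrable lborel (\<lambda>w. tensor k (x - w) * f w)"
proof -
  obtain C where C: "C \<ge> 0" "\<And>x. \<bar>tensor k x\<bar> \<le> C"
    using kernel_bounded[OF assms(1)] by blast
  have "integrable lborel (\<lambda>w. C * f w)"
    using assms(2) by simp
  then show ?thesis
  proof (rule Bochner_Integration.integrable_bound)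
    show "(\<lambda>w. tensor k (x - w) * f w) \<in> borel_measurable lborel"
      using tensor_shift_measurable[OF assms(1)] assms(2) by (intro borel_measurable_times) auto
  qed (use C in \<open>auto simp: abs_mult intro!: mult_right_mono\<close>)
qed

lemma continuous_on_convolve:
  fixes f :: "real^'n::finite \<Rightarrow> real"
  assumes "smooth_kernel R k" "integrable lborel f"
  shows "continuous_on S (convolve k f)"
proof (rule continuous_at_imp_continuous_on, rule ballI, rule continuous_at_sequentiallyI)
  fix x :: "real^'n" and u :: "nat \<Rightarrow> real^'n" assume u: "u \<longlonglongrightarrow> x"
  obtain C where C: "C \<ge> 0" "\<And>x. \<bar>tensor k x\<bar> \<le> C"
    using kernel_bounded[OF assms(1)] by blast
  show "(\<lambda>n. convolve k f (u n)) \<longlonglongrightarrow> convolve k f x"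
    unfolding convolve_def
  proof (rule integral_dominated_convergence[where w = "\<lambda>w. C * \<bar>f w\<bar>"])
    show "AE w in lborel. (\<lambda>n. tensor k (u n - w) * f w) \<longlonglongrightarrow> tensor k (x - w) * f w"
    proof (rule AE_I2)
      fix w
      have "isCont (tensor k) (x - w)"
        using continuous_on_tensor[of k UNIV] kernel_smooth[OF assms(1)]
        by (auto simp: continuous_on_eq_continuous_at)
      then show "(\<lambda>n. tensor k (u n - w) * f w) \<longlonglongrightarrow> tensor k (x - w) * f w"
        by (intro tendsto_mult_right isCont_tendsto_compose[of _ "tensor k"] tendsto_diff u tendsto_const)
    qed
    show "AE w in lborel. norm (tensor k (u n - w) * f w) \<le> C * \<bar>f w\<bar>" for n
      using C by (auto simp: abs_mult intro!: mult_right_mono)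
    show "(\<lambda>w. tensor k (u n - w) * f w) \<in> borel_measurable lborel" for n
      using integrable_kernel_mult[OF assms] by auto
    show "(\<lambda>w. tensor k (x - w) * f w) \<in> borel_measurable lborel"
      using integrable_kernel_mult[OF assms] by auto
  qed (use assms in auto)
qed

text \<open>By the mean value theorem the difference quotients of the kernel are bounded by the
  supremum C of its derivative, so \<open>C * \<bar>f w\<bar>\<close> dominates and the limit passes
  under the integral.\<close>

lemma convolve_DERIV:
  fixes f :: "real^'n::finite \<Rightarrow> real"
  assumes "smooth_kernel R k" "integrable lborel f"
  shows "((\<lambda>s. convolve k f (x + s *\<^sub>R axis j 1)) has_real_derivative
    convolve (k(j := deriv (k j))) f (x + t *\<^sub>R axis j 1)) (at t)"
proof -
  let ?e = "axis j 1 :: real^'n"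
  let ?k' = "k(j := deriv (k j))"
  have k': "smooth_kernel R ?k'"
    by (rule kernel_deriv[OF assms(1)])
  obtain C where C: "C \<ge> 0" "\<And>x. \<bar>tensor ?k' x\<bar> \<le> C"
    using kernel_bounded[OF k'] by blast
  have D: "((\<lambda>s. tensor k (x + s *\<^sub>R ?e - w)) has_real_derivative tensor ?k' (x + s *\<^sub>R ?e - w)) (at s)" for s w
    using tensor_line_DERIV[OF kernel_smooth[OF assms(1)], where v = "x - w" and j = j and s = s] by (simp add: algebra_simps)
  have quot: "(convolve k f (x + y *\<^sub>R ?e) - convolve k f (x + t *\<^sub>R ?e)) / (y - t)
      = (LINT w|lborel. (tensor k (x + y *\<^sub>R ?e - w) - tensor k (x + t *\<^sub>R ?e - w)) / (y - t) * f w)" for y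
  proof -
    have "convolve k f (x + y *\<^sub>R ?e) - convolve k f (x + t *\<^sub>R ?e)
      = (LINT w|lborel. tensor k (x + y *\<^sub>R ?e - w) * f w - tensor k (x + t *\<^sub>R ?e - w) * f w)"
      unfolding convolve_def by (intro Bochner_Integration.integral_diff[symmetric] integrable_kernel_mult[OF assms])
    then show ?thesis
      by (simp flip: integral_divide_zero add: left_diff_distrib diff_divide_distrib)
  qed
  show ?thesis
    unfolding has_field_derivative_iff quot tendsto_at_iff_sequentially o_def
  proof (intro allI impI)
    fix u :: "nat \<Rightarrow> real" assume u: "\<forall>i. u i \<in> UNIV - {t}" "u \<longlonglongrightarrow> t"
    show "(\<lambda>n. LINT w|lborel. (tensor k (x + u n *\<^sub>R ?e - w) - tensor k (x + t *\<^sub>R ?e - w)) / (u n - t) * f w)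
        \<longlonglongrightarrow> convolve ?k' f (x + t *\<^sub>R ?e)"
      unfolding convolve_def
    proof (rule integral_dominated_convergence[where w = "\<lambda>w. C * \<bar>f w\<bar>"])
      show "AE w in lborel. (\<lambda>n. (tensor k (x + u n *\<^sub>R ?e - w) - tensor k (x + t *\<^sub>R ?e - w)) / (u n - t) * f w)
          \<longlonglongrightarrow> tensor ?k' (x + t *\<^sub>R ?e - w) * f w"
        using D[of _ t] u unfolding has_field_derivative_iff tendsto_at_iff_sequentially o_def
        by (intro AE_I2 tendsto_mult_right) blast
      show "AE w in lborel. norm ((tensor k (x + u n *\<^sub>R ?e - w) - tensor k (x + t *\<^sub>R ?e - w)) / (u n - t) * f w)
          \<le> C * \<bar>f w\<bar>" for n
      proof (rule AE_I2)
        fix w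
        have "\<bar>tensor k (x + u n *\<^sub>R ?e - w) - tensor k (x + t *\<^sub>R ?e - w)\<bar> \<le> C * \<bar>u n - t\<bar>"
          using field_differentiable_bound[of UNIV "\<lambda>s. tensor k (x + s *\<^sub>R ?e - w)"
              "\<lambda>s. tensor ?k' (x + s *\<^sub>R ?e - w)" C "u n" t] D C by auto
        then have "\<bar>(tensor k (x + u n *\<^sub>R ?e - w) - tensor k (x + t *\<^sub>R ?e - w)) / (u n - t)\<bar> \<le> C"
          using u(1) by (auto simp: divide_le_eq)
        then show "norm ((tensor k (x + u n *\<^sub>R ?e - w) - tensor k (x + t *\<^sub>R ?e - w)) / (u n - t) * f w)
          \<le> C * \<bar>f w\<bar>"
          unfolding real_norm_def abs_mult by (intro mult_right_mono) auto
      qed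
      show "(\<lambda>w. (tensor k (x + u n *\<^sub>R ?e - w) - tensor k (x + t *\<^sub>R ?e - w)) / (u n - t) * f w)
          \<in> borel_measurable lborel" for n
        using tensor_shift_measurable[OF assms(1)] assms(2)
        by (intro borel_measurable_times borel_measurable_divide borel_measurable_diff borel_measurable_const) auto
      show "(\<lambda>w. tensor ?k' (x + t *\<^sub>R ?e - w) * f w) \<in> borel_measurable lborel"
        using integrable_kernel_mult[OF k' assms(2)] by auto
    qed (use assms in auto)
  qed
qed

section \<open>Mollifiers and their contraction property in L2\<close>

definition mollifier :: "real \<Rightarrow> ('n::finite \<Rightarrow> real \<Rightarrow> real) \<Rightarrow> bool" where
  "mollifier R k \<longleftrightarrow> smooth_kernel R k \<and> (\<forall>x. 0 \<le> tensor k x) \<and> (LINT x|lborel. tensor k x) = 1"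

lemma kernel_integrable:
  fixes k :: "'n::finite \<Rightarrow> real \<Rightarrow> real"
  assumes "smooth_kernel R k"
  shows "integrable lborel (tensor k)"
proof -
  let ?B = "cbox (vec (-R)) (vec R) :: (real^'n) set"
  have "integrable lborel (\<lambda>x. indicator ?B x *\<^sub>R tensor k x)"
    using assms by (intro borel_integrable_compact continuous_on_tensor kernel_smooth) auto
  moreover have "(\<lambda>x. indicator ?B x *\<^sub>R tensor k x) = tensor k"
  proof
    fix x
    show "indicator ?B x *\<^sub>R tensor k x = tensor k x"
    proof (cases "x \<in> ?B")
      case False
      then obtain i where "\<not> (- R \<le> x $ i \<and> x $ i \<le> R)"
        by (auto simp: mem_box_cart)
      then have "\<bar>x $ i\<bar> > R"
        by linarith
      then show ?thesis
        using tensor_eq_0[OF assms] by simp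
    qed simp
  qed
  ultimately show ?thesis by simp
qed

lemma mollifier_exists:
  assumes "0 < R"
  obtains k :: "'n::finite \<Rightarrow> real \<Rightarrow> real" where "mollifier R k"
proof -
  define b where "b = (\<lambda>(i::'n) t. bump (t / R))"
  have b: "smooth_kernel R b"
    unfolding smooth_kernel_def b_def
    using smooth_affine[OF smooth_bump, of 0 "1 / R"] assms by (auto simp: bump_eq_0)
  have nonneg: "0 \<le> tensor b x" for x
    unfolding tensor_def b_def by (intro prod_nonneg) (auto simp: bump_nonneg)
  define C where "C = (LINT x|lborel. tensor b x)"
  \<comment> \<open>Otherwise the continuous product would vanish almost everywhere, yet it is
    positive on an open cube of positive measure.\<close>
  have "C \<noteq> 0"
  proof
    assume "C = 0"
    then have "AE x in lborel. tensor b x = 0"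
      unfolding C_def using integral_nonneg_eq_0_iff_AE[OF kernel_integrable[OF b]] nonneg by auto
    then have "AE x::real^'n in lborel. x \<notin> box (vec (-R)) (vec R)"
    proof eventually_elim
      case (elim x)
      then obtain i where "bump (x $ i / R) = 0"
        by (auto simp: tensor_def b_def)
      then have "\<not> \<bar>x $ i / R\<bar> < 1"
        using bump_pos[of "x $ i / R"] by auto
      then have "R \<le> \<bar>x $ i\<bar>"
        using assms by simp
      moreover have "- R < x $ i \<and> x $ i < R" if "x \<in> box (vec (-R)) (vec R)"
        using that by (simp add: mem_box_cart)
      ultimately show "x \<notin> box (vec (-R)) (vec R)"
        by fastforce
    qed
    then have "emeasure lborel (box (vec (-R)) (vec R) :: (real^'n) set) = 0"
      by (subst (asm) AE_iff_measurable[OF _ refl]) auto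
    moreover have pos: "0 < (vec R - vec (-R)) \<bullet> v" if "v \<in> Basis" for v :: "real^'n"
      using assms that by (auto simp: Basis_vec_def inner_axis)
    moreover have "0 < (\<Prod>v\<in>Basis. ((vec R - vec (-R)) :: real^'n) \<bullet> v)"
      using pos by (intro prod_pos) auto
    moreover have "vec (-R) \<bullet> v \<le> vec R \<bullet> v" if "v \<in> Basis" for v :: "real^'n"
      using pos[OF that] by (simp add: inner_diff_left)
    ultimately show False
      by (fastforce simp: emeasure_lborel_box)
  qed
  moreover have "0 \<le> C"
    unfolding C_def using nonneg by (intro Bochner_Integration.integral_nonneg) auto
  ultimately have "C > 0" by simp
  define n where "n = CARD('n)"
  \<comment> \<open>The mass has to be divided out of a product of n factors, so each of them
    receives an n-th root of it.\<close>
  define k where "k = (\<lambda>(i::'n) t. 1 / root n C * b i t)"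
  have eq: "tensor k = (\<lambda>x. tensor b x / C)"
    using \<open>C > 0\<close> real_root_pow_pos2[of n C]
    by (simp add: fun_eq_iff tensor_def k_def prod.distrib prod_dividef n_def)
  have "smooth_kernel R k"
    using b unfolding smooth_kernel_def k_def by (auto intro!: smooth_mult smooth_const simp del: times_divide_eq_left)
  then have "mollifier R k"
    unfolding mollifier_def eq using nonneg \<open>C > 0\<close> by (auto simp: C_def[symmetric])
  then show ?thesis
    by (rule that)
qed

lemma lborel_reflect: "distr lborel borel (\<lambda>w. x - w) = (lborel :: 'a::euclidean_space measure)"
  using lborel_affine[of "-1" x] by (simp add: density_1)

lemma lborel_translate: "distr lborel borel (\<lambda>x. x - w) = (lborel :: 'a::euclidean_space measure)"
  using lborel_affine[of 1 "- w"] by (simp add: density_1)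

lemma mollifier_integrals:
  assumes "mollifier R k"
  shows "integrable lborel (\<lambda>w. tensor k (x - w))" "(LINT w|lborel. tensor k (x - w)) = 1"
    "(\<integral>\<^sup>+x. ennreal (tensor k (x - w)) \<partial>lborel) = 1"
proof -
  have k: "integrable lborel (tensor k)" "(LINT x|lborel. tensor k x) = 1" "tensor k \<in> borel_measurable borel" "\<And>x. 0 \<le> tensor k x"
    using assms kernel_integrable[of R k] tensor_borel_measurable[of k] kernel_smooth
    by (auto simp: mollifier_def)
  have m: "(\<lambda>w. x - w) \<in> lborel \<rightarrow>\<^sub>M borel" "(\<lambda>x. x - w) \<in> lborel \<rightarrow>\<^sub>M borel"
    by (auto intro!: borel_measurable_continuous_onI continuous_intros)
  show "integrable lborel (\<lambda>w. tensor k (x - w))"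
    using k by (subst integrable_distr_eq[OF m(1) k(3), symmetric]) (simp add: lborel_reflect)
  show "(LINT w|lborel. tensor k (x - w)) = 1"
    using k by (subst integral_distr[OF m(1) k(3), symmetric]) (simp add: lborel_reflect)
  have "(\<integral>\<^sup>+x. ennreal (tensor k (x - w)) \<partial>lborel) = (\<integral>\<^sup>+x. ennreal (tensor k x) \<partial>lborel)"
    using k(3) by (subst nn_integral_distr[OF m(2), symmetric]) (simp_all add: lborel_translate)
  also have "\<dots> = 1"
    using k by (simp add: nn_integral_eq_integral)
  finally show "(\<integral>\<^sup>+x. ennreal (tensor k (x - w)) \<partial>lborel) = 1" .
qed

text \<open>Jensen's inequality for the probability density \<open>tensor k (x - w)\<close>,
  obtained by expanding the nonnegative variance of \<open>f\<close> under it.\<close>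

lemma convolve_square_le:
  assumes "mollifier R k" and f: "integrable lborel f" "integrable lborel (\<lambda>w. (f w)\<^sup>2)"
  shows "ennreal ((convolve k f x)\<^sup>2) \<le> (\<integral>\<^sup>+w. ennreal (tensor k (x - w)) * ennreal ((f w)\<^sup>2) \<partial>lborel)"
proof -
  have k: "smooth_kernel R k" "\<And>x. 0 \<le> tensor k x"
    using assms(1) by (auto simp: mollifier_def)
  note int = integrable_kernel_mult[OF k(1) f(1), of x] integrable_kernel_mult[OF k(1) f(2), of x]
    mollifier_integrals(1)[OF assms(1), of x]
  define c where "c = convolve k f x"
  have "0 \<le> (LINT w|lborel. tensor k (x - w) * (f w - c)\<^sup>2)"
    using k by (intro Bochner_Integration.integral_nonneg) auto
  also have "\<dots> = (LINT w|lborel. tensor k (x - w) * (f w)\<^sup>2 - (2 * c) * (tensor k (x - w) * f w) + c\<^sup>2 * tensor k (x - w))"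
    by (intro Bochner_Integration.integral_cong) (auto simp: power2_eq_square algebra_simps)
  also have "\<dots> = (LINT w|lborel. tensor k (x - w) * (f w)\<^sup>2) - (2 * c) * c + c\<^sup>2 * 1"
    using int mollifier_integrals(2)[OF assms(1), of x] by (simp add: c_def convolve_def)
  finally have "c\<^sup>2 \<le> (LINT w|lborel. tensor k (x - w) * (f w)\<^sup>2)"
    by (simp add: power2_eq_square)
  then have "ennreal (c\<^sup>2) \<le> ennreal (LINT w|lborel. tensor k (x - w) * (f w)\<^sup>2)"
    by (rule ennreal_leI)
  also have "\<dots> = (\<integral>\<^sup>+w. ennreal (tensor k (x - w) * (f w)\<^sup>2) \<partial>lborel)"
    using int k by (intro nn_integral_eq_integral[symmetric]) auto
  finally show ?thesis
    using k by (simp add: c_def ennreal_mult)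
qed

lemma convolve_L2_le:
  fixes f :: "real^'n::finite \<Rightarrow> real"
  assumes "mollifier R k" and f: "integrable lborel f" "integrable lborel (\<lambda>w. (f w)\<^sup>2)"
  shows "(\<integral>\<^sup>+x. ennreal ((convolve k f x)\<^sup>2) \<partial>lborel) \<le> (\<integral>\<^sup>+x. ennreal ((f x)\<^sup>2) \<partial>lborel)"
proof -
  have k: "smooth_kernel R k"
    using assms(1) by (auto simp: mollifier_def)
  have [measurable]: "tensor k \<in> borel_measurable borel" "f \<in> borel_measurable borel"
    using tensor_borel_measurable[of k] kernel_smooth[OF k] f(1) by auto
  have "(\<integral>\<^sup>+x. ennreal ((convolve k f x)\<^sup>2) \<partial>lborel)
      \<le> (\<integral>\<^sup>+x. (\<integral>\<^sup>+w. ennreal (tensor k (x - w)) * ennreal ((f w)\<^sup>2) \<partial>lborel) \<partial>lborel)"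
    by (intro nn_integral_mono convolve_square_le[OF assms])
  also have "\<dots> = (\<integral>\<^sup>+w. (\<integral>\<^sup>+x. ennreal (tensor k (x - w)) * ennreal ((f w)\<^sup>2) \<partial>lborel) \<partial>lborel)"
    by (rule lborel_pair.Fubini') measurable
  also have "\<dots> = (\<integral>\<^sup>+w. (\<integral>\<^sup>+x. ennreal (tensor k (x - w)) \<partial>lborel) * ennreal ((f w)\<^sup>2) \<partial>lborel)"
    by (intro nn_integral_cong nn_integral_multc) measurable
  also have "\<dots> = (\<integral>\<^sup>+w. ennreal ((f w)\<^sup>2) \<partial>lborel)"
    by (simp add: mollifier_integrals(3)[OF assms(1)])
  finally show ?thesis .
qed

section \<open>Continuous approximation in L2 and convergence of mollifications\<close>

definition clamp_real :: "real \<Rightarrow> real \<Rightarrow> real" where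
  "clamp_real M t = max (- M) (min M t)"

lemma continuous_on_clamp_real [continuous_intros]:
  "continuous_on S f \<Longrightarrow> continuous_on S (\<lambda>x. clamp_real M (f x))"
  unfolding clamp_real_def by (intro continuous_intros)

lemma clamp_real_measurable [measurable]:
  "f \<in> borel_measurable N \<Longrightarrow> (\<lambda>x. clamp_real M (f x)) \<in> borel_measurable N"
  unfolding clamp_real_def by (intro borel_measurable_max borel_measurable_min borel_measurable_const)

definition plateau :: "real^'n::finite \<Rightarrow> real^'n \<Rightarrow> real^'n \<Rightarrow> real" where
  "plateau a b x = (\<Prod>i\<in>UNIV. max 0 (min 1 (min (x$i - a$i + 1) (b$i + 1 - x$i))))"

lemma plateau_bounds: "0 \<le> plateau a b x" "plateau a b x \<le> 1"
  unfolding plateau_def by (auto intro!: prod_nonneg prod_le_1)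

lemma plateau_eq_1: "x \<in> cbox a b \<Longrightarrow> plateau a b x = 1"
  unfolding plateau_def by (intro prod.neutral) (auto simp: mem_box_cart min_def max_def)

lemma plateau_eq_0: "x \<notin> cbox (a - vec 1) (b + vec 1) \<Longrightarrow> plateau a b x = 0"
proof -
  assume "x \<notin> cbox (a - vec 1) (b + vec 1)"
  then obtain i where "x$i - a$i + 1 < 0 \<or> b$i + 1 - x$i < 0"
    by (auto simp: mem_box_cart algebra_simps not_le)
  then show ?thesis
  proof -
    have "max 0 (min 1 (min (x$i - a$i + 1) (b$i + 1 - x$i))) = 0"
      using \<open>x$i - a$i + 1 < 0 \<or> b$i + 1 - x$i < 0\<close> by auto
    then show ?thesis
      unfolding plateau_def by (intro prod_zero) (auto intro: bexI[of _ i])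
  qed
qed

lemma continuous_on_plateau [continuous_intros]: "continuous_on S (plateau a b)"
  unfolding plateau_def[abs_def] by (intro continuous_intros)

text \<open>Truncating \<open>F\<close> first makes bounded convergence available: clamping and a
  plateau cutoff give continuous approximants a common bound and a common bounded support. Each step
  costs at most a quarter of \<open>e\<close>, doubled by \<open>sq\<close>.\<close>

lemma L2_density:
  fixes F :: "real^'n::finite \<Rightarrow> real"
  assumes [measurable]: "F \<in> borel_measurable borel"
    and F2: "integrable lborel (\<lambda>x. (F x)\<^sup>2)" and F0: "\<And>x. x \<notin> cbox a b \<Longrightarrow> F x = 0" and e: "e > 0"
  obtains G where "continuous_on UNIV G" "\<And>x. x \<notin> cbox (a - vec 1) (b + vec 1) \<Longrightarrow> G x = 0"
    "(LINT x|lborel. (F x - G x)\<^sup>2) < e" "integrable lborel (\<lambda>x. (F x - G x)\<^sup>2)"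
proof -
  let ?B = "cbox (a - vec 1) (b + vec 1)"
  have cut: "\<bar>t - clamp_real M t\<bar> \<le> \<bar>t\<bar>" "\<bar>clamp_real M t\<bar> \<le> M" if "0 \<le> M" for M t
    using that by (auto simp: clamp_real_def)
  have "(\<lambda>n. LINT x|lborel. (F x - clamp_real (real n) (F x))\<^sup>2) \<longlonglongrightarrow> (LINT x|(lborel::(real^'n) measure). (0::real))"
  proof (rule integral_dominated_convergence[where w = "\<lambda>x. (F x)\<^sup>2"])
    show "AE x in lborel. (\<lambda>n. (F x - clamp_real (real n) (F x))\<^sup>2) \<longlonglongrightarrow> 0"
    proof (rule AE_I2, rule tendsto_eventually)
      fix x
      obtain N :: nat where N: "\<bar>F x\<bar> \<le> real N"
        using real_arch_simple by blast
      show "\<forall>\<^sub>F n in sequentially. (F x - clamp_real (real n) (F x))\<^sup>2 = 0"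
        using eventually_ge_at_top[of N]
      proof eventually_elim
        case (elim n)
        then have "\<bar>F x\<bar> \<le> real n"
          using N by linarith
        then show ?case
          by (auto simp: clamp_real_def)
      qed
    qed
    show "AE x in lborel. norm ((F x - clamp_real (real n) (F x))\<^sup>2) \<le> (F x)\<^sup>2" for n
      using cut(1)[of "real n"] by (auto simp: abs_le_square_iff[symmetric])
  qed (use F2 in auto)
  then have "\<forall>\<^sub>F n in sequentially. (LINT x|lborel. (F x - clamp_real (real n) (F x))\<^sup>2) < e / 4"
    by (rule order_tendstoD) (use e in auto)
  then obtain n where n: "(LINT x|lborel. (F x - clamp_real (real n) (F x))\<^sup>2) < e / 4"
    by (auto simp: eventually_sequentially)
  define M where "M = real n"
  define FM where "FM x = clamp_real M (F x)" for x
  have M: "0 \<le> M" and M1: "(LINT x|lborel. (F x - FM x)\<^sup>2) < e / 4"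
    using n by (simp_all add: M_def FM_def)
  have FM0: "x \<notin> cbox a b \<Longrightarrow> FM x = 0" for x
    using F0 M by (auto simp: FM_def clamp_real_def)
  have FMint: "integrable lborel (\<lambda>x. (F x - FM x)\<^sup>2)"
  proof (rule Bochner_Integration.integrable_bound[OF F2])
    show "AE x in lborel. norm ((F x - FM x)\<^sup>2) \<le> norm ((F x)\<^sup>2)"
      using cut(1)[OF M] unfolding FM_def by (auto simp: abs_le_square_iff[symmetric])
  qed (auto simp: FM_def)
  \<comment> \<open>Measurability in the sense of \<open>measurable_on\<close> means precisely that
    continuous functions converge to \<open>F\<close> outside a negligible set.\<close>
  have "F \<in> borel_measurable (lebesgue_on UNIV)"
    by (auto intro: borel_measurable_subalgebra[of lborel] measurable_completion)
  then have "F measurable_on UNIV"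
    by (simp add: measurable_on_iff_borel_measurable)
  then obtain N g where N: "negligible N" and g: "\<And>n. continuous_on UNIV (g n)"
    and lim: "\<And>x. x \<notin> N \<Longrightarrow> (\<lambda>n. g n x) \<longlonglongrightarrow> F x"
    unfolding measurable_on_def by auto
  define G where "G n x = plateau a b x * clamp_real M (g n x)" for n x
  have contG: "continuous_on UNIV (G n)" for n
    unfolding G_def[abs_def] by (intro continuous_intros g)
  have [measurable]: "G n \<in> borel_measurable borel" for n
    by (intro borel_measurable_continuous_onI contG)
  have [measurable]: "FM \<in> borel_measurable borel"
    unfolding FM_def by measurable
  have G0: "x \<notin> ?B \<Longrightarrow> G n x = 0" for n x
    by (simp add: G_def plateau_eq_0)
  have sub: "cbox a b \<subseteq> ?B"
    by (auto simp: mem_box_cart) (smt (verit))+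
  have bound: "(FM x - G n x)\<^sup>2 \<le> (2 * M)\<^sup>2 * indicat_real ?B x" for n x
  proof (cases "x \<in> ?B")
    case True
    have "\<bar>G n x\<bar> \<le> 1 * M"
      unfolding G_def abs_mult using plateau_bounds[of a b x] cut(2)[OF M] M by (intro mult_mono) auto
    moreover have "\<bar>FM x\<bar> \<le> M"
      unfolding FM_def by (rule cut(2)[OF M])
    ultimately have "\<bar>FM x - G n x\<bar> \<le> \<bar>2 * M\<bar>"
      by linarith
    then show ?thesis
      using True by (simp add: abs_le_square_iff)
  next
    case False
    then show ?thesis
      using G0 FM0 sub by auto
  qed
  have wint: "integrable lborel (\<lambda>x. (2 * M)\<^sup>2 * indicat_real ?B x)"
    by (intro integrable_mult_right integrable_real_indicator emeasure_compact_finite) auto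
  have "(\<lambda>n. LINT x|lborel. (FM x - G n x)\<^sup>2) \<longlonglongrightarrow> (LINT x|(lborel::(real^'n) measure). (0::real))"
  proof (rule integral_dominated_convergence[OF _ _ wint])
    have "AE x in lebesgue. x \<notin> N"
      using N by (simp add: negligible_iff_null_sets AE_not_in)
    then have "AE x in lborel. x \<notin> N"
      by (simp add: AE_completion_iff)
    then show "AE x in lborel. (\<lambda>n. (FM x - G n x)\<^sup>2) \<longlonglongrightarrow> 0"
    proof eventually_elim
      case (elim x)
      have "(\<lambda>n. (FM x - G n x)\<^sup>2) \<longlonglongrightarrow> (FM x - plateau a b x * clamp_real M (F x))\<^sup>2"
        unfolding G_def clamp_real_def by (intro tendsto_intros lim elim)
      moreover have "plateau a b x * clamp_real M (F x) = FM x"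
        using plateau_eq_1[of x a b] FM0[of x] by (cases "x \<in> cbox a b") (auto simp: FM_def)
      ultimately show ?case by simp
    qed
  qed (use bound in auto)
  then have "\<forall>\<^sub>F n in sequentially. (LINT x|lborel. (FM x - G n x)\<^sup>2) < e / 4"
    by (rule order_tendstoD) (use e in auto)
  then obtain m where m: "(LINT x|lborel. (FM x - G m x)\<^sup>2) < e / 4"
    by (auto simp: eventually_sequentially)
  have Gint: "integrable lborel (\<lambda>x. (FM x - G m x)\<^sup>2)"
    by (rule Bochner_Integration.integrable_bound[OF wint]) (use bound in auto)
  have sq: "(F x - G m x)\<^sup>2 \<le> 2 * (F x - FM x)\<^sup>2 + 2 * (FM x - G m x)\<^sup>2" for x
    using sum_squares_bound[of "F x - FM x" "FM x - G m x"]
    by (simp add: power2_eq_square algebra_simps)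
  have int: "integrable lborel (\<lambda>x. 2 * (F x - FM x)\<^sup>2 + 2 * (FM x - G m x)\<^sup>2)"
    using FMint Gint by simp
  have int': "integrable lborel (\<lambda>x. (F x - G m x)\<^sup>2)"
    by (rule Bochner_Integration.integrable_bound[OF int]) (use sq in auto)
  have "(LINT x|lborel. (F x - G m x)\<^sup>2) \<le> (LINT x|lborel. 2 * (F x - FM x)\<^sup>2 + 2 * (FM x - G m x)\<^sup>2)"
    by (intro integral_mono int int' sq)
  also have "\<dots> < e"
    using FMint Gint m M1 by simp
  finally show ?thesis
    using that[OF contG G0 _ int'] by blast
qed

lemma compact_support_uniformly_continuous:
  fixes G :: "real^'n::finite \<Rightarrow> real"
  assumes G: "continuous_on UNIV G" "\<And>x. x \<notin> cbox a b \<Longrightarrow> G x = 0" and e: "e > 0"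
  obtains \<delta> where "\<delta> > 0" "\<And>x y. dist x y < \<delta> \<Longrightarrow> \<bar>G x - G y\<bar> < e"
proof -
  have "uniformly_continuous_on (cbox (a - vec 1) (b + vec 1)) G"
    by (intro compact_uniformly_continuous continuous_on_subset[OF G(1)]) auto
  then obtain d where d: "d > 0" "\<And>x y. x \<in> cbox (a - vec 1) (b + vec 1) \<Longrightarrow> y \<in> cbox (a - vec 1) (b + vec 1)
      \<Longrightarrow> dist y x < d \<Longrightarrow> dist (G y) (G x) < e"
    using e unfolding uniformly_continuous_on_def by metis
  have near: "y \<in> cbox (a - vec 1) (b + vec 1)" if "x \<in> cbox a b" "dist x y < 1" for x y
  proof -
    have "\<bar>x$i - y$i\<bar> < 1" for i
      using component_le_norm_cart[of "x - y" i] that by (simp add: dist_norm)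
    then show ?thesis
      using that(1) unfolding mem_box_cart by (auto simp: abs_less_iff) (smt (verit))+
  qed
  have *: "\<bar>G x - G y\<bar> < e" if "dist x y < min d 1" "x \<in> cbox a b" for x y
    using d(2)[OF near[OF that(2), of y] near[OF that(2), of x]] that by (simp add: dist_commute dist_real_def)
  show ?thesis
  proof
    show "min d 1 > 0"
      using d by simp
    show "\<bar>G x - G y\<bar> < e" if "dist x y < min d 1" for x y
      using *[of x y] *[of y x] G(2)[of x] G(2)[of y] that e
      by (cases "x \<in> cbox a b"; cases "y \<in> cbox a b") (auto simp: dist_commute abs_minus_commute)
  qed
qed

lemma convolve_uniform:
  fixes G :: "real^'n::finite \<Rightarrow> real"
  assumes k: "mollifier R k" and G: "integrable lborel G"
    and close: "\<And>w. (\<And>i. \<bar>x$i - w$i\<bar> \<le> R) \<Longrightarrow> \<bar>G x - G w\<bar> \<le> e"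
  shows "\<bar>convolve k G x - G x\<bar> \<le> e"
proof -
  have k': "smooth_kernel R k" "\<And>x. 0 \<le> tensor k x"
    using k by (auto simp: mollifier_def)
  note int = integrable_kernel_mult[OF k'(1) G, of x] mollifier_integrals(1)[OF k, of x]
  have "convolve k G x - G x = (LINT w|lborel. tensor k (x - w) * G w - G x * tensor k (x - w))"
    using int mollifier_integrals(2)[OF k, of x] by (simp add: convolve_def)
  also have "\<bar>\<dots>\<bar> \<le> (LINT w|lborel. e * tensor k (x - w))"
  proof (rule integral_abs_bound_integral)
    fix w
    show "\<bar>tensor k (x - w) * G w - G x * tensor k (x - w)\<bar> \<le> e * tensor k (x - w)"
    proof (cases "\<forall>i. \<bar>x$i - w$i\<bar> \<le> R")
      case True
      then have "\<bar>G x - G w\<bar> * tensor k (x - w) \<le> e * tensor k (x - w)"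
        using k' close by (intro mult_right_mono) auto
      moreover have "tensor k (x - w) * G w - G x * tensor k (x - w) = - ((G x - G w) * tensor k (x - w))"
        by algebra
      ultimately show ?thesis
        using k'(2)[of "x - w"] by (simp add: abs_mult)
    next
      case False
      then obtain i where "\<bar>(x - w)$i\<bar> > R"
        by (auto simp: not_le)
      then show ?thesis
        using tensor_eq_0[OF k'(1)] by simp
    qed
  qed (use int in auto)
  also have "\<dots> = e"
    using mollifier_integrals(2)[OF k, of x] by simp
  finally show ?thesis .
qed

lemma not_in_cbox_cart: "x$i < a$i \<or> b$i < x$i \<Longrightarrow> x \<notin> cbox a b" for x :: "real^'n"
  unfolding mem_box_cart by (meson not_less)

lemma integrable_compact_support:
  fixes G :: "real^'n::finite \<Rightarrow> real"
  assumes "continuous_on UNIV G" "\<And>x. x \<notin> cbox a b \<Longrightarrow> G x = 0"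
  shows "integrable lborel G"
proof -
  have "integrable lborel (\<lambda>x. indicator (cbox a b) x *\<^sub>R G x)"
    by (intro borel_integrable_compact continuous_on_subset[OF assms(1)]) auto
  moreover have "(\<lambda>x. indicator (cbox a b) x *\<^sub>R G x) = G"
    using assms(2) by (auto simp: indicator_def fun_eq_iff)
  ultimately show ?thesis by simp
qed

lemma integrable_square_imp_integrable:
  fixes F :: "real^'n::finite \<Rightarrow> real"
  assumes F: "F \<in> borel_measurable borel" "integrable lborel (\<lambda>x. (F x)\<^sup>2)" "\<And>x. x \<notin> cbox a b \<Longrightarrow> F x = 0"
  shows "integrable lborel F"
proof (rule Bochner_Integration.integrable_bound)
  show "integrable lborel (\<lambda>x. indicat_real (cbox a b) x + (F x)\<^sup>2)"
    by (intro Bochner_Integration.integrable_add integrable_real_indicator emeasure_compact_finite F) auto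
  have "\<bar>F x\<bar> \<le> 1 + (F x)\<^sup>2" for x
    using sum_squares_bound[of "\<bar>F x\<bar>" 1] abs_ge_zero[of "F x"] by simp
  then show "AE x in lborel. norm (F x) \<le> norm (indicat_real (cbox a b) x + (F x)\<^sup>2)"
    using F(3) by (auto simp: indicator_def)
qed (use F in auto)

text \<open>Split off a continuous \<open>G\<close> close to \<open>F\<close>: mollification
  contracts the L2 norm of \<open>F - G\<close> and moves \<open>G\<close> uniformly little on a
  bounded set. Three squares of integral at most \<open>e / 9\<close> and the factor 3 of the sum of
  three squares give \<open>e\<close>.\<close>

lemma mollify_L2:
  fixes F :: "real^'n::finite \<Rightarrow> real"
  assumes F: "F \<in> borel_measurable borel" "integrable lborel (\<lambda>x. (F x)\<^sup>2)" "\<And>x. x \<notin> cbox a b \<Longrightarrow> F x = 0"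
    and e: "e > 0"
  obtains \<delta> where "\<delta> > 0" "\<And>R k. R \<le> \<delta> \<Longrightarrow> mollifier R k \<Longrightarrow>
    (\<integral>\<^sup>+x. ennreal ((convolve k F x - F x)\<^sup>2) \<partial>lborel) \<le> ennreal e"
proof -
  obtain G where G: "continuous_on UNIV G" "\<And>x. x \<notin> cbox (a - vec 1) (b + vec 1) \<Longrightarrow> G x = 0"
    "(LINT x|lborel. (F x - G x)\<^sup>2) < e / 9" "integrable lborel (\<lambda>x. (F x - G x)\<^sup>2)"
    using L2_density[OF F, where e = "e / 9"] e by auto
  have F1: "integrable lborel F"
    by (rule integrable_square_imp_integrable[OF F])
  have G1: "integrable lborel G"
    by (rule integrable_compact_support[OF G(1,2)])
  have [measurable]: "F \<in> borel_measurable borel" "G \<in> borel_measurable borel"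
    using F(1) G1 by auto
  define V where "V = measure lborel (cbox (a - vec 2) (b + vec 2))"
  have V: "V \<ge> 0" "emeasure lborel (cbox (a - vec 2) (b + vec 2)) = ennreal V"
    using emeasure_compact_finite[OF compact_cbox, of "a - vec 2" "b + vec 2"]
    unfolding V_def by (auto intro!: emeasure_eq_ennreal_measure simp: less_top)
  \<comment> \<open>The uniform error \<open>t\<close> on a set of measure \<open>V\<close> has to
    contribute at most \<open>e / 9\<close>; \<open>V + 1\<close> avoids dividing by 0.\<close>
  define t where "t = sqrt (e / 9 / (V + 1))"
  have t: "t > 0" "t\<^sup>2 * V \<le> e / 9"
  proof -
    show "t > 0"
      using e V by (simp add: t_def)
    have "t\<^sup>2 * V = e / 9 * (V / (V + 1))"
      using e V by (simp add: t_def)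
    also have "\<dots> \<le> e / 9 * 1"
      using e V by (intro mult_left_mono) auto
    finally show "t\<^sup>2 * V \<le> e / 9" by simp
  qed
  obtain \<delta> where \<delta>: "\<delta> > 0" "\<And>x y. dist x y < \<delta> \<Longrightarrow> \<bar>G x - G y\<bar> < t"
    using compact_support_uniformly_continuous[OF G(1,2) t(1)] by blast
  \<comment> \<open>A cube of half width \<open>r\<close> fits into the ball of radius
    \<open>\<delta>\<close> since the Euclidean distance is at most the sum of the components. As
    \<open>r\<close> is at most 1, mollifying keeps the support within the box enlarged by
    2.\<close>
  define r where "r = min 1 (\<delta> / (2 * real CARD('n)))"
  have r: "r > 0" "r \<le> 1" "real CARD('n) * r < \<delta>"
  proof -
    show "r > 0" "r \<le> 1"
      using \<delta> by (auto simp: r_def)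
    have "real CARD('n) * r \<le> real CARD('n) * (\<delta> / (2 * real CARD('n)))"
      unfolding r_def by (intro mult_left_mono) auto
    also have "\<dots> < \<delta>"
      using \<delta> by simp
    finally show "real CARD('n) * r < \<delta>" .
  qed
  have "(\<integral>\<^sup>+x. ennreal ((convolve k F x - F x)\<^sup>2) \<partial>lborel) \<le> ennreal e"
    if R: "R \<le> r" and k: "mollifier R k" for R k
  proof -
    define H where "H x = F x - G x" for x
    have H1: "integrable lborel H" "integrable lborel (\<lambda>x. (H x)\<^sup>2)"
      using F1 G1 G(4) unfolding H_def[abs_def] by auto
    have k': "smooth_kernel R k"
      using k by (simp add: mollifier_def)
    have [measurable]: "convolve k G \<in> borel_measurable borel" "convolve k H \<in> borel_measurable borel" "H \<in> borel_measurable borel"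
      using continuous_on_convolve[OF k' G1] continuous_on_convolve[OF k' H1(1)] H1
      by (auto intro: borel_measurable_continuous_onI)
    have "(\<integral>\<^sup>+x. ennreal ((H x)\<^sup>2) \<partial>lborel) \<le> ennreal (e / 9)"
      using G(3,4) by (subst nn_integral_eq_integral) (auto simp: H_def intro!: ennreal_leI)
    note A = this order_trans[OF convolve_L2_le[OF k H1] this]
    have mid: "(convolve k G x - G x)\<^sup>2 \<le> t\<^sup>2 * indicator (cbox (a - vec 2) (b + vec 2)) x" for x
    proof (cases "x \<in> cbox (a - vec 2) (b + vec 2)")
      case True
      have "\<bar>G x - G w\<bar> \<le> t" if "\<And>i. \<bar>x$i - w$i\<bar> \<le> R" for w
      proof -
        have "dist x w \<le> (\<Sum>i\<in>UNIV. \<bar>(x - w)$i\<bar>)"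
          unfolding dist_norm by (rule norm_le_l1_cart)
        also have "\<dots> \<le> (\<Sum>i\<in>(UNIV::'n set). r)"
          using that R by (intro sum_mono) (auto intro: order_trans)
        also have "\<dots> < \<delta>"
          using r by simp
        finally show ?thesis
          using \<delta>(2)[of x w] by simp
      qed
      then have "\<bar>convolve k G x - G x\<bar> \<le> t"
        by (rule convolve_uniform[OF k G1])
      then show ?thesis
        using True t by (simp add: abs_le_square_iff[symmetric])
    next
      case False
      then obtain i where i: "x$i < a$i - 2 \<or> b$i + 2 < x$i"
        by (auto simp: mem_box_cart not_le)
      have far: "G w = 0" if "\<bar>x$i - w$i\<bar> \<le> R" for w
      proof (rule G(2))
        have "w$i < a$i - 1 \<or> b$i + 1 < w$i"
          using i that R r by linarith
        then show "w \<notin> cbox (a - vec 1) (b + vec 1)"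
          by (intro not_in_cbox_cart[of _ i]) simp
      qed
      have "G x = 0"
        using i by (intro G(2) not_in_cbox_cart[of _ i]) auto
      then have "\<bar>convolve k G x - G x\<bar> \<le> 0"
        using far by (intro convolve_uniform[OF k G1]) auto
      then show ?thesis
        using False by simp
    qed
    have B: "(\<integral>\<^sup>+x. ennreal ((convolve k G x - G x)\<^sup>2) \<partial>lborel) \<le> ennreal (e / 9)"
    proof -
      have "(\<integral>\<^sup>+x. ennreal ((convolve k G x - G x)\<^sup>2) \<partial>lborel)
          \<le> (\<integral>\<^sup>+x. ennreal (t\<^sup>2) * indicator (cbox (a - vec 2) (b + vec 2)) x \<partial>lborel)"
      proof (rule nn_integral_mono)
        show "ennreal ((convolve k G x - G x)\<^sup>2) \<le> ennreal (t\<^sup>2) * indicator (cbox (a - vec 2) (b + vec 2)) x" for x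
          using ennreal_leI[OF mid[of x]] by (auto simp: indicator_def)
      qed
      also have "\<dots> = ennreal (t\<^sup>2 * V)"
        using V by (simp add: nn_integral_cmult_indicator ennreal_mult)
      also have "\<dots> \<le> ennreal (e / 9)"
        using t by (intro ennreal_leI)
      finally show ?thesis .
    qed
    have split: "convolve k F x = convolve k H x + convolve k G x" for x
      using integrable_kernel_mult[OF k' H1(1), of x] integrable_kernel_mult[OF k' G1, of x]
      unfolding convolve_def H_def
      by (subst Bochner_Integration.integral_add[symmetric]) (auto simp: algebra_simps)
    have "(\<integral>\<^sup>+x. ennreal ((convolve k F x - F x)\<^sup>2) \<partial>lborel)
        \<le> (\<integral>\<^sup>+x. 3 * (ennreal ((convolve k H x)\<^sup>2) + ennreal ((convolve k G x - G x)\<^sup>2) + ennreal ((H x)\<^sup>2)) \<partial>lborel)"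
    proof (rule nn_integral_mono)
      fix x
      define A B C where "A = convolve k H x" and "B = convolve k G x - G x" and "C = - H x"
      have "(A + B + C)\<^sup>2 \<le> 3 * (A\<^sup>2 + B\<^sup>2 + C\<^sup>2)"
        using zero_le_power2[of "A - B"] zero_le_power2[of "B - C"] zero_le_power2[of "A - C"]
        by (simp add: power2_eq_square algebra_simps)
      moreover have "convolve k F x - F x = A + B + C"
        by (simp add: split A_def B_def C_def H_def)
      ultimately have "ennreal ((convolve k F x - F x)\<^sup>2) \<le> ennreal (3 * (A\<^sup>2 + B\<^sup>2 + C\<^sup>2))"
        by (intro ennreal_leI) simp
      also have "\<dots> = 3 * (ennreal (A\<^sup>2) + ennreal (B\<^sup>2) + ennreal (C\<^sup>2))"
        by (simp add: ennreal_mult ennreal_plus)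
      finally show "ennreal ((convolve k F x - F x)\<^sup>2)
          \<le> 3 * (ennreal ((convolve k H x)\<^sup>2) + ennreal ((convolve k G x - G x)\<^sup>2) + ennreal ((H x)\<^sup>2))"
        by (simp add: A_def B_def C_def)
    qed
    also have "\<dots> = 3 * ((\<integral>\<^sup>+x. ennreal ((convolve k H x)\<^sup>2) \<partial>lborel)
        + (\<integral>\<^sup>+x. ennreal ((convolve k G x - G x)\<^sup>2) \<partial>lborel) + (\<integral>\<^sup>+x. ennreal ((H x)\<^sup>2) \<partial>lborel))"
      by (subst nn_integral_cmult, measurable, subst nn_integral_add, measurable, subst nn_integral_add, measurable)
    also have "\<dots> \<le> 3 * (ennreal (e / 9) + ennreal (e / 9) + ennreal (e / 9))"
      by (intro mult_left_mono add_mono A B) auto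
    also have "\<dots> = ennreal e"
      using e by (simp add: ennreal_plus[symmetric] ennreal_mult[symmetric] del: ennreal_plus flip: ennreal_numeral)
    finally show ?thesis .
  qed
  with r(1) show ?thesis
    using that by blast
qed

text \<open>Weak derivatives are merely Lebesgue measurable, while \<open>convolve\<close> and
  Fubini work with \<open>lborel\<close>. A Borel version that vanishes off a compact set mediates
  between the two.\<close>

lemma borel_representative:
  fixes f :: "real^'n::finite \<Rightarrow> real"
  assumes K: "compact K" and f: "f \<in> borel_measurable (lebesgue_on K)"
  obtains f' where "f' \<in> borel_measurable borel" "\<And>x. x \<notin> K \<Longrightarrow> f' x = 0"
    "AE x in lebesgue. f' x = indicator K x * f x"
proof -
  have K': "K \<in> sets lebesgue" "K \<in> sets borel"
    using K by (auto simp: borel_compact)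
  have "(\<lambda>x. indicator K x *\<^sub>R f x) \<in> borel_measurable lebesgue"
    using f K' by (subst (asm) borel_measurable_restrict_space_iff) auto
  then obtain g where g: "g \<in> borel_measurable lborel" "AE x in lborel. indicator K x *\<^sub>R f x = g x"
    using completion_ex_borel_measurable_real by blast
  show ?thesis
  proof
    show "(\<lambda>x. indicator K x * g x) \<in> borel_measurable borel"
      using g K' by (intro borel_measurable_times borel_measurable_indicator) auto
    show "x \<notin> K \<Longrightarrow> indicator K x * g x = 0" for x
      by simp
    have "AE x in lborel. indicator K x * g x = indicator K x * f x"
      using g(2) by eventually_elim (auto simp: indicator_def split: if_splits)
    then show "AE x in lebesgue. indicator K x * g x = indicator K x * f x"
      by (simp add: AE_completion_iff)
  qed
qed

lemma integral_kernel_representative: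
  fixes f f' \<psi> :: "real^'n::finite \<Rightarrow> real"
  assumes "compact K" "K \<subseteq> S" "S \<in> sets lebesgue"
    and f: "f \<in> borel_measurable (lebesgue_on K)"
    and f': "f' \<in> borel_measurable borel" "AE x in lebesgue. f' x = indicator K x * f x"
    and \<psi>: "\<psi> \<in> borel_measurable borel" "\<And>x. x \<notin> K \<Longrightarrow> \<psi> x = 0"
  shows "(LINT x|lborel. \<psi> x * f' x) = (LINT x|lebesgue_on S. \<psi> x *\<^sub>R f x)"
proof -
  have K': "K \<in> sets lebesgue"
    using assms by (auto simp: borel_compact)
  have Kf: "(\<lambda>x. indicator K x * f x) \<in> borel_measurable lebesgue"
    using f K' by (subst (asm) borel_measurable_restrict_space_iff) auto
  have \<psi>L: "\<psi> \<in> borel_measurable lebesgue"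
    using \<psi>(1) by (intro measurable_completion) auto
  have f'L: "f' \<in> borel_measurable lebesgue"
    using f'(1) by (intro measurable_completion) auto
  have "(LINT x|lborel. \<psi> x * f' x) = (LINT x|lebesgue. \<psi> x * f' x)"
    using \<psi>(1) f'(1) by (subst integral_completion) auto
  also have "\<dots> = (LINT x|lebesgue. \<psi> x * (indicator K x * f x))"
  proof (rule integral_cong_AE[OF borel_measurable_times[OF \<psi>L f'L] borel_measurable_times[OF \<psi>L Kf]])
    show "AE x in lebesgue. \<psi> x * f' x = \<psi> x * (indicator K x * f x)"
      using f'(2) by eventually_elim simp
  qed
  also have "\<dots> = (LINT x|lebesgue. indicator S x *\<^sub>R (\<psi> x *\<^sub>R f x))"
    using assms(2) \<psi>(2) by (intro Bochner_Integration.integral_cong) (auto simp: indicator_def)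
  also have "\<dots> = (LINT x|lebesgue_on S. \<psi> x *\<^sub>R f x)"
    using assms(3) by (subst integral_restrict_space) auto
  finally show ?thesis .
qed

lemma integrable_representative:
  fixes f f' :: "real^'n::finite \<Rightarrow> real"
  assumes "compact K" "integrable (lebesgue_on K) f" "f' \<in> borel_measurable borel"
    and ae: "AE x in lebesgue. f' x = indicator K x * f x"
  shows "integrable lborel f'"
proof -
  have K': "K \<in> sets lebesgue"
    using assms by (auto simp: borel_compact)
  have int: "integrable lebesgue (\<lambda>x. indicator K x *\<^sub>R f x)"
    using assms(2) K' by (subst (asm) integrable_restrict_space) auto
  have "integrable lebesgue f'"
    using ae assms(3) by (subst integrable_cong_AE[OF _ borel_measurable_integrable[OF int]])
      (use int in \<open>auto intro: measurable_completion\<close>)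
  then show ?thesis
    using assms(3) by (subst (asm) integrable_completion) auto
qed

text \<open>On the inner box, testing the weak derivative with the reflected kernel shows that the
  derivative of the mollified function is the mollified weak derivative. All \<open>j\<close> share
  one kernel and one \<open>f\<close>, so the approximants are the partial derivatives of a single
  smooth function.\<close>

lemma weak_deriv_smooth_approximation:
  fixes U :: "real^'n::finite \<Rightarrow> real" and g :: "'n \<Rightarrow> real^'n \<Rightarrow> real"
  assumes S: "open S" and sub: "cbox (a - vec \<rho>) (b + vec \<rho>) \<subseteq> S" "0 < \<rho>"
    and weak: "\<And>j. has_weak_deriv S [j] U (g j)"
    and L2: "\<And>j. integrable (lebesgue_on (cbox (a - vec \<rho>) (b + vec \<rho>))) (\<lambda>x. (g j x)\<^sup>2)"
    and e: "0 < e"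
  obtains R k f where "smooth_kernel R k" "integrable lborel f"
    "\<And>j. (\<integral>\<^sup>+x\<in>cbox a b. ennreal ((convolve (k(j := deriv (k j))) f x - g j x)\<^sup>2) \<partial>lebesgue) \<le> ennreal e"
proof -
  let ?K = "cbox (a - vec \<rho>) (b + vec \<rho>)"
  have SL: "S \<in> sets lebesgue"
    using S by (simp add: borel_open)
  have loc: "integrable (lebesgue_on ?K) U" "\<And>j. integrable (lebesgue_on ?K) (g j)"
  proof -
    have "U locally_integrable_on S" "g j locally_integrable_on S" for j
      using weak[of j] by (simp_all add: has_weak_deriv_def)
    then show "integrable (lebesgue_on ?K) U" "\<And>j. integrable (lebesgue_on ?K) (g j)"
      using sub(1) compact_cbox[of "a - vec \<rho>" "b + vec \<rho>"] by (simp_all add: locally_integrable_on_def)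
  qed
  obtain f where f: "f \<in> borel_measurable borel" "\<And>x. x \<notin> ?K \<Longrightarrow> f x = 0"
    "AE x in lebesgue. f x = indicator ?K x * U x"
    using borel_representative[OF compact_cbox borel_measurable_integrable[OF loc(1)]] by blast
  have exF: "\<forall>j. \<exists>F. F \<in> borel_measurable borel \<and> (\<forall>x. x \<notin> ?K \<longrightarrow> F x = 0) \<and> (AE x in lebesgue. F x = indicator ?K x * g j x)"
  proof
    fix j
    show "\<exists>F. F \<in> borel_measurable borel \<and> (\<forall>x. x \<notin> ?K \<longrightarrow> F x = 0) \<and> (AE x in lebesgue. F x = indicator ?K x * g j x)"
      by (rule borel_representative[OF compact_cbox borel_measurable_integrable[OF loc(2)[of j]]])
        (intro exI conjI allI impI)
  qed
  obtain F where FF: "\<forall>j. F j \<in> borel_measurable borel \<and> (\<forall>x. x \<notin> ?K \<longrightarrow> F j x = 0)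
      \<and> (AE x in lebesgue. F j x = indicator ?K x * g j x)"
    using choice[OF exF] by (elim exE)
  have F: "F j \<in> borel_measurable borel" "x \<notin> ?K \<Longrightarrow> F j x = 0"
    "AE x in lebesgue. F j x = indicator ?K x * g j x" for j x
    using FF[rule_format, of j] by simp_all
  have F2: "integrable lborel (\<lambda>x. (F j x)\<^sup>2)" for j
  proof (rule integrable_representative[OF compact_cbox L2])
    show "AE x in lebesgue. (F j x)\<^sup>2 = indicator ?K x * (g j x)\<^sup>2"
      using F(3)[of j] by eventually_elim (auto simp: indicator_def)
  qed (use F(1) in auto)
  have f1: "integrable lborel f"
    by (rule integrable_representative[OF compact_cbox loc(1) f(1,3)])
  have ex\<delta>: "\<forall>j. \<exists>\<delta>>0. \<forall>R k. R \<le> \<delta> \<longrightarrow> mollifier R k \<longrightarrow>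
      (\<integral>\<^sup>+x. ennreal ((convolve k (F j) x - F j x)\<^sup>2) \<partial>lborel) \<le> ennreal e"
  proof
    fix j
    show "\<exists>\<delta>>0. \<forall>R k. R \<le> \<delta> \<longrightarrow> mollifier R k \<longrightarrow>
        (\<integral>\<^sup>+x. ennreal ((convolve k (F j) x - F j x)\<^sup>2) \<partial>lborel) \<le> ennreal e"
    proof (rule mollify_L2[OF F(1)[of j] F2 _ e])
      show "F j x = 0" if "x \<notin> ?K" for x
        using that by (rule F(2))
    qed (intro exI conjI allI impI)
  qed
  obtain \<delta> where \<delta>': "\<forall>j. \<delta> j > 0 \<and> (\<forall>R k. R \<le> \<delta> j \<longrightarrow> mollifier R k \<longrightarrow>
      (\<integral>\<^sup>+x. ennreal ((convolve k (F j) x - F j x)\<^sup>2) \<partial>lborel) \<le> ennreal e)"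
    using choice[OF ex\<delta>] by (elim exE)
  have \<delta>: "\<delta> j > 0" "R \<le> \<delta> j \<Longrightarrow> mollifier R k \<Longrightarrow>
      (\<integral>\<^sup>+x. ennreal ((convolve k (F j) x - F j x)\<^sup>2) \<partial>lborel) \<le> ennreal e" for j R k
    using \<delta>'[rule_format, of j] by simp_all
  \<comment> \<open>There are finitely many directions, so a common radius exists;
    \<open>\<rho>\<close> is included to keep the reflected kernels supported in
    \<open>S\<close>.\<close>
  define R where "R = Min (insert \<rho> (range \<delta>))"
  have R: "0 < R" "R \<le> \<rho>" "R \<le> \<delta> j" for j
  proof -
    show "0 < R"
      using \<delta>(1) sub(2) unfolding R_def by simp
    show "R \<le> \<rho>" "R \<le> \<delta> j"
      unfolding R_def by (rule Min_le; simp)+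
  qed
  obtain k :: "'n \<Rightarrow> real \<Rightarrow> real" where k: "mollifier R k"
    using mollifier_exists[OF R(1)] by blast
  then have k': "smooth_kernel R k"
    by (simp add: mollifier_def)
  have key: "convolve (k(j := deriv (k j))) f x = convolve k (F j) x" if x: "x \<in> cbox a b" for x j
  proof -
    let ?k' = "k(j := deriv (k j))"
    \<comment> \<open>The kernel centred at \<open>x\<close>, reflected factor by factor, is again a
      product and hence a test function.\<close>
    define l where "l i t = k i (x$i - t)" for i t
    have l_smooth: "smooth (l i)" for i
      using smooth_affine[OF kernel_smooth[OF k', of i], of "x$i" "-1"] by (simp add: l_def[abs_def])
    have l_deriv: "deriv (l j) t = - deriv (k j) (x$j - t)" for t
    proof (rule DERIV_imp_deriv)
      have "((\<lambda>t. x$j - t) has_real_derivative -1) (at t)"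
        by (auto intro!: derivative_eq_intros)
      from DERIV_chain2[OF smooth_DERIV[OF kernel_smooth[OF k']] this]
      show "(l j has_real_derivative - deriv (k j) (x$j - t)) (at t)"
        unfolding l_def by simp
    qed
    have tl: "tensor l w = tensor k (x - w)" for w
      by (simp add: tensor_def l_def)
    \<comment> \<open>Reflection changes the sign of the derivative, which cancels the sign in the
      definition of the weak derivative.\<close>
    have tl': "partial_deriv j (tensor l) w = - tensor ?k' (x - w)" for w
      unfolding partial_deriv_tensor[OF l_smooth] tensor_upd l_deriv by (simp add: l_def)
    have ball: "cbox (x - vec R) (x + vec R) \<subseteq> ?K"
    proof
      fix w assume w: "w \<in> cbox (x - vec R) (x + vec R)"
      have "a$i - \<rho> \<le> w$i \<and> w$i \<le> b$i + \<rho>" for i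
        using w x R(2) by (auto simp: mem_box_cart dest!: spec[of _ i])
      then show "w \<in> ?K"
        by (simp add: mem_box_cart)
    qed
    have test: "tensor l \<in> test_functions S"
    proof (rule tensor_test_function[OF l_smooth])
      show "cbox (x - vec R) (x + vec R) \<subseteq> S"
        using ball sub by blast
      show "l i t = 0" if "t \<notin> {(x - vec R)$i..(x + vec R)$i}" for i t
        using k' that unfolding smooth_kernel_def l_def by (auto simp: not_le abs_if)
    qed
    have supp: "tensor m (x - w) = 0" if "w \<notin> ?K" "smooth_kernel R m" for w m
    proof -
      have "w \<notin> cbox (x - vec R) (x + vec R)"
        using ball that by blast
      then obtain i where "w$i < x$i - R \<or> x$i + R < w$i"
        by (auto simp: mem_box_cart not_le)
      then have "\<bar>(x - w)$i\<bar> > R"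
        by auto
      then show ?thesis
        using tensor_eq_0[OF that(2)] by simp
    qed
    have "convolve ?k' f x = (LINT w|lebesgue_on S. tensor ?k' (x - w) *\<^sub>R U w)"
      unfolding convolve_def
      using sub(1) SL borel_measurable_integrable[OF loc(1)] f(1,3) tensor_shift_measurable[OF kernel_deriv[OF k']]
        supp kernel_deriv[OF k']
      by (intro integral_kernel_representative[OF compact_cbox]) auto
    also have "\<dots> = - (LINT w|lebesgue_on S. iter_partial [j] (tensor l) w *\<^sub>R U w)"
      by (simp add: tl')
    also have "\<dots> = (LINT w|lebesgue_on S. tensor l w *\<^sub>R g j w)"
      using weak[of j] test unfolding has_weak_deriv_def by simp
    also have "\<dots> = convolve k (F j) x"
      unfolding convolve_def tl
      using sub(1) SL borel_measurable_integrable[OF loc(2)] F(1,3) tensor_shift_measurable[OF k'] supp k'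
      by (intro integral_kernel_representative[OF compact_cbox, symmetric]) auto
    finally show ?thesis .
  qed
  have "(\<integral>\<^sup>+x\<in>cbox a b. ennreal ((convolve (k(j := deriv (k j))) f x - g j x)\<^sup>2) \<partial>lebesgue) \<le> ennreal e" for j
  proof -
    have sub': "cbox a b \<subseteq> ?K"
    proof
      fix w assume w: "w \<in> cbox a b"
      have "a$i - \<rho> \<le> w$i \<and> w$i \<le> b$i + \<rho>" for i
        using w sub(2) by (auto simp: mem_box_cart dest!: spec[of _ i])
      then show "w \<in> ?K"
        by (simp add: mem_box_cart)
    qed
    have "(\<integral>\<^sup>+x\<in>cbox a b. ennreal ((convolve (k(j := deriv (k j))) f x - g j x)\<^sup>2) \<partial>lebesgue)
        \<le> (\<integral>\<^sup>+x. ennreal ((convolve k (F j) x - F j x)\<^sup>2) \<partial>lebesgue)"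
    proof (rule nn_integral_mono_AE)
      show "AE x in lebesgue. ennreal ((convolve (k(j := deriv (k j))) f x - g j x)\<^sup>2) * indicator (cbox a b) x
          \<le> ennreal ((convolve k (F j) x - F j x)\<^sup>2)"
        using F(3)[of j] by eventually_elim (use key sub' in \<open>auto simp: indicator_def\<close>)
    qed
    also have "\<dots> \<le> ennreal e"
      unfolding nn_integral_completion using \<delta>(2)[OF R(3) k] by blast
    finally show ?thesis .
  qed
  then show ?thesis
    using that[OF k' f1] by blast
qed

section \<open>Separation of phases for Sobolev functions\<close>

lemma continuous_on_vector3:
  "continuous_on S x \<Longrightarrow> continuous_on S y \<Longrightarrow> continuous_on S z \<Longrightarrow>
    continuous_on S (\<lambda>s. vector [x s, y s, z s] :: real^3)"
proof -
  assume "continuous_on S x" "continuous_on S y" "continuous_on S z"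
  moreover have "vector [x s, y s, z s] = x s *\<^sub>R axis 1 1 + y s *\<^sub>R axis 2 1 + z s *\<^sub>R (axis 3 1 :: real^3)" for s
    by (simp add: vec_eq_iff forall_3 axis_def)
  ultimately show ?thesis
    by (simp add: continuous_intros)
qed

lemma convolve_vector_cont:
  fixes f :: "real^3 \<Rightarrow> real"
  assumes "smooth_kernel R k" "integrable lborel f"
  shows "continuous_on UNIV (\<lambda>(x, y, z). convolve k f (vector [x, y, z]))"
  unfolding split_beta
  by (rule continuous_on_compose2[OF continuous_on_convolve[OF assms, of UNIV]])
    (auto intro!: continuous_on_vector3 continuous_intros)

lemma convolve_vector_DERIV:
  fixes f :: "real^3 \<Rightarrow> real"
  assumes "smooth_kernel R k" "integrable lborel f"
  shows "((\<lambda>x. convolve k f (vector [x, y, z])) has_real_derivative convolve (k(1 := deriv (k 1))) f (vector [x, y, z])) (at x)"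
    and "((\<lambda>y. convolve k f (vector [x, y, z])) has_real_derivative convolve (k(2 := deriv (k 2))) f (vector [x, y, z])) (at y)"
    and "((\<lambda>z. convolve k f (vector [x, y, z])) has_real_derivative convolve (k(3 := deriv (k 3))) f (vector [x, y, z])) (at z)"
proof -
  have eq: "vector [s, y, z] = vector [0, y, z] + s *\<^sub>R (axis 1 1 :: real^3)"
    "vector [x, s, z] = vector [x, 0, z] + s *\<^sub>R (axis 2 1 :: real^3)"
    "vector [x, y, s] = vector [x, y, 0] + s *\<^sub>R (axis 3 1 :: real^3)" for s
    by (simp_all add: vec_eq_iff forall_3 axis_def)
  show "((\<lambda>x. convolve k f (vector [x, y, z])) has_real_derivative convolve (k(1 := deriv (k 1))) f (vector [x, y, z])) (at x)"
    using convolve_DERIV[OF assms, of "vector [0, y, z]" 1 x] by (simp flip: eq)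
  show "((\<lambda>y. convolve k f (vector [x, y, z])) has_real_derivative convolve (k(2 := deriv (k 2))) f (vector [x, y, z])) (at y)"
    using convolve_DERIV[OF assms, of "vector [x, 0, z]" 2 y] by (simp flip: eq)
  show "((\<lambda>z. convolve k f (vector [x, y, z])) has_real_derivative convolve (k(3 := deriv (k 3))) f (vector [x, y, z])) (at z)"
    using convolve_DERIV[OF assms, of "vector [x, y, 0]" 3 z] by (simp flip: eq)
qed

text \<open>Here \<open>m\<close> is the distance of \<open>t\<close> to the phases 0 and 1. In the
  product \<open>t * (t - 1)\<close> one factor has size \<open>m\<close> and the other at most
  \<open>1 + m\<close>.\<close>

lemma min_dist_two_wells:
  fixes t :: real
  defines "m \<equiv> min \<bar>t\<bar> \<bar>t - 1\<bar>"
  shows "\<bar>t - t\<^sup>2\<bar> \<le> m + m\<^sup>2" "\<bar>t\<bar> \<le> 1 + m" "min \<bar>s\<bar> \<bar>s - 1\<bar> \<le> m + \<bar>s - t\<bar>"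
proof -
  have "\<bar>t - t\<^sup>2\<bar> = \<bar>t\<bar> * \<bar>t - 1\<bar>"
    by (simp add: power2_eq_square abs_mult[symmetric] algebra_simps abs_minus_commute)
  also have "\<dots> \<le> m * (1 + m)"
  proof (cases "\<bar>t\<bar> \<le> \<bar>t - 1\<bar>")
    case True
    then have "m = \<bar>t\<bar>" by (simp add: m_def)
    then show ?thesis
      by (auto intro!: mult_left_mono)
  next
    case False
    then have "m = \<bar>t - 1\<bar>" by (simp add: m_def)
    moreover have "\<bar>t\<bar> * \<bar>t - 1\<bar> \<le> (1 + \<bar>t - 1\<bar>) * \<bar>t - 1\<bar>"
      by (intro mult_right_mono) auto
    ultimately show ?thesis
      by (simp add: mult.commute)
  qed
  finally show "\<bar>t - t\<^sup>2\<bar> \<le> m + m\<^sup>2"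
    by (simp add: power2_eq_square algebra_simps)
  show "\<bar>t\<bar> \<le> 1 + m"
    unfolding m_def by linarith
  show "min \<bar>s\<bar> \<bar>s - 1\<bar> \<le> m + \<bar>s - t\<bar>"
    unfolding m_def by linarith
qed

lemma sum5_square_le:
  fixes D M :: real
  shows "(5 * D + M * (v1 + v2 + v3 + v4 + v5))\<^sup>2
    \<le> 50 * D\<^sup>2 + 10 * M\<^sup>2 * (v1\<^sup>2 + v2\<^sup>2 + v3\<^sup>2 + v4\<^sup>2 + v5\<^sup>2)"
proof -
  define s P where "s = v1 + v2 + v3 + v4 + v5" and "P = v1\<^sup>2 + v2\<^sup>2 + v3\<^sup>2 + v4\<^sup>2 + v5\<^sup>2"
  \<comment> \<open>Lagrange's identity for the Cauchy-Schwarz inequality with five ones: the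
    difference is the sum of the squares of all ten pairwise differences.\<close>
  have "5 * P - s\<^sup>2
      = (v1 - v2)\<^sup>2 + (v1 - v3)\<^sup>2 + (v1 - v4)\<^sup>2 + (v1 - v5)\<^sup>2 + (v2 - v3)\<^sup>2 + (v2 - v4)\<^sup>2
        + (v2 - v5)\<^sup>2 + (v3 - v4)\<^sup>2 + (v3 - v5)\<^sup>2 + (v4 - v5)\<^sup>2"
    unfolding s_def P_def by algebra
  moreover have "0 \<le> \<dots>"
    by (intro add_nonneg_nonneg zero_le_power2)
  ultimately have "s\<^sup>2 \<le> 5 * P"
    by linarith
  then have "2 * M\<^sup>2 * s\<^sup>2 \<le> 2 * M\<^sup>2 * (5 * P)"
    by (intro mult_left_mono) auto
  \<comment> \<open>The parallelogram identity; dropping the second square gives the bound.\<close>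
  moreover have "(5 * D + M * s)\<^sup>2 + (5 * D - M * s)\<^sup>2 = 50 * D\<^sup>2 + 2 * M\<^sup>2 * s\<^sup>2"
    by algebra
  ultimately have "(5 * D + M * s)\<^sup>2 \<le> 50 * D\<^sup>2 + 10 * M\<^sup>2 * P"
    using zero_le_power2[of "5 * D - M * s"] by linarith
  then show ?thesis
    unfolding s_def P_def .
qed

lemma nn_integral_bounds_imp_integral:
  fixes f :: "'a \<Rightarrow> real"
  assumes "f \<in> borel_measurable M" "\<And>x. 0 \<le> f x" "(\<integral>\<^sup>+x. ennreal (f x) \<partial>M) \<le> ennreal c" "0 \<le> c"
  shows "integrable M f" "(LINT x|M. f x) \<le> c"
proof -
  show int: "integrable M f"
    using assms by (intro integrableI_bounded) (auto intro: le_less_trans)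
  then have "ennreal (LINT x|M. f x) \<le> ennreal c"
    using assms by (simp flip: nn_integral_eq_integral)
  then show "(LINT x|M. f x) \<le> c"
    using assms by simp
qed

lemma content_cube3: "0 \<le> r \<Longrightarrow> measure lebesgue (cbox (p - vec r) (p + vec r :: real^3)) = (2 * r)^3"
proof -
  assume "0 \<le> r"
  then have "p \<in> cbox (p - vec r) (p + vec r)"
    by (simp add: mem_box_cart)
  then have "measure lborel (cbox (p - vec r) (p + vec r)) = (\<Prod>i\<in>UNIV. (p + vec r)$i - (p - vec r)$i)"
    by (intro content_cbox_cart) blast
  then show ?thesis
    by (simp add: measure_completion)
qed

lemma test_function_partial:
  assumes "\<phi> \<in> test_functions S"
  obtains K where "compact K" "K \<subseteq> S" "\<And>x. x \<notin> K \<Longrightarrow> \<phi> x = 0" "\<And>x. x \<notin> K \<Longrightarrow> partial_deriv j \<phi> x = 0"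
    "continuous_on UNIV \<phi>" "continuous_on UNIV (partial_deriv j \<phi>)"
proof -
  obtain K where K: "compact K" "K \<subseteq> S" "\<And>x. x \<notin> K \<Longrightarrow> \<phi> x = 0"
    using assms unfolding test_functions_def by auto
  have diff: "iter_partial js \<phi> differentiable (at x)" for js x
    using assms unfolding test_functions_def by auto
  have "partial_deriv j \<phi> x = 0" if "x \<notin> K" for x
  proof -
    have "(\<phi> has_derivative (\<lambda>_. 0)) (at x)"
      by (rule has_derivative_transform_within_open[OF has_derivative_const[of 0]
            open_Compl[OF compact_imp_closed[OF K(1)]]]) (use K that in auto)
    then show ?thesis
      unfolding partial_deriv_def by (simp flip: frechet_derivative_at)
  qed
  moreover have "continuous_on UNIV \<phi>" "continuous_on UNIV (partial_deriv j \<phi>)"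
    using diff[of "[]"] diff[of "[j]"]
    by (auto intro!: continuous_at_imp_continuous_on differentiable_imp_continuous_within)
  ultimately show ?thesis
    using that K by blast
qed

lemma integrable_compact_scaleR:
  fixes \<psi> :: "real^'n::finite \<Rightarrow> real" and f :: "real^'n \<Rightarrow> 'b::euclidean_space"
  assumes K: "compact K" "K \<subseteq> S" and S: "S \<in> sets lebesgue" and f: "integrable (lebesgue_on K) f"
    and \<psi>: "continuous_on UNIV \<psi>" "\<And>x. x \<notin> K \<Longrightarrow> \<psi> x = 0"
  shows "integrable (lebesgue_on S) (\<lambda>x. \<psi> x *\<^sub>R f x)"
proof -
  have K': "K \<in> sets lebesgue"
    using K by (auto simp: borel_compact)
  have "bounded (\<psi> ` K)"
    by (intro compact_imp_bounded compact_continuous_image continuous_on_subset[OF \<psi>(1)] K) auto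
  then obtain C where C: "\<And>x. x \<in> K \<Longrightarrow> \<bar>\<psi> x\<bar> \<le> C"
    unfolding bounded_iff by (metis imageI real_norm_def)
  have "integrable (lebesgue_on K) (\<lambda>x. C *\<^sub>R f x)"
    using f by simp
  then have "integrable (lebesgue_on K) (\<lambda>x. \<psi> x *\<^sub>R f x)"
  proof (rule Bochner_Integration.integrable_bound)
    have "\<psi> \<in> borel_measurable (lebesgue_on K)"
      by (intro continuous_imp_measurable_on_sets_lebesgue K' continuous_on_subset[OF \<psi>(1)]) auto
    then show "(\<lambda>x. \<psi> x *\<^sub>R f x) \<in> borel_measurable (lebesgue_on K)"
      using f by (intro borel_measurable_scaleR) auto
    show "AE x in lebesgue_on K. norm (\<psi> x *\<^sub>R f x) \<le> norm (C *\<^sub>R f x)"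
      using C by (intro AE_I2) (fastforce simp: space_restrict_space intro!: mult_right_mono)
  qed
  then have "integrable lebesgue (\<lambda>x. indicator K x *\<^sub>R (\<psi> x *\<^sub>R f x))"
    using K' by (subst (asm) integrable_restrict_space) auto
  moreover have "(\<lambda>x. indicator K x *\<^sub>R (\<psi> x *\<^sub>R f x)) = (\<lambda>x. indicator S x *\<^sub>R (\<psi> x *\<^sub>R f x))"
    using K(2) \<psi>(2) by (auto simp: indicator_def fun_eq_iff)
  ultimately show ?thesis
    using S by (subst integrable_restrict_space) auto
qed

text \<open>Taking a component commutes with the vector integral as soon as the integrand is
  integrable, which the compact support of the test function ensures.\<close>

lemma has_weak_deriv_component:
  fixes f g :: "real^'n::finite \<Rightarrow> real^'m::finite"
  assumes weak: "has_weak_deriv S [j] f g" and S: "S \<in> sets lebesgue"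
  shows "has_weak_deriv S [j] (\<lambda>x. f x $ i) (\<lambda>x. g x $ i)"
proof -
  have loc: "f locally_integrable_on S" "g locally_integrable_on S"
    using weak by (auto simp: has_weak_deriv_def)
  have comp: "(\<lambda>x. k x $ i) locally_integrable_on S" if "k locally_integrable_on S" for k :: "real^'n \<Rightarrow> real^'m"
    using that unfolding locally_integrable_on_def
    by (auto intro: integrable_bounded_linear[OF bounded_linear_vec_nth])
  have "(LINT x|lebesgue_on S. iter_partial [j] \<phi> x *\<^sub>R f x $ i)
      = (-1) ^ length [j] *\<^sub>R (LINT x|lebesgue_on S. \<phi> x *\<^sub>R g x $ i)"
    if \<phi>: "\<phi> \<in> test_functions S" for \<phi>
  proof -
    obtain K where K: "compact K" "K \<subseteq> S" "\<And>x. x \<notin> K \<Longrightarrow> \<phi> x = 0" "\<And>x. x \<notin> K \<Longrightarrow> partial_deriv j \<phi> x = 0"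
      "continuous_on UNIV \<phi>" "continuous_on UNIV (partial_deriv j \<phi>)"
      using test_function_partial[OF \<phi>] by blast
    have fK: "integrable (lebesgue_on K) f" "integrable (lebesgue_on K) g"
      using loc K(1,2) by (simp_all add: locally_integrable_on_def)
    have int: "integrable (lebesgue_on S) (\<lambda>x. partial_deriv j \<phi> x *\<^sub>R f x)"
      "integrable (lebesgue_on S) (\<lambda>x. \<phi> x *\<^sub>R g x)"
      by (rule integrable_compact_scaleR[OF K(1,2) S]; use K fK in simp)+
    have "(LINT x|lebesgue_on S. (partial_deriv j \<phi> x *\<^sub>R f x) $ i) = (LINT x|lebesgue_on S. partial_deriv j \<phi> x *\<^sub>R f x) $ i"
      by (rule integral_bounded_linear[OF bounded_linear_vec_nth int(1)])
    also have "\<dots> = - (LINT x|lebesgue_on S. \<phi> x *\<^sub>R g x) $ i"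
      using weak \<phi> by (simp add: has_weak_deriv_def)
    also have "(LINT x|lebesgue_on S. \<phi> x *\<^sub>R g x) $ i = (LINT x|lebesgue_on S. (\<phi> x *\<^sub>R g x) $ i)"
      by (rule integral_bounded_linear[OF bounded_linear_vec_nth int(2), symmetric])
    finally show ?thesis
      by simp
  qed
  then show ?thesis
    using comp loc by (simp add: has_weak_deriv_def)
qed

lemma centered_cbox_subset_open:
  fixes p :: "real^'n::finite"
  assumes "open S" "p \<in> S"
  obtains r where "0 < r" "cbox (p - vec r) (p + vec r) \<subseteq> S"
proof -
  obtain e where e: "e > 0" "ball p e \<subseteq> S"
    using assms openE by blast
  define r where "r = e / (2 * real CARD('n))"
  have "cbox (p - vec r) (p + vec r) \<subseteq> ball p e"
  proof
    fix x assume x: "x \<in> cbox (p - vec r) (p + vec r)"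
    have "dist p x \<le> (\<Sum>i\<in>UNIV. \<bar>(p - x)$i\<bar>)"
      unfolding dist_norm by (rule norm_le_l1_cart)
    also have "\<dots> \<le> (\<Sum>i\<in>(UNIV::'n set). r)"
      using x by (intro sum_mono) (auto simp: mem_box_cart abs_le_iff algebra_simps)
    also have "\<dots> < e"
      using e by (simp add: r_def)
    finally show "x \<in> ball p e" by simp
  qed
  then show ?thesis
    using that[of r] e by (auto simp: r_def)
qed

lemma measure_box_pos:
  fixes a b :: "real^'n::finite"
  assumes "\<And>i. a$i < b$i"
  shows "0 < measure lebesgue (box a b)"
proof -
  have le: "\<And>v. v \<in> Basis \<Longrightarrow> a \<bullet> v < b \<bullet> v"
    using assms by (auto simp: Basis_vec_def inner_axis)
  have "emeasure lborel (box a b) = (\<Prod>v\<in>Basis. (b - a) \<bullet> v)"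
    using le by (intro emeasure_lborel_box) (simp add: less_imp_le)
  moreover have "0 < (\<Prod>v\<in>Basis. (b - a) \<bullet> v)"
    using le by (intro prod_pos) (simp add: inner_diff_left)
  ultimately have "measure lborel (box a b) = (\<Prod>v\<in>Basis. (b - a) \<bullet> v)"
    by (simp add: measure_def)
  then show ?thesis
    using \<open>0 < (\<Prod>v\<in>Basis. (b - a) \<bullet> v)\<close> by (simp add: measure_completion)
qed

lemma tendsto_0_if_mult_tendsto_0:
  fixes x y :: "nat \<Rightarrow> real"
  assumes "(\<lambda>n. x n * y n) \<longlonglongrightarrow> 0" "\<forall>\<^sub>F n in sequentially. w \<le> y n" "0 < w" "\<And>n. 0 \<le> x n"
  shows "x \<longlonglongrightarrow> 0"
proof (rule tendsto_sandwich[of "\<lambda>_. 0" _ _ "\<lambda>n. x n * y n / w"])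
  show "\<forall>\<^sub>F n in sequentially. x n \<le> x n * y n / w"
    using assms(2)
  proof eventually_elim
    case (elim n)
    then have "x n * w \<le> x n * y n"
      using assms(4) by (intro mult_left_mono)
    then show ?case
      using assms(3) by (simp add: pos_le_divide_eq)
  qed
  show "(\<lambda>n. x n * y n / w) \<longlonglongrightarrow> 0"
    using tendsto_divide[OF assms(1) tendsto_const[of w]] assms(3) by simp
qed (use assms in auto)

lemma integrable_const_lebesgue_on:
  fixes c :: real
  assumes "R \<in> lmeasurable"
  shows "integrable (lebesgue_on R) (\<lambda>x. c)" "(LINT x|lebesgue_on R. c) = c * measure lebesgue R"
proof -
  have R: "R \<in> sets lebesgue" "emeasure lebesgue R < \<infinity>"
    using assms by (auto simp: fmeasurable_def)
  have "integrable lebesgue (\<lambda>x. indicat_real R x * c)"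
    using R by (intro integrable_mult_left integrable_real_indicator) auto
  then show "integrable (lebesgue_on R) (\<lambda>x. c)"
    using R by (subst integrable_restrict_space) auto
  show "(LINT x|lebesgue_on R. c) = c * measure lebesgue R"
    using R by (simp add: measure_restrict_space space_restrict_space)
qed

section \<open>Propagation of a vanishing phase through a connected domain\<close>

locale unit_densities =
  fixes S :: "(real^'n::finite) set" and \<Theta> :: "nat \<Rightarrow> real^'n \<Rightarrow> real"
  assumes S: "open S" "connected S" "bounded S"
    and \<Theta>_meas: "\<And>n. \<Theta> n \<in> borel_measurable (lebesgue_on S)"
    and \<Theta>_range: "\<And>n x. 0 \<le> \<Theta> n x" "\<And>n x. \<Theta> n x \<le> 1"
begin

definition mass :: "nat \<Rightarrow> (real^'n) set \<Rightarrow> real" where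
  "mass n R = (LINT x|lebesgue_on R. \<Theta> n x)"

lemma S_lmeasurable: "S \<in> lmeasurable"
  using S by (simp add: lmeasurable_open)

lemma integrable_density:
  assumes R: "R \<in> sets lebesgue" "R \<subseteq> S"
  shows "integrable (lebesgue_on R) (\<Theta> n)"
proof -
  have R': "R \<in> lmeasurable"
    using R S_lmeasurable fmeasurableI2 by blast
  have "integrable (lebesgue_on R) (\<lambda>x. 1 :: real)"
    using R' by (rule integrable_const_lebesgue_on)
  then show ?thesis
  proof (rule Bochner_Integration.integrable_bound)
    show "\<Theta> n \<in> borel_measurable (lebesgue_on R)"
      using \<Theta>_meas R S(1) measurable_restrict_mono by blast
  qed (use \<Theta>_range in auto)
qed

lemma mass_nonneg: "0 \<le> mass n R"
  unfolding mass_def using \<Theta>_range by (intro Bochner_Integration.integral_nonneg) auto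

lemma mass_restrict:
  assumes R: "R \<in> sets lebesgue" "R \<subseteq> T" "T \<in> sets lebesgue"
  shows "mass n R = (LINT x|lebesgue_on T. indicator R x * \<Theta> n x)"
  unfolding mass_def using assms
  by (subst (1 2) integral_restrict_space) (auto intro!: Bochner_Integration.integral_cong simp: indicator_def)

lemma mass_mono:
  assumes R: "R \<in> sets lebesgue" "R \<subseteq> T" "T \<in> sets lebesgue" "T \<subseteq> S"
  shows "mass n R \<le> mass n T"
proof -
  have "mass n R = (LINT x|lebesgue_on T. indicator R x * \<Theta> n x)"
    using R by (intro mass_restrict)
  also have "\<dots> \<le> mass n T"
    unfolding mass_def
    using \<Theta>_range by (intro integral_mono_AE' integrable_density R AE_I2) (auto simp: indicator_def)
  finally show ?thesis .
qed

text \<open>This passes information from a small set to a larger one: where the first phase is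
  nearly absent on \<open>R\<close>, the second one has a definite mass on all of
  \<open>T\<close>.\<close>

lemma complement_mass_ge:
  assumes R: "R \<in> sets lebesgue" "R \<subseteq> T" "T \<in> sets lebesgue" "T \<subseteq> S"
  shows "measure lebesgue R - mass n R \<le> (LINT x|lebesgue_on T. 1 - \<Theta> n x)"
proof -
  have m: "R \<in> lmeasurable" "T \<in> lmeasurable"
    using R S_lmeasurable fmeasurableI2 by blast+
  have "measure lebesgue R - mass n R = (LINT x|lebesgue_on R. 1 - \<Theta> n x)"
    unfolding mass_def using m R
    by (subst Bochner_Integration.integral_diff)
      (auto intro!: integrable_density integrable_const_lebesgue_on simp: integrable_const_lebesgue_on(2)[of R 1, simplified])
  also have "\<dots> = (LINT x|lebesgue_on T. indicator R x * (1 - \<Theta> n x))"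
    using R by (subst (1 2) integral_restrict_space)
      (auto intro!: Bochner_Integration.integral_cong simp: indicator_def)
  also have "\<dots> \<le> (LINT x|lebesgue_on T. 1 - \<Theta> n x)"
    using \<Theta>_range m R by (intro integral_mono_AE' AE_I2 Bochner_Integration.integrable_diff integrable_density
        integrable_const_lebesgue_on) (auto simp: indicator_def)
  finally show ?thesis .
qed

text \<open>If the two phases never coexist on small boxes, then the vanishing of one phase near a
  single point propagates: overlapping boxes cannot carry different phases.\<close>

lemma vanishing_propagates:
  assumes loc: "\<And>p. p \<in> S \<Longrightarrow> \<exists>r>0. cbox (p - vec r) (p + vec r) \<subseteq> S \<and>
      (\<lambda>n. mass n (cbox (p - vec r) (p + vec r)) * (LINT x|lebesgue_on (cbox (p - vec r) (p + vec r)). 1 - \<Theta> n x))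
        \<longlonglongrightarrow> 0"
    and start: "0 < r0" "cbox (p0 - vec r0) (p0 + vec r0) \<subseteq> S" "(\<lambda>n. mass n (cbox (p0 - vec r0) (p0 + vec r0))) \<longlonglongrightarrow> 0"
  shows "(\<lambda>n. mass n S) \<longlonglongrightarrow> 0"
proof -
  \<comment> \<open>The point lies in the open box while the mass vanishes on the closed one:
    openness is needed for the covering argument, closed boxes for the masses.\<close>
  define good where "good p \<longleftrightarrow> (\<exists>a b. p \<in> box a b \<and> cbox a b \<subseteq> S \<and> (\<lambda>n. mass n (cbox a b)) \<longlonglongrightarrow> 0)" for p
  have shrink: "(\<lambda>n. mass n R) \<longlonglongrightarrow> 0"
    if "(\<lambda>n. mass n T) \<longlonglongrightarrow> 0" "R \<in> sets lebesgue" "R \<subseteq> T" "T \<in> sets lebesgue" "T \<subseteq> S" for R T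
    by (rule tendsto_sandwich[OF _ _ tendsto_const that(1)]) (use mass_nonneg mass_mono[OF that(2-5)] in auto)
  have inbox: "p \<in> box (p - vec r) (p + vec r)" if "0 < r" for p :: "real^'n" and r
    using that by (simp add: mem_box_cart)
  have p0: "p0 \<in> S" "good p0"
    using start inbox[of r0 p0] box_subset_cbox unfolding good_def by blast+
  have "good p" if "p \<in> S" for p
  proof (rule connected_induction_simple[where P = good, OF S(2) p0(1) that p0(2)])
    fix q assume "q \<in> S"
    then obtain r where r: "0 < r" "cbox (q - vec r) (q + vec r) \<subseteq> S"
      "(\<lambda>n. mass n (cbox (q - vec r) (q + vec r)) * (LINT x|lebesgue_on (cbox (q - vec r) (q + vec r)). 1 - \<Theta> n x)) \<longlonglongrightarrow> 0"
      using loc by blast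
    let ?B = "box (q - vec r) (q + vec r)" and ?C = "cbox (q - vec r) (q + vec r)"
    \<comment> \<open>A small cube in the overlap carries almost none of the first phase, so the
      second one keeps at least half its measure inside the new box. As the product of the masses
      tends to 0, the first phase disappears from the whole box.\<close>
    have "good y" if xy: "x \<in> ?B" "y \<in> ?B" "good x" for x y
    proof -
      obtain a b where ab: "x \<in> box a b" "cbox a b \<subseteq> S" "(\<lambda>n. mass n (cbox a b)) \<longlonglongrightarrow> 0"
        using xy(3) unfolding good_def by blast
      have "open (box a b \<inter> ?B)" "x \<in> box a b \<inter> ?B"
        using ab xy by (auto intro: open_box)
      then obtain s where s: "0 < s" "cbox (x - vec s) (x + vec s) \<subseteq> box a b \<inter> ?B"
        using centered_cbox_subset_open by blast
      let ?R = "cbox (x - vec s) (x + vec s)"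
      have subs: "?R \<subseteq> cbox a b" "?R \<subseteq> ?C"
        using s(2) box_subset_cbox by blast+
      have "0 < measure lebesgue (box (x - vec s) (x + vec s))"
        using s(1) by (intro measure_box_pos) auto
      also have "\<dots> \<le> measure lebesgue ?R"
        by (intro measure_mono_fmeasurable box_subset_cbox) auto
      finally have w: "0 < measure lebesgue ?R" .
      have "(\<lambda>n. mass n ?R) \<longlonglongrightarrow> 0"
        using ab subs by (intro shrink[OF ab(3)]) auto
      then have "\<forall>\<^sub>F n in sequentially. mass n ?R < measure lebesgue ?R / 2"
        by (rule order_tendstoD) (use w in simp)
      then have "\<forall>\<^sub>F n in sequentially. measure lebesgue ?R / 2 \<le> (LINT x|lebesgue_on ?C. 1 - \<Theta> n x)"
      proof eventually_elim
        case (elim n)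
        then show ?case
          using complement_mass_ge[of ?R ?C n] subs r by simp
      qed
      then have "(\<lambda>n. mass n ?C) \<longlonglongrightarrow> 0"
        by (rule tendsto_0_if_mult_tendsto_0[OF r(3)]) (use w mass_nonneg in auto)
      then show ?thesis
        unfolding good_def using xy(2) r(2) by blast
    qed
    moreover have "openin (top_of_set S) ?B" "q \<in> ?B"
      using r inbox box_subset_cbox[of "q - vec r" "q + vec r"] by (auto intro!: openin_open_subtopology[THEN iffD2] simp: openin_open_eq S)
    ultimately show "\<exists>T. openin (top_of_set S) T \<and> q \<in> T \<and> (\<forall>x\<in>T. \<forall>y\<in>T. good x \<longrightarrow> good y)"
      by blast
  qed
  note good = this
  show ?thesis
  proof (rule LIMSEQ_I)
    fix e :: real assume "0 < e"
    \<comment> \<open>Finitely many good boxes cover only a compact set; the rest is given measure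
      less than \<open>e / 2\<close>, and the density is at most 1 there.\<close>
    then obtain K where K: "closed K" "K \<subseteq> S" "S - K \<in> lmeasurable" "emeasure lebesgue (S - K) < ennreal (e / 2)"
      using sets_lebesgue_inner_closed[of S "e / 2"] S_lmeasurable by (metis fmeasurableD half_gt_zero)
    have "compact K"
      using K S bounded_subset compact_eq_bounded_closed by blast
    have "\<forall>p\<in>K. \<exists>c. p \<in> box (fst c) (snd c) \<and> cbox (fst c) (snd c) \<subseteq> S \<and> (\<lambda>n. mass n (cbox (fst c) (snd c))) \<longlonglongrightarrow> 0"
    proof
      fix p assume "p \<in> K"
      then have "good p"
        using good K(2) by blast
      then obtain u v where "p \<in> box u v" "cbox u v \<subseteq> S" "(\<lambda>n. mass n (cbox u v)) \<longlonglongrightarrow> 0"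
        unfolding good_def by blast
      then show "\<exists>c. p \<in> box (fst c) (snd c) \<and> cbox (fst c) (snd c) \<subseteq> S \<and> (\<lambda>n. mass n (cbox (fst c) (snd c))) \<longlonglongrightarrow> 0"
        by (intro exI[of _ "(u, v)"]) simp
    qed
    from bchoice[OF this] obtain c where c: "\<forall>p\<in>K. p \<in> box (fst (c p)) (snd (c p)) \<and> cbox (fst (c p)) (snd (c p)) \<subseteq> S
        \<and> (\<lambda>n. mass n (cbox (fst (c p)) (snd (c p)))) \<longlonglongrightarrow> 0"
      by (elim exE)
    define a b where "a p = fst (c p)" and "b p = snd (c p)" for p
    have ab: "p \<in> box (a p) (b p)" "cbox (a p) (b p) \<subseteq> S" "(\<lambda>n. mass n (cbox (a p) (b p))) \<longlonglongrightarrow> 0" if "p \<in> K" for p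
      using c[rule_format, OF that] by (simp_all add: a_def b_def)
    have cover: "K \<subseteq> (\<Union>p\<in>K. box (a p) (b p))"
      using ab(1) by blast
    obtain C where C: "C \<subseteq> K" "finite C" "K \<subseteq> (\<Union>p\<in>C. box (a p) (b p))"
      by (rule compactE_image[OF \<open>compact K\<close> _ cover]) auto
    have "(\<lambda>n. \<Sum>p\<in>C. mass n (cbox (a p) (b p))) \<longlonglongrightarrow> (\<Sum>p\<in>C. 0)"
      using C ab by (intro tendsto_sum) blast
    then have "\<forall>\<^sub>F n in sequentially. (\<Sum>p\<in>C. mass n (cbox (a p) (b p))) < e / 2"
      by (rule order_tendstoD) (use \<open>0 < e\<close> in simp)
    then obtain N where N: "\<And>n. n \<ge> N \<Longrightarrow> (\<Sum>p\<in>C. mass n (cbox (a p) (b p))) < e / 2"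
      by (auto simp: eventually_sequentially)
    have "norm (mass n S - 0) < e" if "n \<ge> N" for n
    proof -
      have SL: "S \<in> sets lebesgue" "K \<in> sets lebesgue"
        using S_lmeasurable K(1) by auto
      have int: "integrable (lebesgue_on S) (\<lambda>x. indicator R x * \<Theta> n x)" if "R \<in> sets lebesgue" for R
      proof (rule Bochner_Integration.integrable_bound[OF integrable_density[OF SL(1) order_refl, of n]])
        show "(\<lambda>x. indicator R x * \<Theta> n x) \<in> borel_measurable (lebesgue_on S)"
          by (rule borel_measurable_times[OF measurable_restrict_space1[OF borel_measurable_indicator[OF that]] \<Theta>_meas])
      qed (auto simp: indicator_def)
      have indSK: "integrable (lebesgue_on S) (indicat_real (S - K))"
        "(LINT x|lebesgue_on S. indicat_real (S - K) x) = measure lebesgue (S - K)"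
      proof -
        have eq: "(\<lambda>x. indicat_real S x *\<^sub>R indicat_real (S - K) x) = indicat_real (S - K)"
          by (auto simp: fun_eq_iff indicator_def)
        have fin: "S - K \<in> sets lebesgue" "emeasure lebesgue (S - K) < \<infinity>"
          using K(3) by (auto simp: fmeasurable_def)
        show "integrable (lebesgue_on S) (indicat_real (S - K))"
        proof (subst integrable_restrict_space)
          show "integrable lebesgue (\<lambda>x. indicat_real S x *\<^sub>R indicat_real (S - K) x)"
            unfolding eq by (rule integrable_real_indicator[OF fin])
        qed (use SL in simp)
        show "(LINT x|lebesgue_on S. indicat_real (S - K) x) = measure lebesgue (S - K)"
        proof (subst integral_restrict_space)
          show "(LINT x|lebesgue. indicat_real S x *\<^sub>R indicat_real (S - K) x) = measure lebesgue (S - K)"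
            unfolding eq using fin by simp
        qed (use SL in simp)
      qed
      have "mass n S \<le> (LINT x|lebesgue_on S. (\<Sum>p\<in>C. indicator (cbox (a p) (b p)) x * \<Theta> n x) + indicator (S - K) x)"
        unfolding mass_def
      proof (rule integral_mono)
        show "integrable (lebesgue_on S) (\<lambda>x. (\<Sum>p\<in>C. indicator (cbox (a p) (b p)) x * \<Theta> n x) + indicator (S - K) x)"
          by (intro Bochner_Integration.integrable_add Bochner_Integration.integrable_sum int indSK) auto
        fix x assume "x \<in> space (lebesgue_on S)"
        then have "x \<in> S" by (simp add: space_restrict_space)
        have nn: "0 \<le> (\<Sum>p\<in>C. indicator (cbox (a p) (b p)) x * \<Theta> n x)"
          using \<Theta>_range by (intro sum_nonneg) auto
        show "\<Theta> n x \<le> (\<Sum>p\<in>C. indicator (cbox (a p) (b p)) x * \<Theta> n x) + indicator (S - K) x"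
        proof (cases "x \<in> K")
          case True
          then obtain p where p: "p \<in> C" "x \<in> cbox (a p) (b p)"
            using C(3) box_subset_cbox by blast
          have "\<Theta> n x = indicator (cbox (a p) (b p)) x * \<Theta> n x"
            using p by simp
          also have "\<dots> \<le> (\<Sum>p\<in>C. indicator (cbox (a p) (b p)) x * \<Theta> n x)"
            using p C(2) \<Theta>_range by (intro member_le_sum) auto
          finally show ?thesis
            by (rule order_trans) (simp add: indicator_def)
        next
          case False
          then show ?thesis
            using \<open>x \<in> S\<close> nn \<Theta>_range(2)[of n x] by simp
        qed
      qed (intro integrable_density SL order_refl)
      also have "\<dots> = (\<Sum>p\<in>C. mass n (cbox (a p) (b p))) + measure lebesgue (S - K)"
      proof -
        have "(LINT x|lebesgue_on S. indicator (cbox (a p) (b p)) x * \<Theta> n x) = mass n (cbox (a p) (b p))" if "p \<in> C" for p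
        proof (rule mass_restrict[symmetric])
          have "p \<in> K"
            using that C(1) by blast
          then show "cbox (a p) (b p) \<subseteq> S"
            by (rule ab(2))
        qed (use SL in simp_all)
        moreover have "integrable (lebesgue_on S) (\<lambda>x. indicator (cbox (a p) (b p)) x * \<Theta> n x)" for p
          by (rule int) simp
        ultimately show ?thesis
          using indSK by (simp add: Bochner_Integration.integral_add Bochner_Integration.integral_sum)
      qed
      also have "\<dots> < e"
      proof -
        have "measure lebesgue (S - K) < e / 2"
          using K(4) unfolding emeasure_eq_measure2[OF K(3)] by (simp add: ennreal_less_iff)
        then show ?thesis
          using N[OF that] by linarith
      qed
      finally show ?thesis
        using mass_nonneg[of n S] by simp
    qed
    then show "\<exists>N. \<forall>n\<ge>N. norm (mass n S - 0) < e"
      by blast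
  qed
qed

end

lemma nn_integral_cbox_continuous:
  fixes k :: "real^3 \<Rightarrow> real"
  assumes "continuous_on UNIV k" "\<And>x. 0 \<le> k x"
  shows "ennreal (integral (cbox l u) k) = (\<integral>\<^sup>+x. ennreal (k x) \<partial>lebesgue_on (cbox l u))"
proof -
  have int: "integrable (lebesgue_on (cbox l u)) k"
    by (intro continuous_imp_integrable continuous_on_subset[OF assms(1)]) auto
  then show ?thesis
    using assms by (subst nn_integral_eq_integral) (auto simp: lebesgue_integral_eq_integral)
qed

lemma integrable_lebesgue_on_subset:
  fixes f :: "'a::euclidean_space \<Rightarrow> 'b::euclidean_space"
  assumes f: "integrable (lebesgue_on S) f" and T: "T \<in> sets lebesgue" "T \<subseteq> S" and S: "S \<in> sets lebesgue"
  shows "integrable (lebesgue_on T) f"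
proof -
  have "integrable lebesgue (\<lambda>x. indicator S x *\<^sub>R f x)"
    using f S by (subst (asm) integrable_restrict_space) auto
  then have "integrable lebesgue (\<lambda>x. indicator T x *\<^sub>R (indicator S x *\<^sub>R f x))"
    by (rule integrable_mult_indicator[OF T(1)])
  moreover have "(\<lambda>x. indicator T x *\<^sub>R (indicator S x *\<^sub>R f x)) = (\<lambda>x. indicator T x *\<^sub>R f x)"
    using T(2) by (auto simp: fun_eq_iff indicator_def)
  ultimately show ?thesis
    using T(1) by (subst integrable_restrict_space) auto
qed

text \<open>The smooth estimate is applied to mollifications of \<open>U\<close> and
  \<open>V\<close>. Their accuracy may depend on \<open>h\<close> and \<open>\<delta>\<close>,
  because these are fixed here; thus even coefficients with a factor \<open>1 / h\<close> in front
  of the smoothing errors are harmless.\<close>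

lemma film_separation:
  fixes S :: "(real^3) set" and U V :: "real^3 \<Rightarrow> real" and \<gamma> \<kappa> :: "3 \<Rightarrow> real^3 \<Rightarrow> real"
    and D :: "real^3 \<Rightarrow> real" and r \<rho> h a b \<delta> :: real and p :: "real^3"
  assumes S: "open S" and r: "0 < r" "4 * r \<le> 1" and \<rho>: "0 < \<rho>"
    and sub: "cbox (p - vec (2 * r) - vec \<rho>) (p + vec (2 * r) + vec \<rho>) \<subseteq> S"
    and h: "0 < h" "h \<le> r" and ab: "a \<noteq> 0" "b \<noteq> 0" and \<delta>: "0 < \<delta>"
    and weak: "\<And>j. has_weak_deriv S [j] U (\<gamma> j)" "\<And>j. has_weak_deriv S [j] V (\<kappa> j)"
    and L2: "\<And>j. integrable (lebesgue_on S) (\<lambda>x. (\<gamma> j x)\<^sup>2)" "\<And>j. integrable (lebesgue_on S) (\<lambda>x. (\<kappa> j x)\<^sup>2)"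
    and D: "D \<in> borel_measurable (lebesgue_on S)" "(\<integral>\<^sup>+x. ennreal ((D x)\<^sup>2) \<partial>lebesgue_on S) \<le> ennreal \<delta>"
    and near: "\<And>x. \<bar>(\<gamma> 1 x - 1) / a - (\<kappa> 3 x / h - 1) / b\<bar> \<le> D x" "\<And>x. \<bar>\<gamma> 3 x / (a * h)\<bar> \<le> D x"
      "\<And>x. \<bar>\<kappa> 1 x / b\<bar> \<le> D x" "\<And>x. \<bar>\<kappa> 2 x / b\<bar> \<le> D x"
      "\<And>x. min \<bar>(\<gamma> 1 x - 1) / a\<bar> \<bar>(\<gamma> 1 x - 1) / a - 1\<bar> \<le> D x"
  defines "\<Theta> \<equiv> \<lambda>x. transition ((\<gamma> 1 x - 1) / a)" and "B \<equiv> cbox (p - vec r) (p + vec r)"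
    and "c \<equiv> 6 / (4 * r)\<^sup>2"
  shows "(LINT x|lebesgue_on B. \<Theta> x) * (LINT x|lebesgue_on B. 1 - \<Theta> x)
    \<le> (1200 * c^3 + 1000 * c\<^sup>2) * (51 * \<delta> / h + sqrt (51 * \<delta>)) + 4 / \<bar>a\<bar> * \<delta>"
proof -
  let ?K = "cbox (p - vec (2 * r)) (p + vec (2 * r))"
  let ?K' = "cbox (p - vec (2 * r) - vec \<rho>) (p + vec (2 * r) + vec \<rho>)"
  have SL: "S \<in> sets lebesgue"
    using S by (simp add: borel_open)
  have KK': "?K \<subseteq> ?K'"
  proof
    fix w assume w: "w \<in> ?K"
    have "p$i - 2 * r - \<rho> \<le> w$i \<and> w$i \<le> p$i + 2 * r + \<rho>" for i
      using w \<rho> by (auto simp: mem_box_cart dest!: spec[of _ i])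
    then show "w \<in> ?K'"
      by (simp add: mem_box_cart)
  qed
  have BK: "B \<subseteq> ?K"
  proof
    fix w assume w: "w \<in> B"
    have "p$i - 2 * r \<le> w$i \<and> w$i \<le> p$i + 2 * r" for i
      using w r by (auto simp: B_def mem_box_cart dest!: spec[of _ i])
    then show "w \<in> ?K"
      by (simp add: mem_box_cart)
  qed
  \<comment> \<open>One number above all coefficients with which the smoothing errors enter:
    \<open>2 / \<bar>a\<bar>\<close>, \<open>1 / \<bar>b\<bar>\<close> and the same with
    \<open>1 / h\<close>.\<close>
  define M where "M = 2 * (1 / \<bar>a\<bar> + 1 / \<bar>b\<bar>) * (1 + 1 / h)"
  have M: "0 < M" "2 / \<bar>a\<bar> \<le> M" "1 / (\<bar>a\<bar> * h) \<le> M" "1 / \<bar>b\<bar> \<le> M" "1 / (\<bar>b\<bar> * h) \<le> M"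
  proof -
    have pos: "0 < 1 / \<bar>a\<bar>" "0 < 1 / \<bar>b\<bar>" "0 < 1 / (\<bar>a\<bar> * h)" "0 < 1 / (\<bar>b\<bar> * h)"
      using ab h by auto
    have "M = 2 / \<bar>a\<bar> + 2 / \<bar>b\<bar> + 2 * (1 / (\<bar>a\<bar> * h)) + 2 * (1 / (\<bar>b\<bar> * h))"
      using ab h by (simp add: M_def field_simps)
    then show "0 < M" "2 / \<bar>a\<bar> \<le> M" "1 / (\<bar>a\<bar> * h) \<le> M" "1 / \<bar>b\<bar> \<le> M" "1 / (\<bar>b\<bar> * h) \<le> M"
      using pos by linarith+
  qed
  \<comment> \<open>The first bound makes the five smoothing errors, weighted with
    \<open>10 * M\<^sup>2\<close>, add at most \<open>\<delta>\<close> to the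
    \<open>50 * \<delta>\<close> of the true distance, whence 51. The second one,
    \<open>sqrt \<tau> \<le> \<delta>\<close>, serves the comparison of the phase masses.\<close>
  define \<tau> where "\<tau> = min (\<delta> / (50 * M\<^sup>2)) (\<delta>\<^sup>2)"
  have \<tau>: "0 < \<tau>" "50 * M\<^sup>2 * \<tau> \<le> \<delta>" "sqrt \<tau> \<le> \<delta>"
  proof -
    show "0 < \<tau>"
      using \<delta> M by (simp add: \<tau>_def)
    have "50 * M\<^sup>2 * \<tau> \<le> 50 * M\<^sup>2 * (\<delta> / (50 * M\<^sup>2))"
      unfolding \<tau>_def by (intro mult_left_mono) auto
    then show "50 * M\<^sup>2 * \<tau> \<le> \<delta>"
      using M by simp
    have "sqrt \<tau> \<le> sqrt (\<delta>\<^sup>2)"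
      unfolding \<tau>_def by (intro real_sqrt_le_mono) simp
    then show "sqrt \<tau> \<le> \<delta>"
      using \<delta> by simp
  qed
  have L2K: "integrable (lebesgue_on ?K') (\<lambda>x. (\<gamma> j x)\<^sup>2)" "integrable (lebesgue_on ?K') (\<lambda>x. (\<kappa> j x)\<^sup>2)" for j
    by (rule integrable_lebesgue_on_subset[OF _ _ sub SL]; use L2 in simp)+
  obtain R k f where f: "smooth_kernel R k" "integrable lborel f"
    "\<And>j. (\<integral>\<^sup>+x\<in>?K. ennreal ((convolve (k(j := deriv (k j))) f x - \<gamma> j x)\<^sup>2) \<partial>lebesgue) \<le> ennreal \<tau>"
    using weak_deriv_smooth_approximation[OF S sub \<rho> weak(1) L2K(1) \<tau>(1)] by blast
  obtain R' l g where g: "smooth_kernel R' l" "integrable lborel g"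
    "\<And>j. (\<integral>\<^sup>+x\<in>?K. ennreal ((convolve (l(j := deriv (l j))) g x - \<kappa> j x)\<^sup>2) \<partial>lebesgue) \<le> ennreal \<tau>"
    using weak_deriv_smooth_approximation[OF S sub \<rho> weak(2) L2K(2) \<tau>(1)] by blast
  define k' l' where "k' j = k(j := deriv (k j))" and "l' j = l(j := deriv (l j))" for j
  \<comment> \<open>The two derivatives act on different factors of the kernel, so their order is
    irrelevant; this is the symmetry of the mixed derivative needed for \<open>g13\<close>.\<close>
  define l13 where "l13 = (l' 1)(3 := deriv (l' 1 3))"
  have l13: "l13 = (l' 3)(1 := deriv (l' 3 1))"
    by (simp add: l13_def l'_def fun_upd_twist)
  have ker: "smooth_kernel R (k' j)" "smooth_kernel R' (l' j)" for j
    unfolding k'_def l'_def by (intro kernel_deriv f(1) g(1))+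
  have ker13: "smooth_kernel R' l13"
    unfolding l13_def by (intro kernel_deriv ker)
  define p1 where "p1 v = (convolve (k' 1) f v - 1) / a" for v
  define p3 where "p3 v = convolve (k' 3) f v / a" for v
  define q1 where "q1 v = convolve (l' 1) g v / b" for v
  define q2 where "q2 v = convolve (l' 2) g v / b" for v
  define q3 where "q3 v = (convolve (l' 3) g v - h) / b" for v
  \<comment> \<open>The sum of all defects that \<open>cell_functions\<close> bounds: mismatch of
    the indicators, the three small derivatives, and the distance of the first indicator to 0 and
    1.\<close>
  define e where "e v = \<bar>p1 v - q3 v / h\<bar> + \<bar>p3 v\<bar> / h + \<bar>q1 v\<bar> + \<bar>q2 v\<bar> + min \<bar>p1 v\<bar> \<bar>p1 v - 1\<bar>" for v
  have cont: "continuous_on T p1" "continuous_on T p3" "continuous_on T q1" "continuous_on T q2" "continuous_on T q3" for T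
    unfolding p1_def p3_def q1_def q2_def q3_def
    using ab by (auto intro!: continuous_intros continuous_on_convolve ker f g)
  have cont_e: "continuous_on T e" for T
    unfolding e_def using h by (auto intro!: continuous_intros cont)
  have triple: "continuous_on UNIV (\<lambda>(x, y, z). q (vector [x, y, z]))" if "\<And>T. continuous_on T q" for q :: "real^3 \<Rightarrow> real"
    unfolding split_beta
    by (rule continuous_on_compose2[OF that[of UNIV]]) (auto intro!: continuous_on_vector3 continuous_intros)
  have cell: "cell_functions h (\<lambda>x y z. (convolve k f (vector [x, y, z]) - x) / a) (\<lambda>x y z. p1 (vector [x, y, z]))
    (\<lambda>x y z. p3 (vector [x, y, z])) (\<lambda>x y z. (convolve l g (vector [x, y, z]) - h * z) / b)
    (\<lambda>x y z. q1 (vector [x, y, z])) (\<lambda>x y z. q2 (vector [x, y, z])) (\<lambda>x y z. q3 (vector [x, y, z]))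
    (\<lambda>x y z. convolve l13 g (vector [x, y, z]) / b) (\<lambda>x y z. e (vector [x, y, z]))"
  proof (unfold_locales, goal_cases)
    case 1 show ?case by (rule h(1))
  next
    case 2
    show ?case
      using convolve_vector_cont[OF f(1,2)] ab unfolding split_beta by (intro continuous_intros) auto
  next
    case 5
    show ?case
      using convolve_vector_cont[OF g(1,2)] ab unfolding split_beta by (intro continuous_intros) auto
  next
    case 9
    show ?case
      using convolve_vector_cont[OF ker13 g(2)] ab unfolding split_beta by (intro continuous_intros) auto
  next
    case 10
    show ?case by (rule triple[OF cont_e])
  next
    case (11 x z y)
    show ?case
      unfolding p1_def k'_def
      by (rule DERIV_cdivide, rule DERIV_diff, rule convolve_vector_DERIV(1)[OF f(1,2)], rule DERIV_ident)
  next
    case (12 x y z)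
    show ?case
      using DERIV_cdivide[OF DERIV_diff[OF convolve_vector_DERIV(3)[OF f(1,2), of x y z] DERIV_const[of x]], of a]
      by (simp add: p3_def k'_def)
  next
    case (13 x y z)
    show ?case
      using DERIV_cdivide[OF DERIV_diff[OF convolve_vector_DERIV(2)[OF g(1,2), of x z y] DERIV_const[of "h * z"]], of b]
      by (simp add: q2_def l'_def)
  next
    case (14 x y z)
    show ?case
      using DERIV_cdivide[OF DERIV_diff[OF convolve_vector_DERIV(3)[OF g(1,2), of x y z] DERIV_cmult[OF DERIV_ident, of h]], of b]
      by (simp add: q3_def l'_def)
  next
    case (15 x y z)
    show ?case
      using DERIV_cdivide[OF DERIV_diff[OF convolve_vector_DERIV(1)[OF ker(2)[of 3] g(2), of y z x] DERIV_const[of h]], of b]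
      by (simp add: q3_def l13)
  next
    case (16 x y z)
    show ?case
      using DERIV_cdivide[OF convolve_vector_DERIV(3)[OF ker(2)[of 1] g(2), of x y z], of b]
      by (simp add: q1_def l13_def)
  next
    case (19 x y z)
    show ?case
      using h by (simp add: e_def pos_le_divide_eq[symmetric] field_simps)
  next
    case (22 x y z)
    have "min \<bar>p1 (vector [x, y, z])\<bar> \<bar>p1 (vector [x, y, z]) - 1\<bar> \<le> e (vector [x, y, z])"
      using h by (simp add: e_def)
    moreover have "0 \<le> min \<bar>p1 (vector [x, y, z])\<bar> \<bar>p1 (vector [x, y, z]) - 1\<bar>"
      by simp
    ultimately show ?case
      using min_dist_two_wells(1)[of "p1 (vector [x, y, z])"] power_mono[of "min \<bar>p1 (vector [x, y, z])\<bar> \<bar>p1 (vector [x, y, z]) - 1\<bar>" _ 2]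
      by (smt (verit))
  next
    case (23 x y z)
    have "min \<bar>p1 (vector [x, y, z])\<bar> \<bar>p1 (vector [x, y, z]) - 1\<bar> \<le> e (vector [x, y, z])"
      using h by (simp add: e_def)
    then show ?case
      using min_dist_two_wells(2)[of "p1 (vector [x, y, z])"] by linarith
  qed (use h in \<open>auto intro!: triple cont cont_e simp: e_def\<close>)
  define E where "E = integral ?K (\<lambda>v. (e v)\<^sup>2)"
  have vec3: "vector [v$1, v$2, v$3] = v" for v :: "real^3"
    by (simp add: vec_eq_iff forall_3)
  have sep: "integral B (\<lambda>v. transition (p1 v)) * integral B (\<lambda>v. 1 - transition (p1 v))
    \<le> (1200 * c^3 + 1000 * c\<^sup>2) * (E / h + sqrt E)"
    using cell_separation[OF r h(2) cell, of p] unfolding vec3 B_def c_def E_def .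
  let ?LK = "lebesgue_on ?K"
  define \<alpha>1 \<alpha>3 \<beta>1 \<beta>2 \<beta>3 where "\<alpha>1 v = convolve (k' 1) f v - \<gamma> 1 v" and "\<alpha>3 v = convolve (k' 3) f v - \<gamma> 3 v"
    and "\<beta>1 v = convolve (l' 1) g v - \<kappa> 1 v" and "\<beta>2 v = convolve (l' 2) g v - \<kappa> 2 v"
    and "\<beta>3 v = convolve (l' 3) g v - \<kappa> 3 v" for v
  have loc: "integrable ?LK (\<gamma> j)" "integrable ?LK (\<kappa> j)" for j
    using weak[of j] KK' sub compact_cbox[of "p - vec (2 * r)" "p + vec (2 * r)"]
    unfolding has_weak_deriv_def locally_integrable_on_def by (meson order_trans)+
  have meas: "\<alpha>1 \<in> borel_measurable ?LK" "\<alpha>3 \<in> borel_measurable ?LK" "\<beta>1 \<in> borel_measurable ?LK"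
    "\<beta>2 \<in> borel_measurable ?LK" "\<beta>3 \<in> borel_measurable ?LK"
    unfolding \<alpha>1_def[abs_def] \<alpha>3_def[abs_def] \<beta>1_def[abs_def] \<beta>2_def[abs_def] \<beta>3_def[abs_def]
    by (intro borel_measurable_diff borel_measurable_integrable[OF loc(1)] borel_measurable_integrable[OF loc(2)]
        continuous_imp_measurable_on_sets_lebesgue continuous_on_convolve[OF ker(1) f(2)]
        continuous_on_convolve[OF ker(2) g(2)]; simp)+
  have DK: "D \<in> borel_measurable ?LK"
    by (rule measurable_restrict_mono[OF D(1)]) (use KK' sub in blast)
  have err: "(\<integral>\<^sup>+v. ennreal ((\<alpha>1 v)\<^sup>2) \<partial>?LK) \<le> ennreal \<tau>" "(\<integral>\<^sup>+v. ennreal ((\<alpha>3 v)\<^sup>2) \<partial>?LK) \<le> ennreal \<tau>"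
    "(\<integral>\<^sup>+v. ennreal ((\<beta>1 v)\<^sup>2) \<partial>?LK) \<le> ennreal \<tau>" "(\<integral>\<^sup>+v. ennreal ((\<beta>2 v)\<^sup>2) \<partial>?LK) \<le> ennreal \<tau>"
    "(\<integral>\<^sup>+v. ennreal ((\<beta>3 v)\<^sup>2) \<partial>?LK) \<le> ennreal \<tau>"
    using f(3) g(3) by (simp_all add: nn_integral_restrict_space \<alpha>1_def \<alpha>3_def \<beta>1_def \<beta>2_def \<beta>3_def k'_def l'_def)
  have D2: "(\<integral>\<^sup>+v. ennreal ((D v)\<^sup>2) \<partial>?LK) \<le> ennreal \<delta>"
  proof -
    have "(\<integral>\<^sup>+v. ennreal ((D v)\<^sup>2) \<partial>?LK) \<le> (\<integral>\<^sup>+v. ennreal ((D v)\<^sup>2) \<partial>lebesgue_on S)"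
      using KK' sub SL by (simp add: nn_integral_restrict_space) (intro nn_integral_mono, auto simp: indicator_def)
    from this D(2) show ?thesis by (rule order_trans)
  qed
  have e_bound: "(e v)\<^sup>2 \<le> 50 * (D v)\<^sup>2 + 10 * M\<^sup>2 * ((\<alpha>1 v)\<^sup>2 + (\<alpha>3 v)\<^sup>2 + (\<beta>1 v)\<^sup>2 + (\<beta>2 v)\<^sup>2 + (\<beta>3 v)\<^sup>2)" for v
  proof -
    define P Q where "P = (\<gamma> 1 v - 1) / a" and "Q = (\<kappa> 3 v / h - 1) / b"
    have eqs: "p1 v = P + \<alpha>1 v / a" "p3 v / h = \<gamma> 3 v / (a * h) + \<alpha>3 v / (a * h)" "q1 v = \<kappa> 1 v / b + \<beta>1 v / b"
      "q2 v = \<kappa> 2 v / b + \<beta>2 v / b" "q3 v / h = Q + \<beta>3 v / (b * h)"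
      using ab h by (simp_all add: p1_def p3_def q1_def q2_def q3_def P_def Q_def \<alpha>1_def \<alpha>3_def \<beta>1_def \<beta>2_def \<beta>3_def field_simps)
    have A: "2 * \<bar>\<alpha>1 v / a\<bar> \<le> M * \<bar>\<alpha>1 v\<bar>" "\<bar>\<alpha>3 v / (a * h)\<bar> \<le> M * \<bar>\<alpha>3 v\<bar>" "\<bar>\<beta>1 v / b\<bar> \<le> M * \<bar>\<beta>1 v\<bar>"
      "\<bar>\<beta>2 v / b\<bar> \<le> M * \<bar>\<beta>2 v\<bar>" "\<bar>\<beta>3 v / (b * h)\<bar> \<le> M * \<bar>\<beta>3 v\<bar>"
    proof -
      have scale: "\<bar>x / d\<bar> \<le> M * \<bar>x\<bar>" if "1 / \<bar>d\<bar> \<le> M" for x d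
        using mult_right_mono[OF that, of "\<bar>x\<bar>"] by simp
      have "(2 / \<bar>a\<bar>) * \<bar>\<alpha>1 v\<bar> \<le> M * \<bar>\<alpha>1 v\<bar>"
        using M(2) by (rule mult_right_mono) simp
      then show "2 * \<bar>\<alpha>1 v / a\<bar> \<le> M * \<bar>\<alpha>1 v\<bar>"
        by simp
      have "1 / \<bar>a * h\<bar> \<le> M" "1 / \<bar>b * h\<bar> \<le> M"
        using M(3,5) h(1) by (simp_all add: abs_mult)
      from scale[OF this(1)] scale[OF this(2)]
      show "\<bar>\<alpha>3 v / (a * h)\<bar> \<le> M * \<bar>\<alpha>3 v\<bar>" "\<bar>\<beta>3 v / (b * h)\<bar> \<le> M * \<bar>\<beta>3 v\<bar>"
        by blast+
      show "\<bar>\<beta>1 v / b\<bar> \<le> M * \<bar>\<beta>1 v\<bar>" "\<bar>\<beta>2 v / b\<bar> \<le> M * \<bar>\<beta>2 v\<bar>"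
        by (rule scale[OF M(4)])+
    qed
    have N: "\<bar>P - Q\<bar> \<le> D v" "\<bar>\<gamma> 3 v / (a * h)\<bar> \<le> D v" "\<bar>\<kappa> 1 v / b\<bar> \<le> D v" "\<bar>\<kappa> 2 v / b\<bar> \<le> D v" "min \<bar>P\<bar> \<bar>P - 1\<bar> \<le> D v"
      unfolding P_def Q_def by (rule near)+
    have t1: "\<bar>p1 v - q3 v / h\<bar> \<le> D v + \<bar>\<alpha>1 v / a\<bar> + \<bar>\<beta>3 v / (b * h)\<bar>"
      using N(1) unfolding eqs by linarith
    have "\<bar>p3 v\<bar> / h = \<bar>p3 v / h\<bar>"
      using h by simp
    then have t2: "\<bar>p3 v\<bar> / h \<le> D v + \<bar>\<alpha>3 v / (a * h)\<bar>"
      using N(2) abs_triangle_ineq[of "\<gamma> 3 v / (a * h)" "\<alpha>3 v / (a * h)"] unfolding eqs by linarith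
    have t3: "\<bar>q1 v\<bar> \<le> D v + \<bar>\<beta>1 v / b\<bar>" "\<bar>q2 v\<bar> \<le> D v + \<bar>\<beta>2 v / b\<bar>"
      using N(3,4) abs_triangle_ineq[of "\<kappa> 1 v / b" "\<beta>1 v / b"] abs_triangle_ineq[of "\<kappa> 2 v / b" "\<beta>2 v / b"]
      unfolding eqs by linarith+
    have t5: "min \<bar>p1 v\<bar> \<bar>p1 v - 1\<bar> \<le> D v + \<bar>\<alpha>1 v / a\<bar>"
      using N(5) min_dist_two_wells(3)[of "p1 v" P] unfolding eqs by simp
    \<comment> \<open>Each of the five summands of \<open>e\<close> contributes one
      \<open>D v\<close>. The error \<open>\<alpha>1\<close> counts twice, in the mismatch of the
      indicators and in the distance to the phases.\<close>
    have "e v \<le> 5 * D v + (2 * \<bar>\<alpha>1 v / a\<bar> + \<bar>\<alpha>3 v / (a * h)\<bar> + \<bar>\<beta>1 v / b\<bar> + \<bar>\<beta>2 v / b\<bar> + \<bar>\<beta>3 v / (b * h)\<bar>)"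
      unfolding e_def using t1 t2 t3 t5 by linarith
    also have "\<dots> \<le> 5 * D v + M * (\<bar>\<alpha>1 v\<bar> + \<bar>\<alpha>3 v\<bar> + \<bar>\<beta>1 v\<bar> + \<bar>\<beta>2 v\<bar> + \<bar>\<beta>3 v\<bar>)"
      unfolding distrib_left using A by linarith
    finally have "e v \<le> 5 * D v + M * (\<bar>\<alpha>1 v\<bar> + \<bar>\<alpha>3 v\<bar> + \<bar>\<beta>1 v\<bar> + \<bar>\<beta>2 v\<bar> + \<bar>\<beta>3 v\<bar>)" .
    moreover have "0 \<le> e v"
      using h by (simp add: e_def)
    ultimately have "(e v)\<^sup>2 \<le> (5 * D v + M * (\<bar>\<alpha>1 v\<bar> + \<bar>\<alpha>3 v\<bar> + \<bar>\<beta>1 v\<bar> + \<bar>\<beta>2 v\<bar> + \<bar>\<beta>3 v\<bar>))\<^sup>2"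
      by (rule power_mono)
    also have "\<dots> \<le> 50 * (D v)\<^sup>2 + 10 * M\<^sup>2 * (\<bar>\<alpha>1 v\<bar>\<^sup>2 + \<bar>\<alpha>3 v\<bar>\<^sup>2 + \<bar>\<beta>1 v\<bar>\<^sup>2 + \<bar>\<beta>2 v\<bar>\<^sup>2 + \<bar>\<beta>3 v\<bar>\<^sup>2)"
      by (rule sum5_square_le)
    finally show ?thesis by simp
  qed
  have E0: "0 \<le> E"
    unfolding E_def by (intro integral_nonneg integrable_continuous continuous_intros cont_e) auto
  have "E \<le> 51 * \<delta>"
  proof -
    have "ennreal E = (\<integral>\<^sup>+v. ennreal ((e v)\<^sup>2) \<partial>?LK)"
      unfolding E_def by (intro nn_integral_cbox_continuous continuous_intros cont_e) auto
    also have "\<dots> \<le> (\<integral>\<^sup>+v. ennreal 50 * ennreal ((D v)\<^sup>2) + ennreal (10 * M\<^sup>2) * (ennreal ((\<alpha>1 v)\<^sup>2) + ennreal ((\<alpha>3 v)\<^sup>2)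
        + ennreal ((\<beta>1 v)\<^sup>2) + ennreal ((\<beta>2 v)\<^sup>2) + ennreal ((\<beta>3 v)\<^sup>2)) \<partial>?LK)"
    proof (rule nn_integral_mono)
      fix v
      show "ennreal ((e v)\<^sup>2) \<le> ennreal 50 * ennreal ((D v)\<^sup>2) + ennreal (10 * M\<^sup>2) * (ennreal ((\<alpha>1 v)\<^sup>2) + ennreal ((\<alpha>3 v)\<^sup>2)
        + ennreal ((\<beta>1 v)\<^sup>2) + ennreal ((\<beta>2 v)\<^sup>2) + ennreal ((\<beta>3 v)\<^sup>2))"
        using ennreal_leI[OF e_bound[of v]]
        by (simp add: ennreal_mult[symmetric] ennreal_plus[symmetric] del: ennreal_plus ennreal_numeral)
    qed
    also have "\<dots> = ennreal 50 * (\<integral>\<^sup>+v. ennreal ((D v)\<^sup>2) \<partial>?LK) + ennreal (10 * M\<^sup>2) * ((\<integral>\<^sup>+v. ennreal ((\<alpha>1 v)\<^sup>2) \<partial>?LK)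
        + (\<integral>\<^sup>+v. ennreal ((\<alpha>3 v)\<^sup>2) \<partial>?LK) + (\<integral>\<^sup>+v. ennreal ((\<beta>1 v)\<^sup>2) \<partial>?LK)
        + (\<integral>\<^sup>+v. ennreal ((\<beta>2 v)\<^sup>2) \<partial>?LK) + (\<integral>\<^sup>+v. ennreal ((\<beta>3 v)\<^sup>2) \<partial>?LK))"
      using meas DK by (simp add: nn_integral_add nn_integral_cmult)
    also have "\<dots> \<le> ennreal 50 * ennreal \<delta> + ennreal (10 * M\<^sup>2) * (ennreal \<tau> + ennreal \<tau> + ennreal \<tau> + ennreal \<tau> + ennreal \<tau>)"
      by (intro add_mono mult_left_mono D2 err) auto
    also have "\<dots> = ennreal (50 * \<delta> + 10 * M\<^sup>2 * (5 * \<tau>))"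
      using \<delta> \<tau> by (simp add: ennreal_mult[symmetric] ennreal_plus[symmetric] del: ennreal_plus ennreal_numeral)
    also have "\<dots> \<le> ennreal (51 * \<delta>)"
      using \<tau>(2) by (intro ennreal_leI) linarith
    finally show ?thesis
      using \<delta> by simp
  qed
  have B: "B \<in> lmeasurable" "B \<in> sets lebesgue" "measure lebesgue B \<le> 1"
  proof -
    have "(2 * r)^3 \<le> 1"
      using r by (intro power_le_one) auto
    then show "B \<in> lmeasurable" "B \<in> sets lebesgue" "measure lebesgue B \<le> 1"
      using content_cube3[of r p] r by (simp_all add: B_def)
  qed
  let ?LB = "lebesgue_on B"
  have \<alpha>int: "integrable ?LB (\<lambda>v. (\<alpha>1 v)\<^sup>2)" "(LINT v|?LB. (\<alpha>1 v)\<^sup>2) \<le> \<tau>"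
  proof -
    have "(\<integral>\<^sup>+v. ennreal ((\<alpha>1 v)\<^sup>2) \<partial>?LB) \<le> (\<integral>\<^sup>+v. ennreal ((\<alpha>1 v)\<^sup>2) \<partial>?LK)"
      using BK B(2) by (simp add: nn_integral_restrict_space) (intro nn_integral_mono, auto simp: indicator_def)
    with err(1) have *: "(\<integral>\<^sup>+v. ennreal ((\<alpha>1 v)\<^sup>2) \<partial>?LB) \<le> ennreal \<tau>"
      by (meson order_trans)
    have **: "(\<lambda>v. (\<alpha>1 v)\<^sup>2) \<in> borel_measurable ?LB"
      using measurable_restrict_mono[OF meas(1) BK] by (rule borel_measurable_power)
    show "integrable ?LB (\<lambda>v. (\<alpha>1 v)\<^sup>2)" "(LINT v|?LB. (\<alpha>1 v)\<^sup>2) \<le> \<tau>"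
      using nn_integral_bounds_imp_integral[OF ** _ *] \<tau>(1) by auto
  qed
  have \<Theta>meas: "\<Theta> \<in> borel_measurable ?LB"
  proof -
    have \<gamma>1: "\<gamma> 1 \<in> borel_measurable ?LB"
      using measurable_restrict_mono[OF borel_measurable_integrable[OF loc(1)] BK] .
    have "(\<lambda>x. (\<gamma> 1 x - 1) / a) \<in> borel_measurable ?LB"
      by (intro borel_measurable_divide borel_measurable_diff borel_measurable_const \<gamma>1)
    moreover have "transition \<in> borel_measurable borel"
      by (intro borel_measurable_continuous_onI continuous_on_transition continuous_on_id)
    ultimately show ?thesis
      unfolding \<Theta>_def by (rule measurable_compose)
  qed
  have \<Theta>int: "integrable ?LB \<Theta>"
    by (rule Bochner_Integration.integrable_bound[OF integrable_const_lebesgue_on(1)[OF B(1), of 1] \<Theta>meas])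
      (use transition_bounds in \<open>auto simp: \<Theta>_def\<close>)
  define \<Phi> where "\<Phi> v = transition (p1 v)" for v
  have cont\<Phi>: "continuous_on T \<Phi>" for T
    unfolding \<Phi>_def by (intro continuous_intros cont)
  have \<Phi>int: "integrable ?LB \<Phi>"
    unfolding B_def by (intro continuous_imp_integrable cont\<Phi>)
  have one: "integrable ?LB (\<lambda>x. 1 :: real)" "(LINT x|?LB. (1 :: real)) = measure lebesgue B"
    using integrable_const_lebesgue_on[OF B(1), of 1] by simp_all
  have unit: "0 \<le> (LINT v|?LB. \<phi> v)" "(LINT v|?LB. \<phi> v) \<le> 1" "0 \<le> (LINT v|?LB. 1 - \<phi> v)" "(LINT v|?LB. 1 - \<phi> v) \<le> 1"
    if "integrable ?LB \<phi>" "\<And>v. 0 \<le> \<phi> v" "\<And>v. \<phi> v \<le> 1" for \<phi> :: "real^3 \<Rightarrow> real"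
  proof -
    show nn: "0 \<le> (LINT v|?LB. \<phi> v)" "0 \<le> (LINT v|?LB. 1 - \<phi> v)"
      by (intro Bochner_Integration.integral_nonneg; simp add: that)+
    have "(LINT v|?LB. 1 - \<phi> v) = measure lebesgue B - (LINT v|?LB. \<phi> v)"
      using one that by simp
    then show "(LINT v|?LB. \<phi> v) \<le> 1" "(LINT v|?LB. 1 - \<phi> v) \<le> 1"
      using nn B(3) by linarith+
  qed
  have diff: "\<bar>(LINT v|?LB. \<Phi> v) - (LINT v|?LB. \<Theta> v)\<bar> \<le> 2 / \<bar>a\<bar> * \<delta>"
  proof -
    \<comment> \<open>Only the square of \<open>\<alpha>1\<close> is controlled, so the inequality
      \<open>2 * \<bar>\<alpha>1 v\<bar> \<le> t + (1 / t) * (\<alpha>1 v)\<^sup>2\<close> is used;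
      at \<open>t = sqrt \<tau>\<close> both parts integrate to at most \<open>t\<close>.\<close>
    define t where "t = sqrt \<tau>"
    have t: "0 < t" "t\<^sup>2 = \<tau>"
      using \<tau>(1) by (simp_all add: t_def)
    have pt: "\<bar>\<Phi> v - \<Theta> v\<bar> \<le> (1 / \<bar>a\<bar>) * (t + (1 / t) * (\<alpha>1 v)\<^sup>2)" for v
    proof -
      have "p1 v - (\<gamma> 1 v - 1) / a = \<alpha>1 v / a"
        by (simp add: p1_def \<alpha>1_def diff_divide_distrib)
      then have "\<bar>\<Phi> v - \<Theta> v\<bar> \<le> 2 * \<bar>\<alpha>1 v / a\<bar>"
        using transition_lipschitz[of "p1 v" "(\<gamma> 1 v - 1) / a"] by (simp add: \<Phi>_def \<Theta>_def)
      also have "\<dots> = (1 / \<bar>a\<bar>) * (2 * \<bar>\<alpha>1 v\<bar>)"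
        by simp
      also have "\<dots> \<le> (1 / \<bar>a\<bar>) * (t + (1 / t) * (\<alpha>1 v)\<^sup>2)"
      proof (rule mult_left_mono)
        have "2 * \<bar>\<alpha>1 v\<bar> * t \<le> t\<^sup>2 + (\<alpha>1 v)\<^sup>2"
          using sum_squares_bound[of "\<bar>\<alpha>1 v\<bar>" t] by simp
        then have "2 * \<bar>\<alpha>1 v\<bar> \<le> (t\<^sup>2 + (\<alpha>1 v)\<^sup>2) / t"
          using t(1) by (simp add: pos_le_divide_eq)
        also have "\<dots> = t + (1 / t) * (\<alpha>1 v)\<^sup>2"
          using t(1) by (simp add: field_simps power2_eq_square)
        finally show "2 * \<bar>\<alpha>1 v\<bar> \<le> t + (1 / t) * (\<alpha>1 v)\<^sup>2" .
      qed simp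
      finally show ?thesis .
    qed
    have bint: "integrable ?LB (\<lambda>v. (1 / \<bar>a\<bar>) * (t + (1 / t) * (\<alpha>1 v)\<^sup>2))"
      by (intro integrable_mult_right Bochner_Integration.integrable_add integrable_const_lebesgue_on B \<alpha>int)
    have "\<bar>(LINT v|?LB. \<Phi> v) - (LINT v|?LB. \<Theta> v)\<bar> = \<bar>LINT v|?LB. \<Phi> v - \<Theta> v\<bar>"
      using \<Phi>int \<Theta>int by simp
    also have "\<dots> \<le> (LINT v|?LB. (1 / \<bar>a\<bar>) * (t + (1 / t) * (\<alpha>1 v)\<^sup>2))"
      using \<Phi>int \<Theta>int bint pt by (intro integral_abs_bound_integral) auto
    also have "\<dots> = (1 / \<bar>a\<bar>) * (t * measure lebesgue B + (1 / t) * (LINT v|?LB. (\<alpha>1 v)\<^sup>2))"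
      using \<alpha>int(1) integrable_const_lebesgue_on[OF B(1), of t]
      by (simp del: times_divide_eq_left times_divide_eq_right)
    also have "\<dots> \<le> (1 / \<bar>a\<bar>) * (t * 1 + (1 / t) * \<tau>)"
      using t \<alpha>int(2) B(3) by (intro mult_left_mono add_mono) auto
    also have "\<dots> = 2 / \<bar>a\<bar> * t"
      using t by (simp add: power2_eq_square flip: t(2))
    also have "\<dots> \<le> 2 / \<bar>a\<bar> * \<delta>"
      using \<tau>(3) by (intro mult_left_mono) (auto simp: t_def)
    finally show ?thesis .
  qed
  have N: "(LINT v|?LB. \<Phi> v) * (LINT v|?LB. 1 - \<Phi> v) \<le> (1200 * c^3 + 1000 * c\<^sup>2) * (51 * \<delta> / h + sqrt (51 * \<delta>))"
  proof -
    have "(LINT v|?LB. \<Phi> v) * (LINT v|?LB. 1 - \<Phi> v) \<le> (1200 * c^3 + 1000 * c\<^sup>2) * (E / h + sqrt E)"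
      using sep unfolding lebesgue_integral_eq_integral[OF \<Phi>int B(2)]
        lebesgue_integral_eq_integral[OF Bochner_Integration.integrable_diff[OF one(1) \<Phi>int] B(2)]
      by (simp add: \<Phi>_def[abs_def])
    also have "\<dots> \<le> (1200 * c^3 + 1000 * c\<^sup>2) * (51 * \<delta> / h + sqrt (51 * \<delta>))"
      using \<open>E \<le> 51 * \<delta>\<close> h r by (intro mult_left_mono add_mono divide_right_mono real_sqrt_le_mono) (auto simp: c_def)
    finally show ?thesis .
  qed
  have u\<Theta>: "0 \<le> \<Theta> v" "\<Theta> v \<le> 1" and u\<Phi>: "0 \<le> \<Phi> v" "\<Phi> v \<le> 1" for v
    by (simp_all add: \<Theta>_def \<Phi>_def transition_bounds)
  define x y x' y' where "x = (LINT v|?LB. \<Theta> v)" and "y = (LINT v|?LB. 1 - \<Theta> v)"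
    and "x' = (LINT v|?LB. \<Phi> v)" and "y' = (LINT v|?LB. 1 - \<Phi> v)"
  have xy: "0 \<le> y" "y \<le> 1" "0 \<le> x'" "x' \<le> 1"
    using unit[OF \<Theta>int u\<Theta>] unit[OF \<Phi>int u\<Phi>] by (simp_all add: x_def y_def x'_def y'_def)
  \<comment> \<open>The two phase masses sum to the measure of \<open>B\<close>, so replacing the
    density changes both by the same amount with opposite signs.\<close>
  have "y - y' = x' - x"
    using \<Theta>int \<Phi>int one by (simp add: x_def y_def x'_def y'_def)
  then have "x * y = x' * y' + x' * (x' - x) - (x' - x) * y"
    by algebra
  also have "\<dots> \<le> x' * y' + 1 * \<bar>x' - x\<bar> + \<bar>x' - x\<bar> * 1"
  proof -
    have "x' * (x' - x) \<le> \<bar>x'\<bar> * \<bar>x' - x\<bar>"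
      by (metis abs_ge_self abs_mult)
    also have "\<dots> \<le> 1 * \<bar>x' - x\<bar>"
      using xy by (intro mult_right_mono) auto
    finally have "x' * (x' - x) \<le> 1 * \<bar>x' - x\<bar>" .
    moreover have "- ((x' - x) * y) \<le> \<bar>x' - x\<bar> * 1"
    proof -
      have "- ((x' - x) * y) \<le> \<bar>x' - x\<bar> * \<bar>y\<bar>"
        by (metis abs_ge_minus_self abs_mult)
      also have "\<dots> \<le> \<bar>x' - x\<bar> * 1"
        using xy by (intro mult_left_mono) auto
      finally show ?thesis .
    qed
    ultimately show ?thesis
      by linarith
  qed
  also have "\<dots> \<le> (1200 * c^3 + 1000 * c\<^sup>2) * (51 * \<delta> / h + sqrt (51 * \<delta>)) + 4 / \<bar>a\<bar> * \<delta>"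
  proof -
    have sum: "2 / \<bar>a\<bar> * \<delta> + 2 / \<bar>a\<bar> * \<delta> = 4 / \<bar>a\<bar> * \<delta>"
      by simp
    have "\<bar>x' - x\<bar> \<le> 2 / \<bar>a\<bar> * \<delta>"
      using diff by (simp only: x_def x'_def)
    then have "x' * y' + 1 * \<bar>x' - x\<bar> + \<bar>x' - x\<bar> * 1
        \<le> (1200 * c^3 + 1000 * c\<^sup>2) * (51 * \<delta> / h + sqrt (51 * \<delta>)) + 2 / \<bar>a\<bar> * \<delta> + 2 / \<bar>a\<bar> * \<delta>"
      using N by (intro add_mono) (simp_all only: x'_def y'_def mult_1_left mult_1_right)
    then show ?thesis
      by (simp only: add.assoc sum)
  qed
  finally show ?thesis
    by (simp add: x_def y_def)
qed

section \<open>Thin films\<close>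

text \<open>Three regimes: close to the wells the quadratic lower bound holds, far away the growth
  condition dominates, and on the compact set in between \<open>W\<close> has a positive
  minimum.\<close>

lemma energy_density_lower_bound:
  fixes W :: "'a::euclidean_space \<Rightarrow> real" and A B :: 'a
  assumes cont: "continuous_on UNIV W" and nonneg: "\<forall>\<xi>. W \<xi> \<ge> 0" and wells: "{\<xi>. W \<xi> = 0} = {A, B}"
    and growth: "\<exists>C\<^sub>1>0. \<forall>\<xi>. 1 / C\<^sub>1 * (norm \<xi>)\<^sup>2 - C\<^sub>1 \<le> W \<xi> \<and> W \<xi> \<le> C\<^sub>1 * (norm \<xi>)\<^sup>2 + C\<^sub>1"
    and near_wells: "\<exists>\<rho>>0. \<exists>C\<^sub>2>0. \<forall>\<xi>. infdist \<xi> {A, B} \<le> \<rho> \<longrightarrow>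
        1 / C\<^sub>2 * (infdist \<xi> {A, B})\<^sup>2 \<le> W \<xi> \<and> W \<xi> \<le> C\<^sub>2 * (infdist \<xi> {A, B})\<^sup>2"
  obtains C where "C > 0" "\<And>\<xi>. (infdist \<xi> {A, B})\<^sup>2 \<le> C * W \<xi>"
proof -
  obtain C1 where C1: "C1 > 0" "\<And>\<xi>. (norm \<xi>)\<^sup>2 / C1 - C1 \<le> W \<xi>"
    using growth by auto
  obtain \<rho> C2 where \<rho>: "\<rho> > 0" "C2 > 0" "\<And>\<xi>. infdist \<xi> {A, B} \<le> \<rho> \<Longrightarrow> (infdist \<xi> {A, B})\<^sup>2 / C2 \<le> W \<xi>"
    using near_wells by auto
  \<comment> \<open>Beyond this radius \<open>(norm \<xi>)\<^sup>2 / C1\<close> is at least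
    \<open>2 * C1\<close>, so the subtracted \<open>C1\<close> costs at most half of it and
    \<open>W\<close> is at least \<open>C1\<close>.\<close>
  define R where "R = sqrt (2 * C1\<^sup>2)"
  have R: "R \<ge> 0" "R\<^sup>2 = 2 * C1\<^sup>2"
    by (simp_all add: R_def)
  define K where "K = {\<xi> \<in> cball 0 R. \<rho> \<le> infdist \<xi> {A, B}}"
  have "closed {\<xi>. \<rho> \<le> infdist \<xi> {A, B}}"
    by (intro closed_Collect_le continuous_intros)
  moreover have "K = cball 0 R \<inter> {\<xi>. \<rho> \<le> infdist \<xi> {A, B}}"
    by (auto simp: K_def)
  ultimately have K: "compact K"
    by (simp only: compact_Int_closed[OF compact_cball])
  have "\<exists>m>0. \<forall>\<xi>\<in>K. m \<le> W \<xi>"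
  proof (cases "K = {}")
    case False
    obtain \<xi>0 where \<xi>0: "\<xi>0 \<in> K" "\<And>\<xi>. \<xi> \<in> K \<Longrightarrow> W \<xi>0 \<le> W \<xi>"
      using continuous_attains_inf[OF K False continuous_on_subset[OF cont]] by blast
    have "infdist \<xi>0 {A, B} \<noteq> 0"
      using \<xi>0(1) \<rho>(1) by (auto simp: K_def)
    then have "\<xi>0 \<notin> {A, B}"
      by auto
    then have "W \<xi>0 > 0"
      using wells nonneg by (metis (mono_tags, lifting) mem_Collect_eq order_le_less)
    then show ?thesis
      using \<xi>0(2) by blast
  qed (auto intro: exI[of _ 1])
  then obtain m where m: "m > 0" "\<And>\<xi>. \<xi> \<in> K \<Longrightarrow> m \<le> W \<xi>"
    by blast
  \<comment> \<open>\<open>X2\<close> compares the largest distance on the ball with the minimum of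
    \<open>W\<close> on \<open>K\<close>. In \<open>X1\<close> the first term pays for
    \<open>2 * (norm \<xi>)\<^sup>2\<close> and the second for \<open>2 * (norm A)\<^sup>2\<close>,
    as \<open>W\<close> is at least \<open>C1\<close> far out.\<close>
  define X1 X2 where "X1 = 4 * C1 + 2 * (norm A)\<^sup>2 / C1" and "X2 = (R + norm A)\<^sup>2 / m"
  have X: "0 \<le> X1" "0 \<le> X2"
    using C1 m by (simp_all add: X1_def X2_def)
  have upper: "infdist \<xi> {A, B} \<le> norm \<xi> + norm A" for \<xi>
    using infdist_le[of A "{A, B}" \<xi>] norm_triangle_ineq4[of \<xi> A] by (simp add: dist_norm)
  have "(infdist \<xi> {A, B})\<^sup>2 \<le> (X1 + X2 + C2) * W \<xi>" for \<xi>
  proof -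
    let ?d = "infdist \<xi> {A, B}"
    have W: "0 \<le> W \<xi>"
      using nonneg by blast
    consider "?d \<le> \<rho>" | "\<xi> \<in> K" | "R < norm \<xi>"
      by (fastforce simp: K_def)
    then have "?d\<^sup>2 \<le> C2 * W \<xi> \<or> ?d\<^sup>2 \<le> X2 * W \<xi> \<or> ?d\<^sup>2 \<le> X1 * W \<xi>"
    proof cases
      case 1
      then have "?d\<^sup>2 \<le> C2 * W \<xi>"
        using \<rho>(3)[OF 1] \<rho>(2) by (simp add: pos_divide_le_eq mult.commute)
      then show ?thesis ..
    next
      case 2
      then have "?d \<le> R + norm A"
        using upper[of \<xi>] by (simp add: K_def)
      then have "?d\<^sup>2 \<le> (R + norm A)\<^sup>2"
        by (intro power_mono) (auto simp: infdist_nonneg)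
      also have "\<dots> = X2 * m"
        using m by (simp add: X2_def)
      also have "\<dots> \<le> X2 * W \<xi>"
        using X m(2)[OF 2] by (intro mult_left_mono)
      finally show ?thesis by simp
    next
      case 3
      then have "R\<^sup>2 \<le> (norm \<xi>)\<^sup>2"
        using R by (intro power_mono) auto
      then have n: "2 * C1\<^sup>2 \<le> (norm \<xi>)\<^sup>2"
        by (simp add: R)
      then have "2 * C1 \<le> (norm \<xi>)\<^sup>2 / C1"
        using C1(1) by (simp add: pos_le_divide_eq power2_eq_square)
      then have W1: "C1 \<le> W \<xi>" "(norm \<xi>)\<^sup>2 / C1 \<le> 2 * W \<xi>"
        using C1(2)[of \<xi>] by linarith+
      have "?d\<^sup>2 \<le> (norm \<xi> + norm A)\<^sup>2"
        using upper[of \<xi>] by (intro power_mono) (auto simp: infdist_nonneg)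
      also have "\<dots> \<le> 2 * (norm \<xi>)\<^sup>2 + 2 * (norm A)\<^sup>2"
        using zero_le_power2[of "norm \<xi> - norm A"] by (simp add: power2_eq_square algebra_simps)
      also have "\<dots> = 2 * C1 * ((norm \<xi>)\<^sup>2 / C1) + 2 * (norm A)\<^sup>2 / C1 * C1"
        using C1(1) by simp
      also have "\<dots> \<le> 2 * C1 * (2 * W \<xi>) + 2 * (norm A)\<^sup>2 / C1 * W \<xi>"
        using C1(1) W1 by (intro add_mono mult_left_mono) auto
      also have "\<dots> = X1 * W \<xi>"
        by (simp add: X1_def algebra_simps)
      finally show ?thesis by simp
    qed
    moreover have "C2 * W \<xi> \<le> (X1 + X2 + C2) * W \<xi>" "X2 * W \<xi> \<le> (X1 + X2 + C2) * W \<xi>" "X1 * W \<xi> \<le> (X1 + X2 + C2) * W \<xi>"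
      using X \<rho>(2) W by (auto intro!: mult_right_mono)
    ultimately show ?thesis
      by linarith
  qed
  then show ?thesis
    using that[of "X1 + X2 + C2"] X \<rho>(2) by simp
qed

lemma transition_half: "s \<le> 1/2 \<Longrightarrow> transition s \<le> 1/2" "1/2 \<le> s \<Longrightarrow> 1/2 \<le> transition s"
proof -
  have pos: "0 < s\<^sup>2 + (1 - s)\<^sup>2"
    using transition_denom(1)[of s] by linarith
  show "transition s \<le> 1/2" if "s \<le> 1/2"
    using that pos by (simp add: transition_def pos_divide_le_eq power2_eq_square algebra_simps)
  show "1/2 \<le> transition s" if "1/2 \<le> s"
    using that pos by (simp add: transition_def pos_le_divide_eq power2_eq_square algebra_simps)
qed

lemma infdist_pair:
  obtains "infdist \<xi> {A, B} = dist \<xi> A" | "infdist \<xi> {A, B} = dist \<xi> B"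
proof -
  have "infdist \<xi> {A, B} = min (dist \<xi> A) (dist \<xi> B)"
    by (simp add: infdist_def cInf_eq_Min)
  then show ?thesis
    using that by (metis min_def)
qed

lemma matrix_entry_le: "\<bar>\<xi> $ i $ j\<bar> \<le> norm (\<xi> :: real^3^3)"
  using component_le_norm_cart[of "\<xi> $ i" j] Finite_Cartesian_Product.norm_nth_le[of \<xi> i] by linarith

text \<open>Only the case where the other well is nearest needs an argument. If \<open>d\<close> is
  at most \<open>\<bar>a\<bar> / 2\<close>, the entry in position (1,1) puts \<open>s\<close> on the
  wrong side of 1/2, and the transition term pays for \<open>2 * N\<^sup>2\<close>; otherwise
  \<open>d\<^sup>2\<close> does, with coefficient \<open>8 * N\<^sup>2 / a\<^sup>2\<close>.\<close>

lemma well_distance: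
  fixes A B \<xi> :: "real^3^3" and a :: real
  assumes a: "a \<noteq> 0" "A $ 1 $ 1 = 1" "B $ 1 $ 1 = 1 + a"
  defines "d \<equiv> infdist \<xi> {A, B}" and "s \<equiv> (\<xi> $ 1 $ 1 - 1) / a" and "N \<equiv> norm (B - A)"
  shows "(norm (\<xi> - A))\<^sup>2 \<le> (2 + 8 * N\<^sup>2 / a\<^sup>2 + 4 * N\<^sup>2) * (d\<^sup>2 + transition s)"
    and "(norm (\<xi> - B))\<^sup>2 \<le> (2 + 8 * N\<^sup>2 / a\<^sup>2 + 4 * N\<^sup>2) * (d\<^sup>2 + (1 - transition s))"
proof -
  define K where "K = 2 + 8 * N\<^sup>2 / a\<^sup>2 + 4 * N\<^sup>2"
  have K: "1 \<le> K"
    by (simp add: K_def add_nonneg_nonneg)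
  have near: "x\<^sup>2 \<le> K * (d\<^sup>2 + t)" if "x = d" "0 \<le> t" for x t
  proof -
    have "1 * (d\<^sup>2 + t) \<le> K * (d\<^sup>2 + t)"
      using K that by (intro mult_right_mono) auto
    then show ?thesis
      using that by simp
  qed
  have far: "x\<^sup>2 \<le> K * (d\<^sup>2 + t)" if "0 \<le> x" "x \<le> d + N" "0 \<le> t" and small: "d \<le> \<bar>a\<bar> / 2 \<Longrightarrow> 1/2 \<le> t" for x t
  proof -
    have "x\<^sup>2 \<le> (d + N)\<^sup>2"
      using that by (intro power_mono)
    also have "\<dots> \<le> 2 * d\<^sup>2 + 2 * N\<^sup>2"
      using zero_le_power2[of "d - N"] by (simp add: power2_eq_square algebra_simps)
    also have "2 * N\<^sup>2 \<le> 8 * N\<^sup>2 / a\<^sup>2 * d\<^sup>2 + 4 * N\<^sup>2 * t"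
    proof (cases "d \<le> \<bar>a\<bar> / 2")
      case True
      have "4 * N\<^sup>2 * (1/2) \<le> 4 * N\<^sup>2 * t"
        using small[OF True] by (intro mult_left_mono) auto
      moreover have "0 \<le> 8 * N\<^sup>2 / a\<^sup>2 * d\<^sup>2"
        by simp
      ultimately show ?thesis by linarith
    next
      case False
      then have "(\<bar>a\<bar> / 2)\<^sup>2 \<le> d\<^sup>2"
        by (intro power_mono) auto
      then have "8 * N\<^sup>2 / a\<^sup>2 * (\<bar>a\<bar> / 2)\<^sup>2 \<le> 8 * N\<^sup>2 / a\<^sup>2 * d\<^sup>2"
        by (intro mult_left_mono) auto
      moreover have "8 * N\<^sup>2 / a\<^sup>2 * (\<bar>a\<bar> / 2)\<^sup>2 = 2 * N\<^sup>2"
        using a by (simp add: power_divide)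
      moreover have "0 \<le> 4 * N\<^sup>2 * t"
        using that by simp
      ultimately show ?thesis by linarith
    qed
    finally have "x\<^sup>2 \<le> 2 * d\<^sup>2 + (8 * N\<^sup>2 / a\<^sup>2 * d\<^sup>2 + 4 * N\<^sup>2 * t)"
      by simp
    also have "\<dots> \<le> K * (d\<^sup>2 + t)"
    proof -
      have "K * (d\<^sup>2 + t) = 2 * d\<^sup>2 + (8 * N\<^sup>2 / a\<^sup>2 * d\<^sup>2 + 4 * N\<^sup>2 * t) + (2 * t + 8 * N\<^sup>2 / a\<^sup>2 * t + 4 * N\<^sup>2 * d\<^sup>2)"
        by (simp add: K_def distrib_left distrib_right)
      moreover have "0 \<le> 2 * t + 8 * N\<^sup>2 / a\<^sup>2 * t + 4 * N\<^sup>2 * d\<^sup>2"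
        using that by simp
      ultimately show ?thesis by linarith
    qed
    finally show ?thesis .
  qed
  have tri: "norm (\<xi> - B) \<le> norm (\<xi> - A) + N" "norm (\<xi> - A) \<le> norm (\<xi> - B) + N"
    unfolding N_def using norm_triangle_ineq4[of "\<xi> - A" "B - A"] norm_triangle_ineq[of "\<xi> - B" "B - A"] by simp_all
  have "(norm (\<xi> - A))\<^sup>2 \<le> K * (d\<^sup>2 + transition s) \<and> (norm (\<xi> - B))\<^sup>2 \<le> K * (d\<^sup>2 + (1 - transition s))"
  proof (cases rule: infdist_pair[of \<xi> A B])
    case 1
    then have d: "norm (\<xi> - A) = d"
      by (simp add: d_def dist_norm)
    have "1/2 \<le> 1 - transition s" if "d \<le> \<bar>a\<bar> / 2"
    proof -
      have "\<bar>\<xi> $ 1 $ 1 - 1\<bar> \<le> \<bar>a\<bar> / 2"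
        using matrix_entry_le[of "\<xi> - A" 1 1] a d that by simp
      then have "\<bar>s\<bar> \<le> 1/2"
        using a by (simp add: s_def pos_divide_le_eq)
      then show ?thesis
        using transition_half(1)[of s] by linarith
    qed
    then show ?thesis
      using near[OF d] far[of "norm (\<xi> - B)" "1 - transition s"] tri d transition_bounds[of s] by simp
  next
    case 2
    then have d: "norm (\<xi> - B) = d"
      by (simp add: d_def dist_norm)
    have "1/2 \<le> transition s" if "d \<le> \<bar>a\<bar> / 2"
    proof -
      have "\<bar>\<xi> $ 1 $ 1 - 1 - a\<bar> \<le> \<bar>a\<bar> / 2"
        using matrix_entry_le[of "\<xi> - B" 1 1] a d that by (simp add: algebra_simps)
      moreover have "s - 1 = (\<xi> $ 1 $ 1 - 1 - a) / a"
        using a by (simp add: s_def diff_divide_distrib)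
      ultimately have "\<bar>s - 1\<bar> \<le> 1/2"
        using a by (simp add: pos_divide_le_eq)
      then show ?thesis
        using transition_half(2)[of s] by linarith
    qed
    then show ?thesis
      using near[OF d] far[of "norm (\<xi> - A)" "transition s"] tri d transition_bounds[of s] by simp
  qed
  then show "(norm (\<xi> - A))\<^sup>2 \<le> (2 + 8 * N\<^sup>2 / a\<^sup>2 + 4 * N\<^sup>2) * (d\<^sup>2 + transition s)"
    and "(norm (\<xi> - B))\<^sup>2 \<le> (2 + 8 * N\<^sup>2 / a\<^sup>2 + 4 * N\<^sup>2) * (d\<^sup>2 + (1 - transition s))"
    by (simp_all add: K_def)
qed

lemma film_domain_geometry:
  assumes "bounded \<omega>" "convex \<omega>" "open \<omega>"
  shows "bounded (film_domain \<omega>)" "convex (film_domain \<omega>)" "open (film_domain \<omega>)"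
proof -
  define P :: "real^3 \<Rightarrow> real^2" where "P x = vector [x$1, x$2]" for x
  have P: "linear P"
    unfolding P_def by (intro linearI) (simp_all add: vec_eq_iff forall_2)
  have fd: "film_domain \<omega> = (P -` \<omega>) \<inter> ({x. - (1/2) < x$3} \<inter> {x. x$3 < 1/2})"
    by (auto simp: film_domain_def P_def)
  have "open (P -` \<omega>)"
    using open_vimage[OF assms(3) linear_continuous_on[of P UNIV]] P by (simp add: linear_conv_bounded_linear)
  moreover have "open {x :: real^3. - (1/2) < x$3}" "open {x :: real^3. x$3 < 1/2}"
    by (intro open_Collect_less continuous_intros)+
  ultimately show "open (film_domain \<omega>)"
    unfolding fd by (intro open_Int)
  have c3: "convex {x :: real^3. - (1/2) < x$3}" "convex {x :: real^3. x$3 < 1/2}"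
    using convex_halfspace_gt[of "- (1/2)" "axis 3 1 :: real^3"] convex_halfspace_lt[of "axis 3 1 :: real^3" "1/2"]
    by (simp_all add: inner_axis inner_commute)
  show "convex (film_domain \<omega>)"
    unfolding fd using convex_linear_vimage[OF P assms(2)] c3 by (intro convex_Int)
  obtain C where C: "\<And>y. y \<in> \<omega> \<Longrightarrow> norm y \<le> C"
    using assms(1) unfolding bounded_iff by blast
  have "norm x \<le> 2 * C + 1/2" if x: "x \<in> film_domain \<omega>" for x
  proof -
    have "norm x \<le> (\<Sum>i\<in>UNIV. \<bar>x$i\<bar>)"
      by (rule norm_le_l1_cart)
    also have "\<dots> = \<bar>x$1\<bar> + \<bar>x$2\<bar> + \<bar>x$3\<bar>"
      unfolding UNIV_3 by simp
    also have "\<dots> \<le> C + C + 1/2"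
    proof (intro add_mono)
      have "norm (P x) \<le> C"
        using x by (intro C) (auto simp: fd)
      then show "\<bar>x$1\<bar> \<le> C" "\<bar>x$2\<bar> \<le> C"
        using component_le_norm_cart[of "P x" 1] component_le_norm_cart[of "P x" 2] by (simp_all add: P_def)
      show "\<bar>x$3\<bar> \<le> 1/2"
        using x by (auto simp: film_domain_def)
    qed
    finally show ?thesis by simp
  qed
  then show "bounded (film_domain \<omega>)"
    unfolding bounded_iff by blast
qed

text \<open>Local integrability speaks about compact sets only; an exhaustion of \<open>S\<close> by
  compact sets presents the function as a pointwise limit.\<close>

lemma locally_integrable_measurable:
  fixes f :: "real^'n::finite \<Rightarrow> 'b::euclidean_space"
  assumes S: "open S" and f: "f locally_integrable_on S"
  shows "f \<in> borel_measurable (lebesgue_on S)"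
proof -
  obtain C where C: "\<And>n. compact (C n)" "\<And>n. C n \<subseteq> S" "\<And>n. C n \<subseteq> interior (C (Suc n))" "\<Union> (range C) = S"
    by (rule open_Union_compact_subsets[OF S]) (auto simp: that)
  have CL: "C n \<in> sets lebesgue" for n
    using C(1) by (auto simp: borel_compact)
  have mono: "C n \<subseteq> C m" if "n \<le> m" for n m
    using that by (rule lift_Suc_mono_le[rotated]) (meson C(3) interior_subset order_trans)
  have "(\<lambda>x. indicator S x *\<^sub>R f x) \<in> borel_measurable lebesgue"
  proof (rule borel_measurable_LIMSEQ_metric)
    show "(\<lambda>x. indicator (C n) x *\<^sub>R f x) \<in> borel_measurable lebesgue" for n
    proof -
      have "integrable (lebesgue_on (C n)) f"
        using f C(1,2)[of n] by (simp add: locally_integrable_on_def)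
      then have "f \<in> borel_measurable (lebesgue_on (C n))"
        by (rule borel_measurable_integrable)
      then show ?thesis
        using CL by (subst (asm) borel_measurable_restrict_space_iff) auto
    qed
    show "(\<lambda>n. indicator (C n) x *\<^sub>R f x) \<longlonglongrightarrow> indicator S x *\<^sub>R f x" for x
    proof (cases "x \<in> S")
      case True
      then obtain N where N: "x \<in> C N"
        using C(4) by blast
      have "\<forall>\<^sub>F n in sequentially. indicator (C n) x *\<^sub>R f x = indicator S x *\<^sub>R f x"
        using eventually_ge_at_top[of N] by eventually_elim (use mono N True in \<open>auto simp: indicator_def\<close>)
      then show ?thesis
        by (rule tendsto_eventually)
    next
      case False
      then have "x \<notin> C n" for n
        using C(2) by blast
      then show ?thesis
        using False by simp
    qed
  qed
  then show ?thesis
    using S by (subst borel_measurable_restrict_space_iff) (auto simp: borel_open)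
qed

text \<open>On one reference cube the two masses sum to its measure, so for every n one of them is
  at least half of it. The one for which this happens infinitely often picks the subsequence; there
  the other phase vanishes on the cube, and then everywhere.\<close>

lemma unit_densities_dichotomy:
  assumes "unit_densities S \<Theta>"
    and loc: "\<And>p. p \<in> S \<Longrightarrow> \<exists>r>0. cbox (p - vec r) (p + vec r) \<subseteq> S \<and>
      (\<lambda>n. (LINT x|lebesgue_on (cbox (p - vec r) (p + vec r)). \<Theta> n x)
         * (LINT x|lebesgue_on (cbox (p - vec r) (p + vec r)). 1 - \<Theta> n x)) \<longlonglongrightarrow> 0"
  obtains \<sigma> :: "nat \<Rightarrow> nat" where "strict_mono \<sigma>" "(\<lambda>n. LINT x|lebesgue_on S. \<Theta> (\<sigma> n) x) \<longlonglongrightarrow> 0"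
  | \<sigma> :: "nat \<Rightarrow> nat" where "strict_mono \<sigma>" "(\<lambda>n. LINT x|lebesgue_on S. 1 - \<Theta> (\<sigma> n) x) \<longlonglongrightarrow> 0"
proof (cases "S = {}")
  case True
  then have "(\<lambda>n. LINT x|lebesgue_on S. \<Theta> (id n) x) \<longlonglongrightarrow> 0"
    by (simp add: integral_empty)
  then show ?thesis
    using that(1)[of id] by (simp add: strict_mono_id)
next
  case False
  interpret unit_densities S \<Theta> by fact
  obtain p r where p: "p \<in> S" and r: "0 < r" "cbox (p - vec r) (p + vec r) \<subseteq> S"
    and lim: "(\<lambda>n. (LINT x|lebesgue_on (cbox (p - vec r) (p + vec r)). \<Theta> n x)
       * (LINT x|lebesgue_on (cbox (p - vec r) (p + vec r)). 1 - \<Theta> n x)) \<longlonglongrightarrow> 0"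
    using False loc by blast
  let ?C = "cbox (p - vec r) (p + vec r)"
  define x y where "x n = (LINT z|lebesgue_on ?C. \<Theta> n z)" and "y n = (LINT z|lebesgue_on ?C. 1 - \<Theta> n z)" for n
  define v where "v = measure lebesgue ?C"
  have "0 < measure lebesgue (box (p - vec r) (p + vec r))"
    using r(1) by (intro measure_box_pos) auto
  also have "\<dots> \<le> v"
    unfolding v_def by (intro measure_mono_fmeasurable box_subset_cbox) auto
  finally have v: "0 < v" .
  have nn: "0 \<le> x n" "0 \<le> y n" for n
    unfolding x_def y_def by (intro Bochner_Integration.integral_nonneg; simp add: \<Theta>_range)+
  have sum: "v \<le> x n + y n" for n
    using complement_mass_ge[of ?C ?C n] r(2) by (simp add: mass_def x_def y_def v_def)
  have xy: "(\<lambda>n. x n * y n) \<longlonglongrightarrow> 0"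
    using lim by (simp add: x_def y_def)
  have "infinite {n. v / 2 \<le> y n} \<or> infinite {n. v / 2 \<le> x n}"
  proof (rule ccontr)
    assume "\<not> ?thesis"
    then have "finite ({n. v / 2 \<le> y n} \<union> {n. v / 2 \<le> x n})"
      by simp
    moreover have "{n. v / 2 \<le> y n} \<union> {n. v / 2 \<le> x n} = UNIV"
    proof -
      have "v / 2 \<le> y n \<or> v / 2 \<le> x n" for n
        using sum[of n] by linarith
      then show ?thesis by blast
    qed
    ultimately have "finite (UNIV :: nat set)"
      by (simp only:)
    then show False
      by simp
  qed
  then show ?thesis
  proof
    assume "infinite {n. v / 2 \<le> y n}"
    then obtain \<sigma> :: "nat \<Rightarrow> nat" where \<sigma>: "strict_mono \<sigma>" "\<And>n. v / 2 \<le> y (\<sigma> n)"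
      using infinite_enumerate by blast
    interpret sub: unit_densities S "\<lambda>n. \<Theta> (\<sigma> n)"
      by unfold_locales (use S \<Theta>_meas \<Theta>_range in auto)
    have "(\<lambda>n. sub.mass n S) \<longlonglongrightarrow> 0"
    proof (rule sub.vanishing_propagates[OF _ r])
      fix q assume "q \<in> S"
      from loc[OF this] obtain s where s: "s > 0" "cbox (q - vec s) (q + vec s) \<subseteq> S"
        "(\<lambda>n. (LINT x|lebesgue_on (cbox (q - vec s) (q + vec s)). \<Theta> n x)
         * (LINT x|lebesgue_on (cbox (q - vec s) (q + vec s)). 1 - \<Theta> n x)) \<longlonglongrightarrow> 0"
        by blast
      show "\<exists>r>0. cbox (q - vec r) (q + vec r) \<subseteq> S \<and>
          (\<lambda>n. sub.mass n (cbox (q - vec r) (q + vec r))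
            * (LINT x|lebesgue_on (cbox (q - vec r) (q + vec r)). 1 - \<Theta> (\<sigma> n) x)) \<longlonglongrightarrow> 0"
        using s(1,2) LIMSEQ_subseq_LIMSEQ[OF s(3) \<sigma>(1)] unfolding sub.mass_def o_def by blast
    next
      show "(\<lambda>n. sub.mass n ?C) \<longlonglongrightarrow> 0"
        unfolding sub.mass_def x_def[symmetric]
        by (rule tendsto_0_if_mult_tendsto_0[where w = "v / 2"])
          (use LIMSEQ_subseq_LIMSEQ[OF xy \<sigma>(1)] \<sigma>(2) v nn in \<open>auto simp: o_def\<close>)
    qed
    then show ?thesis
      using that(1)[OF \<sigma>(1)] by (simp add: sub.mass_def)
  next
    assume "infinite {n. v / 2 \<le> x n}"
    then obtain \<sigma> :: "nat \<Rightarrow> nat" where \<sigma>: "strict_mono \<sigma>" "\<And>n. v / 2 \<le> x (\<sigma> n)"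
      using infinite_enumerate by blast
    \<comment> \<open>The hypotheses are symmetric under exchanging the phases, so the propagation
      applies to the complementary density as well.\<close>
    interpret sub: unit_densities S "\<lambda>n z. 1 - \<Theta> (\<sigma> n) z"
      by unfold_locales (use S \<Theta>_meas \<Theta>_range in auto)
    have "(\<lambda>n. sub.mass n S) \<longlonglongrightarrow> 0"
    proof (rule sub.vanishing_propagates[OF _ r])
      fix q assume "q \<in> S"
      from loc[OF this] obtain s where s: "s > 0" "cbox (q - vec s) (q + vec s) \<subseteq> S"
        "(\<lambda>n. (LINT x|lebesgue_on (cbox (q - vec s) (q + vec s)). \<Theta> n x)
         * (LINT x|lebesgue_on (cbox (q - vec s) (q + vec s)). 1 - \<Theta> n x)) \<longlonglongrightarrow> 0"
        by blast
      have "(\<lambda>n. sub.mass n (cbox (q - vec s) (q + vec s))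
            * (LINT x|lebesgue_on (cbox (q - vec s) (q + vec s)). 1 - (1 - \<Theta> (\<sigma> n) x))) \<longlonglongrightarrow> 0"
        using LIMSEQ_subseq_LIMSEQ[OF s(3) \<sigma>(1)] unfolding sub.mass_def o_def by (simp add: mult.commute)
      then show "\<exists>r>0. cbox (q - vec r) (q + vec r) \<subseteq> S \<and>
          (\<lambda>n. sub.mass n (cbox (q - vec r) (q + vec r))
            * (LINT x|lebesgue_on (cbox (q - vec r) (q + vec r)). 1 - (1 - \<Theta> (\<sigma> n) x))) \<longlonglongrightarrow> 0"
        using s(1,2) by blast
    next
      show "(\<lambda>n. sub.mass n ?C) \<longlonglongrightarrow> 0"
        unfolding sub.mass_def y_def[symmetric]
        by (rule tendsto_0_if_mult_tendsto_0[where w = "v / 2"])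
          (use LIMSEQ_subseq_LIMSEQ[OF xy \<sigma>(1)] \<sigma>(2) v nn in \<open>auto simp: o_def mult.commute\<close>)
    qed
    then show ?thesis
      using that(2)[OF \<sigma>(1)] by (simp add: sub.mass_def)
  qed
qed

lemma L2_tendsto_well:
  fixes G :: "nat \<Rightarrow> real^3 \<Rightarrow> real^3^3" and d \<theta> :: "nat \<Rightarrow> real^3 \<Rightarrow> real"
  assumes S: "S \<in> lmeasurable" and G: "\<And>n. G n \<in> borel_measurable (lebesgue_on S)"
    and d: "\<And>n. integrable (lebesgue_on S) (\<lambda>x. (d n x)\<^sup>2)" "(\<lambda>n. LINT x|lebesgue_on S. (d n x)\<^sup>2) \<longlonglongrightarrow> 0"
    and \<theta>: "\<And>n. integrable (lebesgue_on S) (\<theta> n)" "(\<lambda>n. LINT x|lebesgue_on S. \<theta> n x) \<longlonglongrightarrow> 0"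
    and bound: "\<And>n x. (norm (G n x - \<xi>))\<^sup>2 \<le> K * ((d n x)\<^sup>2 + \<theta> n x)"
  shows "L2_tendsto S G (\<lambda>x. \<xi>)"
proof -
  have G\<xi>: "(\<lambda>x. G n x - \<xi>) \<in> borel_measurable (lebesgue_on S)" for n
    by (intro borel_measurable_diff G borel_measurable_const)
  have sq: "(\<lambda>x. (norm (G n x - \<xi>))\<^sup>2) \<in> borel_measurable (lebesgue_on S)"
    "(\<lambda>x. (norm (G n x))\<^sup>2) \<in> borel_measurable (lebesgue_on S)" for n
    by (intro borel_measurable_power measurable_compose[OF G\<xi> borel_measurable_norm]
        measurable_compose[OF G borel_measurable_norm])+
  have Kint: "integrable (lebesgue_on S) (\<lambda>x. K * ((d n x)\<^sup>2 + \<theta> n x))" for n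
    by (intro integrable_mult_right Bochner_Integration.integrable_add d \<theta>)
  have int: "integrable (lebesgue_on S) (\<lambda>x. (norm (G n x - \<xi>))\<^sup>2)" for n
    by (rule Bochner_Integration.integrable_bound[OF Kint[of n] sq(1)])
      (use bound in \<open>auto intro: order_trans[OF _ abs_ge_self]\<close>)
  have "G n \<in> L2 S" for n
  proof -
    have "integrable (lebesgue_on S) (\<lambda>x. 2 * (norm (G n x - \<xi>))\<^sup>2 + 2 * (norm \<xi>)\<^sup>2)"
      by (intro Bochner_Integration.integrable_add integrable_mult_right int integrable_const_lebesgue_on S)
    then have "integrable (lebesgue_on S) (\<lambda>x. (norm (G n x))\<^sup>2)"
    proof (rule Bochner_Integration.integrable_bound[OF _ sq(2)])
      have "(norm (G n x))\<^sup>2 \<le> 2 * (norm (G n x - \<xi>))\<^sup>2 + 2 * (norm \<xi>)\<^sup>2" for x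
      proof -
        have "norm (G n x) \<le> norm (G n x - \<xi>) + norm \<xi>"
          using norm_triangle_ineq[of "G n x - \<xi>" \<xi>] by simp
        then have "(norm (G n x))\<^sup>2 \<le> (norm (G n x - \<xi>) + norm \<xi>)\<^sup>2"
          by (intro power_mono) auto
        also have "\<dots> \<le> 2 * (norm (G n x - \<xi>))\<^sup>2 + 2 * (norm \<xi>)\<^sup>2"
          using zero_le_power2[of "norm (G n x - \<xi>) - norm \<xi>"] by (simp add: power2_eq_square algebra_simps)
        finally show ?thesis .
      qed
      then show "AE x in lebesgue_on S. norm ((norm (G n x))\<^sup>2) \<le> norm (2 * (norm (G n x - \<xi>))\<^sup>2 + 2 * (norm \<xi>)\<^sup>2)"
        by (intro AE_I2) (auto intro: order_trans[OF _ abs_ge_self])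
    qed
    then show ?thesis
      using G by (simp add: L2_def)
  qed
  moreover have "(\<lambda>x. \<xi>) \<in> L2 S"
    using integrable_const_lebesgue_on[OF S] by (simp add: L2_def)
  moreover have "(\<lambda>n. L2_norm S (\<lambda>x. G n x - \<xi>)) \<longlonglongrightarrow> 0"
  proof -
    have "(\<lambda>n. LINT x|lebesgue_on S. (norm (G n x - \<xi>))\<^sup>2) \<longlonglongrightarrow> 0"
    proof (rule tendsto_sandwich[OF _ _ tendsto_const])
      show "\<forall>\<^sub>F n in sequentially. 0 \<le> (LINT x|lebesgue_on S. (norm (G n x - \<xi>))\<^sup>2)"
        by (auto intro!: always_eventually Bochner_Integration.integral_nonneg)
      have "(LINT x|lebesgue_on S. (norm (G n x - \<xi>))\<^sup>2)
          \<le> K * ((LINT x|lebesgue_on S. (d n x)\<^sup>2) + (LINT x|lebesgue_on S. \<theta> n x))" for n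
      proof -
        have "(LINT x|lebesgue_on S. (norm (G n x - \<xi>))\<^sup>2) \<le> (LINT x|lebesgue_on S. K * ((d n x)\<^sup>2 + \<theta> n x))"
          by (rule integral_mono[OF int Kint bound])
        also have "\<dots> = K * ((LINT x|lebesgue_on S. (d n x)\<^sup>2) + (LINT x|lebesgue_on S. \<theta> n x))"
          using d(1) \<theta>(1) by simp
        finally show ?thesis .
      qed
      then show "\<forall>\<^sub>F n in sequentially. (LINT x|lebesgue_on S. (norm (G n x - \<xi>))\<^sup>2)
          \<le> K * ((LINT x|lebesgue_on S. (d n x)\<^sup>2) + (LINT x|lebesgue_on S. \<theta> n x))"
        by (intro always_eventually allI)
      have "(\<lambda>n. K * ((LINT x|lebesgue_on S. (d n x)\<^sup>2) + (LINT x|lebesgue_on S. \<theta> n x))) \<longlonglongrightarrow> K * (0 + 0)"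
        by (intro tendsto_intros d \<theta>)
      then show "(\<lambda>n. K * ((LINT x|lebesgue_on S. (d n x)\<^sup>2) + (LINT x|lebesgue_on S. \<theta> n x))) \<longlonglongrightarrow> 0"
        by simp
    qed
    from tendsto_real_sqrt[OF this] show ?thesis
      by (simp add: L2_norm_def)
  qed
  ultimately show ?thesis
    by (simp add: L2_tendsto_def)
qed

section \<open>The scaled gradient of a Sobolev film and its energy\<close>

lemma sobolev_weak_deriv:
  assumes "u \<in> sobolev_H k S" "1 \<le> k"
  shows "has_weak_deriv S [j] u (weak_deriv S [j] u)"
proof -
  have "length [j] \<le> k"
    using assms(2) by simp
  then have "\<exists>g. has_weak_deriv S [j] u g"
    using assms(1) unfolding sobolev_H_def by blast
  then show ?thesis
    unfolding weak_deriv_def by (rule someI_ex)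
qed

lemma scaled_grad_measurable:
  fixes u :: "real^3 \<Rightarrow> real^3"
  assumes "open S" "\<And>j. has_weak_deriv S [j] u (weak_deriv S [j] u)"
  shows "scaled_grad S h u \<in> borel_measurable (lebesgue_on S)"
proof -
  \<comment> \<open>\<open>L j\<close> places a vector into column \<open>j\<close>; the scaled
    gradient is a sum of such linear images of measurable columns.\<close>
  define L :: "3 \<Rightarrow> real^3 \<Rightarrow> real^3^3" where "L j v = (\<chi> i k. if k = j then v $ i else 0)" for j v
  have "linear (L j)" for j
    unfolding L_def by (intro linearI) (simp_all add: vec_eq_iff)
  then have "L j \<in> borel_measurable borel" for j
    by (intro borel_measurable_continuous_onI linear_continuous_on) (simp add: linear_conv_bounded_linear)
  moreover have "weak_deriv S [j] u \<in> borel_measurable (lebesgue_on S)" for j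
    using assms(2)[of j] by (intro locally_integrable_measurable[OF assms(1)]) (simp add: has_weak_deriv_def)
  ultimately have "(\<lambda>x. L j (weak_deriv S [j] u x)) \<in> borel_measurable (lebesgue_on S)" for j
    using measurable_compose by blast
  then have "(\<lambda>x. \<Sum>j\<in>UNIV. (if j = 3 then 1 / h else 1) *\<^sub>R L j (weak_deriv S [j] u x)) \<in> borel_measurable (lebesgue_on S)"
    by (intro borel_measurable_sum borel_measurable_scaleR borel_measurable_const)
  moreover have "(\<lambda>x. \<Sum>j\<in>UNIV. (if j = 3 then 1 / h else 1) *\<^sub>R L j (weak_deriv S [j] u x)) = scaled_grad S h u"
    unfolding UNIV_3 by (simp add: fun_eq_iff scaled_grad_def L_def vec_eq_iff forall_3)
  ultimately show ?thesis
    by simp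
qed

lemma film_energy_well_bound:
  assumes S: "open S" and \<epsilon>: "0 < \<epsilon>" and W: "continuous_on UNIV W" "\<forall>\<xi>. W \<xi> \<ge> 0"
    and weak: "\<And>j. has_weak_deriv S [j] u (weak_deriv S [j] u)"
    and C: "0 < C" "\<And>\<xi>. (infdist \<xi> {A, B})\<^sup>2 \<le> C * W \<xi>"
    and E: "film_energy W S \<epsilon> h u \<le> ennreal M" "0 \<le> M"
  shows "(\<integral>\<^sup>+x. ennreal ((infdist (scaled_grad S h u x) {A, B})\<^sup>2) \<partial>lebesgue_on S) \<le> ennreal (C * \<epsilon> * M)"
proof -
  have "(\<integral>\<^sup>+x. ennreal ((infdist (scaled_grad S h u x) {A, B})\<^sup>2) \<partial>lebesgue_on S)
      \<le> (\<integral>\<^sup>+x. ennreal (C * \<epsilon>) * ennreal (1 / \<epsilon> * W (scaled_grad S h u x)) \<partial>lebesgue_on S)"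
  proof (rule nn_integral_mono)
    fix x
    have "(infdist (scaled_grad S h u x) {A, B})\<^sup>2 \<le> (C * \<epsilon>) * (1 / \<epsilon> * W (scaled_grad S h u x))"
      using C(2)[of "scaled_grad S h u x"] \<epsilon> by simp
    then have "ennreal ((infdist (scaled_grad S h u x) {A, B})\<^sup>2) \<le> ennreal ((C * \<epsilon>) * (1 / \<epsilon> * W (scaled_grad S h u x)))"
      by (rule ennreal_leI)
    then show "ennreal ((infdist (scaled_grad S h u x) {A, B})\<^sup>2)
        \<le> ennreal (C * \<epsilon>) * ennreal (1 / \<epsilon> * W (scaled_grad S h u x))"
      using C(1) \<epsilon> W(2) by (subst ennreal_mult[symmetric]) auto
  qed
  also have "\<dots> = ennreal (C * \<epsilon>) * (\<integral>\<^sup>+x. ennreal (1 / \<epsilon> * W (scaled_grad S h u x)) \<partial>lebesgue_on S)"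
  proof (rule nn_integral_cmult)
    have "(\<lambda>x. W (scaled_grad S h u x)) \<in> borel_measurable (lebesgue_on S)"
      by (rule measurable_compose[OF scaled_grad_measurable[OF S weak] borel_measurable_continuous_onI[OF W(1)]])
    then show "(\<lambda>x. ennreal (1 / \<epsilon> * W (scaled_grad S h u x))) \<in> borel_measurable (lebesgue_on S)"
      by (intro measurable_compose[OF _ measurable_ennreal] borel_measurable_times borel_measurable_const)
  qed
  also have "\<dots> \<le> ennreal (C * \<epsilon>) * film_energy W S \<epsilon> h u"
    unfolding film_energy_def
  proof (intro mult_left_mono nn_integral_mono ennreal_leI)
    show "1 / \<epsilon> * W (scaled_grad S h u x) \<le> 1 / \<epsilon> * W (scaled_grad S h u x) + \<epsilon> * scaled_hess_sq S h u x" for x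
      using \<epsilon> by (simp add: scaled_hess_sq_def sum_nonneg add_nonneg_nonneg)
  qed simp
  also have "\<dots> \<le> ennreal (C * \<epsilon>) * ennreal M"
    using E(1) by (rule mult_left_mono) simp
  also have "\<dots> = ennreal (C * \<epsilon> * M)"
    using C(1) \<epsilon> E(2) by (simp add: ennreal_mult)
  finally show ?thesis .
qed

theorem theorem6p10:
  fixes \<omega> :: "(real^2) set" and \<Omega> :: "(real^3) set"
    and A B :: "real^3^3" and \<theta>\<^sub>1 \<theta>\<^sub>2 :: real
    and W :: "real^3^3 \<Rightarrow> real"
    and h \<epsilon> :: "nat \<Rightarrow> real" and u :: "nat \<Rightarrow> real^3 \<Rightarrow> real^3"
  assumes \<omega>: "bounded \<omega>" "convex \<omega>" "open \<omega>"
    and \<Omega>: "\<Omega> = film_domain \<omega>"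
    and \<theta>: "\<theta>\<^sub>1 > 0" "\<theta>\<^sub>2 > 0" "(1 - \<theta>\<^sub>1) * (1 - \<theta>\<^sub>2) > 0"
    and A: "A = mat 1" and B: "B = diag3 \<theta>\<^sub>1 1 \<theta>\<^sub>2"
    and W: "continuous_on UNIV W" "\<forall>\<xi>. W \<xi> \<ge> 0"
    and wells: "{\<xi>. W \<xi> = 0} = {A, B}"
    and growth: "\<exists>C\<^sub>1>0. \<forall>\<xi>. 1 / C\<^sub>1 * (norm \<xi>)\<^sup>2 - C\<^sub>1 \<le> W \<xi> \<and> W \<xi> \<le> C\<^sub>1 * (norm \<xi>)\<^sup>2 + C\<^sub>1"
    and near_wells: "\<exists>\<rho>>0. \<exists>C\<^sub>2>0. \<forall>\<xi>. infdist \<xi> {A, B} \<le> \<rho> \<longrightarrow>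
        1 / C\<^sub>2 * (infdist \<xi> {A, B})\<^sup>2 \<le> W \<xi> \<and> W \<xi> \<le> C\<^sub>2 * (infdist \<xi> {A, B})\<^sup>2"
    and h: "\<forall>n. h n > 0" "h \<longlonglongrightarrow> 0"
    and \<epsilon>: "\<forall>n. \<epsilon> n > 0" "\<epsilon> \<longlonglongrightarrow> 0"
    and regime: "filterlim (\<lambda>n. h n / \<epsilon> n) at_top sequentially"
    and u: "\<forall>n. u n \<in> sobolev_H 2 \<Omega>"
    and energy_bound: "(SUP n. film_energy W \<Omega> (\<epsilon> n) (h n) (u n)) < \<infinity>"
  shows "\<exists>r :: nat \<Rightarrow> nat. \<exists>\<xi>\<^sub>0\<in>{A, B}. strict_mono r \<and>
    L2_tendsto \<Omega> (\<lambda>n. scaled_grad \<Omega> (h (r n)) (u (r n))) (\<lambda>x. \<xi>\<^sub>0)"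
proof -
  note geom = film_domain_geometry[OF \<omega>, folded \<Omega>]
  have \<Omega>L: "\<Omega> \<in> lmeasurable" "\<Omega> \<in> sets lebesgue"
    using geom by (simp_all add: lmeasurable_open borel_open)
  \<comment> \<open>The diagonal entries by which the wells differ. The sign condition on the
    product makes both nonzero, so that the displacements can be normalised by them.\<close>
  define a b where "a = \<theta>\<^sub>1 - 1" and "b = \<theta>\<^sub>2 - 1"
  have ab: "a \<noteq> 0" "b \<noteq> 0"
    using \<theta>(3) by (auto simp: a_def b_def)
  obtain C where C: "C > 0" "\<And>\<xi>. (infdist \<xi> {A, B})\<^sup>2 \<le> C * W \<xi>"
    using energy_density_lower_bound[OF W wells growth near_wells] by blast
  obtain M where M: "0 \<le> M" "(SUP n. film_energy W \<Omega> (\<epsilon> n) (h n) (u n)) = ennreal M"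
    using energy_bound by (metis ennreal_cases infinity_ennreal_def less_irrefl)
  have energy: "film_energy W \<Omega> (\<epsilon> n) (h n) (u n) \<le> ennreal M" for n
    unfolding M(2)[symmetric] by (rule SUP_upper) simp
  define G where "G n = scaled_grad \<Omega> (h n) (u n)" for n
  define d where "d n x = infdist (G n x) {A, B}" for n x
  define \<Theta> where "\<Theta> n x = transition ((G n x $ 1 $ 1 - 1) / a)" for n x
  have weak: "has_weak_deriv \<Omega> [j] (u n) (weak_deriv \<Omega> [j] (u n))" for n j
    using u by (intro sobolev_weak_deriv[of _ 2]) auto
  have G: "G n \<in> borel_measurable (lebesgue_on \<Omega>)" for n
    unfolding G_def by (rule scaled_grad_measurable[OF geom(3) weak])
  have dmeas: "d n \<in> borel_measurable (lebesgue_on \<Omega>)" for n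
  proof -
    have "(\<lambda>\<xi>. infdist \<xi> {A, B}) \<in> borel_measurable borel"
      by (intro borel_measurable_continuous_onI continuous_intros)
    from measurable_compose[OF G this] show ?thesis
      by (simp add: d_def[abs_def])
  qed
  have Gentry: "(\<lambda>x. G n x $ i $ j) \<in> borel_measurable (lebesgue_on \<Omega>)" for n i j
  proof -
    have "(\<lambda>\<xi> :: real^3^3. \<xi> $ i $ j) \<in> borel_measurable borel"
      by (intro borel_measurable_continuous_onI continuous_intros)
    from measurable_compose[OF G this] show ?thesis .
  qed
  have \<Theta>meas: "\<Theta> n \<in> borel_measurable (lebesgue_on \<Omega>)" for n
  proof -
    have "(\<lambda>x. (G n x $ 1 $ 1 - 1) / a) \<in> borel_measurable (lebesgue_on \<Omega>)"
      by (intro borel_measurable_divide borel_measurable_diff borel_measurable_const Gentry)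
    moreover have "transition \<in> borel_measurable borel"
      by (intro borel_measurable_continuous_onI continuous_on_transition continuous_on_id)
    ultimately show ?thesis
      unfolding \<Theta>_def by (rule measurable_compose)
  qed
  interpret unit_densities \<Omega> \<Theta>
    by unfold_locales
      (use geom \<Theta>meas transition_bounds in \<open>auto simp: \<Theta>_def convex_connected\<close>)
  have d2: "(\<integral>\<^sup>+x. ennreal ((d n x)\<^sup>2) \<partial>lebesgue_on \<Omega>) \<le> ennreal (C * \<epsilon> n * M)" for n
    unfolding d_def G_def
    by (rule film_energy_well_bound[OF geom(3) _ W weak C energy M(1)]) (use \<epsilon>(1) in simp)
  have d2meas: "(\<lambda>x. (d n x)\<^sup>2) \<in> borel_measurable (lebesgue_on \<Omega>)" for n
    using dmeas by (rule borel_measurable_power)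
  have dint: "integrable (lebesgue_on \<Omega>) (\<lambda>x. (d n x)\<^sup>2)" "(LINT x|lebesgue_on \<Omega>. (d n x)\<^sup>2) \<le> C * \<epsilon> n * M" for n
  proof -
    have "0 \<le> C * \<epsilon> n * M"
      using C(1) \<epsilon>(1) M(1) by (intro mult_nonneg_nonneg) (auto simp: less_imp_le)
    from nn_integral_bounds_imp_integral[OF d2meas _ d2 this]
    show "integrable (lebesgue_on \<Omega>) (\<lambda>x. (d n x)\<^sup>2)" "(LINT x|lebesgue_on \<Omega>. (d n x)\<^sup>2) \<le> C * \<epsilon> n * M"
      by simp_all
  qed
  have dlim: "(\<lambda>n. LINT x|lebesgue_on \<Omega>. (d n x)\<^sup>2) \<longlonglongrightarrow> 0"
  proof (rule tendsto_sandwich[OF _ _ tendsto_const])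
    show "\<forall>\<^sub>F n in sequentially. 0 \<le> (LINT x|lebesgue_on \<Omega>. (d n x)\<^sup>2)"
      by (auto intro!: always_eventually Bochner_Integration.integral_nonneg)
    show "\<forall>\<^sub>F n in sequentially. (LINT x|lebesgue_on \<Omega>. (d n x)\<^sup>2) \<le> C * \<epsilon> n * M"
      by (intro always_eventually allI dint)
    have "(\<lambda>n. C * \<epsilon> n * M) \<longlonglongrightarrow> C * 0 * M"
      by (intro tendsto_intros \<epsilon>)
    then show "(\<lambda>n. C * \<epsilon> n * M) \<longlonglongrightarrow> 0"
      by simp
  qed
  define \<kappa> where "\<kappa> = 1 / \<bar>a\<bar> + 1 / \<bar>b\<bar>"
  have \<kappa>: "0 < \<kappa>"
    using ab by (auto simp: \<kappa>_def add_pos_pos)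
  \<comment> \<open>\<open>M + 1\<close> in place of \<open>M\<close> keeps the bound positive when
    the energies vanish.\<close>
  define \<delta> where "\<delta> n = \<kappa>\<^sup>2 * (C * \<epsilon> n * (M + 1))" for n
  have \<delta>: "0 < \<delta> n" for n
    using \<kappa> C(1) \<epsilon>(1) M(1) by (auto simp: \<delta>_def intro!: mult_pos_pos)
  have D2: "(\<integral>\<^sup>+x. ennreal ((\<kappa> * d n x)\<^sup>2) \<partial>lebesgue_on \<Omega>) \<le> ennreal (\<delta> n)" for n
  proof -
    have "(\<integral>\<^sup>+x. ennreal ((\<kappa> * d n x)\<^sup>2) \<partial>lebesgue_on \<Omega>) = ennreal (LINT x|lebesgue_on \<Omega>. \<kappa>\<^sup>2 * (d n x)\<^sup>2)"
      using dint(1)[of n] by (subst nn_integral_eq_integral) (auto simp: power_mult_distrib)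
    also have "\<dots> \<le> ennreal (\<kappa>\<^sup>2 * (C * \<epsilon> n * M))"
      using dint(2)[of n] by (intro ennreal_leI) (auto intro!: mult_left_mono)
    also have "\<dots> \<le> ennreal (\<delta> n)"
      unfolding \<delta>_def using C(1) \<epsilon>(1) by (intro ennreal_leI mult_left_mono) (auto simp: less_imp_le)
    finally show ?thesis .
  qed
  define \<gamma> where "\<gamma> n j x = weak_deriv \<Omega> [j] (u n) x $ 1" for n j x
  define \<eta> where "\<eta> n j x = weak_deriv \<Omega> [j] (u n) x $ 3" for n j x
  have entries: "\<gamma> n 1 x = G n x $ 1 $ 1" "\<gamma> n 3 x / h n = G n x $ 1 $ 3" "\<eta> n 1 x = G n x $ 3 $ 1"
    "\<eta> n 2 x = G n x $ 3 $ 2" "\<eta> n 3 x / h n = G n x $ 3 $ 3" for n x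
    by (simp_all add: \<gamma>_def \<eta>_def G_def scaled_grad_def)
  have AB: "A $ 1 $ 1 = 1" "A $ 1 $ 3 = 0" "A $ 3 $ 1 = 0" "A $ 3 $ 2 = 0" "A $ 3 $ 3 = 1"
    "B $ 1 $ 1 = 1 + a" "B $ 1 $ 3 = 0" "B $ 3 $ 1 = 0" "B $ 3 $ 2 = 0" "B $ 3 $ 3 = 1 + b"
    by (simp_all add: A B mat_def diag3_def a_def b_def)
  have near: "\<bar>(\<gamma> n 1 x - 1) / a - (\<eta> n 3 x / h n - 1) / b\<bar> \<le> \<kappa> * d n x"
    "\<bar>\<gamma> n 3 x / (a * h n)\<bar> \<le> \<kappa> * d n x" "\<bar>\<eta> n 1 x / b\<bar> \<le> \<kappa> * d n x" "\<bar>\<eta> n 2 x / b\<bar> \<le> \<kappa> * d n x"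
    "min \<bar>(\<gamma> n 1 x - 1) / a\<bar> \<bar>(\<gamma> n 1 x - 1) / a - 1\<bar> \<le> \<kappa> * d n x" for n x
  proof -
    define P Q where "P = (G n x $ 1 $ 1 - 1) / a" and "Q = (G n x $ 3 $ 3 - 1) / b"
    \<comment> \<open>\<open>\<xi>\<close> is a nearest well and \<open>\<sigma>\<close> its phase.
      Both normalised indicators are compared with the same \<open>\<sigma>\<close>, which is why
      they are close to each other.\<close>
    obtain \<sigma> \<xi> where \<sigma>: "\<sigma> = 0 \<or> \<sigma> = (1::real)" and \<xi>: "d n x = norm (G n x - \<xi>)"
      "\<xi> $ 1 $ 1 = 1 + \<sigma> * a" "\<xi> $ 1 $ 3 = 0" "\<xi> $ 3 $ 1 = 0" "\<xi> $ 3 $ 2 = 0" "\<xi> $ 3 $ 3 = 1 + \<sigma> * b"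
    proof (cases rule: infdist_pair[of "G n x" A B])
      case 1
      then show ?thesis
        using that[of 0 A] AB by (simp add: d_def dist_norm)
    next
      case 2
      then show ?thesis
        using that[of 1 B] AB by (simp add: d_def dist_norm)
    qed
    have ent: "\<bar>G n x $ i $ j - \<xi> $ i $ j\<bar> \<le> d n x" for i j
      using matrix_entry_le[of "G n x - \<xi>" i j] by (simp add: \<xi>(1))
    have dn: "0 \<le> d n x"
      by (simp add: d_def infdist_nonneg)
    have sc: "\<bar>t / a\<bar> \<le> 1 / \<bar>a\<bar> * d n x" "\<bar>t / b\<bar> \<le> 1 / \<bar>b\<bar> * d n x" if "\<bar>t\<bar> \<le> d n x" for t
      using that by (auto simp: divide_right_mono)
    have split: "\<kappa> * d n x = 1 / \<bar>a\<bar> * d n x + 1 / \<bar>b\<bar> * d n x" "0 \<le> 1 / \<bar>a\<bar> * d n x" "0 \<le> 1 / \<bar>b\<bar> * d n x"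
      using dn by (simp_all add: \<kappa>_def distrib_right)
    have "P - \<sigma> = (G n x $ 1 $ 1 - \<xi> $ 1 $ 1) / a" "Q - \<sigma> = (G n x $ 3 $ 3 - \<xi> $ 3 $ 3) / b"
      using ab by (simp_all add: P_def Q_def \<xi> field_simps)
    then have PQ: "\<bar>P - \<sigma>\<bar> \<le> 1 / \<bar>a\<bar> * d n x" "\<bar>Q - \<sigma>\<bar> \<le> 1 / \<bar>b\<bar> * d n x"
      using sc ent by metis+
    have "\<bar>P - Q\<bar> \<le> \<kappa> * d n x"
      using PQ split by linarith
    then show "\<bar>(\<gamma> n 1 x - 1) / a - (\<eta> n 3 x / h n - 1) / b\<bar> \<le> \<kappa> * d n x"
      by (simp only: entries P_def Q_def)
    have off: "\<bar>G n x $ 1 $ 3\<bar> \<le> d n x" "\<bar>G n x $ 3 $ 1\<bar> \<le> d n x" "\<bar>G n x $ 3 $ 2\<bar> \<le> d n x"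
      using ent[of 1 3] ent[of 3 1] ent[of 3 2] by (simp_all only: \<xi>(3-5) diff_zero)
    have "\<bar>G n x $ 1 $ 3 / a\<bar> \<le> \<kappa> * d n x"
      using sc(1)[OF off(1)] split by linarith
    moreover have "\<gamma> n 3 x / (a * h n) = G n x $ 1 $ 3 / a"
      by (simp flip: entries(2))
    ultimately show "\<bar>\<gamma> n 3 x / (a * h n)\<bar> \<le> \<kappa> * d n x"
      by (simp only:)
    show "\<bar>\<eta> n 1 x / b\<bar> \<le> \<kappa> * d n x" "\<bar>\<eta> n 2 x / b\<bar> \<le> \<kappa> * d n x"
      using sc(2)[OF off(2)] sc(2)[OF off(3)] split unfolding entries by linarith+
    have "min \<bar>P\<bar> \<bar>P - 1\<bar> \<le> \<kappa> * d n x"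
    proof -
      have "\<bar>P - \<sigma>\<bar> \<le> \<kappa> * d n x"
        using PQ(1) split by linarith
      then show ?thesis
        using \<sigma> by (auto simp: min_le_iff_disj)
    qed
    then show "min \<bar>(\<gamma> n 1 x - 1) / a\<bar> \<bar>(\<gamma> n 1 x - 1) / a - 1\<bar> \<le> \<kappa> * d n x"
      by (simp only: entries P_def)
  qed
  \<comment> \<open>\<open>weak_deriv\<close> picks a representative known only to be locally
    integrable. Its square integrability is drawn from the energy: the gradient is within
    \<open>d n x\<close> of a bounded set.\<close>
  have Gint: "integrable (lebesgue_on \<Omega>) (\<lambda>x. (G n x $ i $ j)\<^sup>2)" for n i j
  proof (rule Bochner_Integration.integrable_bound)
    define N where "N = norm A + norm B"
    show "integrable (lebesgue_on \<Omega>) (\<lambda>x. 2 * (d n x)\<^sup>2 + 2 * N\<^sup>2)"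
      by (intro Bochner_Integration.integrable_add integrable_mult_right dint integrable_const_lebesgue_on \<Omega>L)
    show "(\<lambda>x. (G n x $ i $ j)\<^sup>2) \<in> borel_measurable (lebesgue_on \<Omega>)"
      by (rule borel_measurable_power[OF Gentry])
    have "(G n x $ i $ j)\<^sup>2 \<le> 2 * (d n x)\<^sup>2 + 2 * N\<^sup>2" for x
    proof -
      have "norm (G n x) \<le> d n x + N"
      proof (cases rule: infdist_pair[of "G n x" A B])
        case 1
        then show ?thesis
          using norm_triangle_ineq[of "G n x - A" A] by (simp add: d_def dist_norm N_def) (smt (verit) norm_ge_zero)
      next
        case 2
        then show ?thesis
          using norm_triangle_ineq[of "G n x - B" B] by (simp add: d_def dist_norm N_def) (smt (verit) norm_ge_zero)
      qed
      then have "\<bar>G n x $ i $ j\<bar> \<le> d n x + N"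
        using matrix_entry_le[of "G n x" i j] by linarith
      then have "\<bar>G n x $ i $ j\<bar>\<^sup>2 \<le> (d n x + N)\<^sup>2"
        by (intro power_mono) auto
      also have "\<dots> \<le> 2 * (d n x)\<^sup>2 + 2 * N\<^sup>2"
        using zero_le_power2[of "d n x - N"] by (simp add: power2_eq_square algebra_simps)
      finally show ?thesis
        by simp
    qed
    then show "AE x in lebesgue_on \<Omega>. norm ((G n x $ i $ j)\<^sup>2) \<le> norm (2 * (d n x)\<^sup>2 + 2 * N\<^sup>2)"
      by (intro AE_I2) (auto intro: order_trans[OF _ abs_ge_self])
  qed
  have wd_entry: "weak_deriv \<Omega> [j] (u n) x $ i = (if j = 3 then h n else 1) * G n x $ i $ j" for n i j x
  proof -
    have "h n \<noteq> 0"
      using h(1) by (metis less_irrefl)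
    then show ?thesis
      by (simp add: G_def scaled_grad_def)
  qed
  have L2: "integrable (lebesgue_on \<Omega>) (\<lambda>x. (\<gamma> n j x)\<^sup>2)" "integrable (lebesgue_on \<Omega>) (\<lambda>x. (\<eta> n j x)\<^sup>2)" for n j
    unfolding \<gamma>_def \<eta>_def wd_entry power_mult_distrib by (intro integrable_mult_right Gint)+
  have weak': "has_weak_deriv \<Omega> [j] (\<lambda>x. u n x $ 1) (\<gamma> n j)" "has_weak_deriv \<Omega> [j] (\<lambda>x. u n x $ 3) (\<eta> n j)" for n j
    unfolding \<gamma>_def[abs_def] \<eta>_def[abs_def] by (intro has_weak_deriv_component weak \<Omega>L)+
  have \<delta>lim: "\<delta> \<longlonglongrightarrow> 0" "(\<lambda>n. \<delta> n / h n) \<longlonglongrightarrow> 0"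
  proof -
    have "(\<lambda>n. \<kappa>\<^sup>2 * (C * \<epsilon> n * (M + 1))) \<longlonglongrightarrow> \<kappa>\<^sup>2 * (C * 0 * (M + 1))"
      by (intro tendsto_intros \<epsilon>)
    then show "\<delta> \<longlonglongrightarrow> 0"
      by (simp add: \<delta>_def[abs_def])
    have "(\<lambda>n. inverse (h n / \<epsilon> n)) \<longlonglongrightarrow> 0"
      by (rule tendsto_inverse_0_at_top[OF regime])
    \<comment> \<open>Here the regime enters: \<open>\<delta> n\<close> is a constant multiple of
      \<open>\<epsilon> n\<close>, so \<open>\<delta> n / h n\<close> is one of
      \<open>\<epsilon> n / h n\<close>.\<close>
    then have "(\<lambda>n. (\<kappa>\<^sup>2 * C * (M + 1)) * inverse (h n / \<epsilon> n)) \<longlonglongrightarrow> (\<kappa>\<^sup>2 * C * (M + 1)) * 0"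
      by (intro tendsto_intros)
    moreover have "(\<kappa>\<^sup>2 * C * (M + 1)) * inverse (h n / \<epsilon> n) = \<delta> n / h n" for n
      by (simp add: \<delta>_def divide_inverse mult_ac)
    ultimately show "(\<lambda>n. \<delta> n / h n) \<longlonglongrightarrow> 0"
      by (simp only: mult_zero_right)
  qed
  have loc: "\<exists>r>0. cbox (p - vec r) (p + vec r) \<subseteq> \<Omega> \<and>
      (\<lambda>n. (LINT x|lebesgue_on (cbox (p - vec r) (p + vec r)). \<Theta> n x)
         * (LINT x|lebesgue_on (cbox (p - vec r) (p + vec r)). 1 - \<Theta> n x)) \<longlonglongrightarrow> 0"
    if p: "p \<in> \<Omega>" for p
  proof -
    obtain s where s: "0 < s" "cbox (p - vec s) (p + vec s) \<subseteq> \<Omega>"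
      using centered_cbox_subset_open[OF geom(3) p] by blast
    \<comment> \<open>A third of \<open>s\<close> leaves the positive margin
      \<open>s - 2 * r\<close> around the double cube for mollification; 1/4 bounds the height
      \<open>4 * r\<close> of the weight by 1.\<close>
    define r where "r = min (s / 3) (1 / 4)"
    have r: "0 < r" "4 * r \<le> 1" "0 < s - 2 * r" "r \<le> s"
      using s(1) by (auto simp: r_def min_def)
    have box: "cbox (p - vec (2 * r) - vec (s - 2 * r)) (p + vec (2 * r) + vec (s - 2 * r)) \<subseteq> \<Omega>"
    proof -
      have "p - vec (2 * r) - vec (s - 2 * r) = p - vec s" "p + vec (2 * r) + vec (s - 2 * r) = p + vec s"
        by (simp_all add: vec_eq_iff)
      then show ?thesis
        using s(2) by (simp only:)
    qed
    let ?B = "cbox (p - vec r) (p + vec r)"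
    let ?c = "6 / (4 * r)\<^sup>2"
    let ?P = "\<lambda>n. (LINT x|lebesgue_on ?B. \<Theta> n x) * (LINT x|lebesgue_on ?B. 1 - \<Theta> n x)"
    have "?B \<subseteq> cbox (p - vec s) (p + vec s)"
    proof
      fix w assume w: "w \<in> ?B"
      have "p$i - s \<le> w$i \<and> w$i \<le> p$i + s" for i
        using w r(4) by (auto simp: mem_box_cart dest!: spec[of _ i])
      then show "w \<in> cbox (p - vec s) (p + vec s)"
        by (simp add: mem_box_cart)
    qed
    then have sub: "?B \<subseteq> \<Omega>"
      using s(2) by blast
    have "?P \<longlonglongrightarrow> 0"
    proof (rule tendsto_sandwich[OF _ _ tendsto_const])
      have "0 \<le> ?P n" for n
        by (intro mult_nonneg_nonneg Bochner_Integration.integral_nonneg; simp add: \<Theta>_range)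
      then show "\<forall>\<^sub>F n in sequentially. 0 \<le> ?P n"
        by (intro always_eventually allI)
      have "\<forall>\<^sub>F n in sequentially. h n < r"
        by (rule order_tendstoD(2)[OF h(2) r(1)])
      then show "\<forall>\<^sub>F n in sequentially. ?P n
          \<le> (1200 * ?c^3 + 1000 * ?c\<^sup>2) * (51 * \<delta> n / h n + sqrt (51 * \<delta> n)) + 4 / \<bar>a\<bar> * \<delta> n"
      proof eventually_elim
        case (elim n)
        have Dm: "(\<lambda>x. \<kappa> * d n x) \<in> borel_measurable (lebesgue_on \<Omega>)"
          by (intro borel_measurable_times borel_measurable_const dmeas)
        have "h n \<le> r" "0 < h n"
          using elim h(1) by simp_all
        from film_separation[OF geom(3) r(1,2,3) box this(2,1) ab \<delta> weak' L2 Dm D2 near]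
        show ?case
          unfolding \<Theta>_def entries .
      qed
      have "(\<lambda>n. (1200 * ?c^3 + 1000 * ?c\<^sup>2) * (51 * (\<delta> n / h n) + sqrt (51 * \<delta> n)) + 4 / \<bar>a\<bar> * \<delta> n)
          \<longlonglongrightarrow> (1200 * ?c^3 + 1000 * ?c\<^sup>2) * (51 * 0 + sqrt (51 * 0)) + 4 / \<bar>a\<bar> * 0"
        by (intro tendsto_add tendsto_mult tendsto_const tendsto_real_sqrt \<delta>lim)
      then show "(\<lambda>n. (1200 * ?c^3 + 1000 * ?c\<^sup>2) * (51 * \<delta> n / h n + sqrt (51 * \<delta> n)) + 4 / \<bar>a\<bar> * \<delta> n) \<longlonglongrightarrow> 0"
        by simp
    qed
    then show ?thesis
      using r(1) sub by blast
  qed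
  have \<Theta>int: "integrable (lebesgue_on \<Omega>) (\<Theta> n)" for n
    by (intro integrable_density \<Omega>L order_refl)
  define K where "K = 2 + 8 * (norm (B - A))\<^sup>2 / a\<^sup>2 + 4 * (norm (B - A))\<^sup>2"
  have dist: "(norm (G n x - A))\<^sup>2 \<le> K * ((d n x)\<^sup>2 + \<Theta> n x)"
    "(norm (G n x - B))\<^sup>2 \<le> K * ((d n x)\<^sup>2 + (1 - \<Theta> n x))" for n x
    unfolding K_def d_def \<Theta>_def by (intro well_distance ab AB)+
  show ?thesis
  proof (rule unit_densities_dichotomy[OF unit_densities_axioms loc])
    fix \<sigma> :: "nat \<Rightarrow> nat"
    assume \<sigma>: "strict_mono \<sigma>" "(\<lambda>n. LINT x|lebesgue_on \<Omega>. \<Theta> (\<sigma> n) x) \<longlonglongrightarrow> 0"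
    have "L2_tendsto \<Omega> (\<lambda>n. G (\<sigma> n)) (\<lambda>x. A)"
      using LIMSEQ_subseq_LIMSEQ[OF dlim \<sigma>(1)]
      by (intro L2_tendsto_well[OF \<Omega>L(1) G dint(1) _ \<Theta>int \<sigma>(2) dist(1)]) (simp add: o_def)
    then show ?thesis
      using \<sigma>(1) unfolding G_def by blast
  next
    fix \<sigma> :: "nat \<Rightarrow> nat"
    assume \<sigma>: "strict_mono \<sigma>" "(\<lambda>n. LINT x|lebesgue_on \<Omega>. 1 - \<Theta> (\<sigma> n) x) \<longlonglongrightarrow> 0"
    have "L2_tendsto \<Omega> (\<lambda>n. G (\<sigma> n)) (\<lambda>x. B)"
      using LIMSEQ_subseq_LIMSEQ[OF dlim \<sigma>(1)]
      by (intro L2_tendsto_well[OF \<Omega>L(1) G dint(1) _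
            Bochner_Integration.integrable_diff[OF integrable_const_lebesgue_on(1)[OF \<Omega>L(1)] \<Theta>int] \<sigma>(2) dist(2)])
        (simp add: o_def)
    then show ?thesis
      using \<sigma>(1) unfolding G_def by blast
  qed
qed

end
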